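(* Let $x\in B_n$ with canonical length $\ell(x)>1$ be conjugate to a left rigid braid. Then $USG_L(x)$ and $USG_R(x)^{op}$ are isomorphic directed graphs.
   Context: $B_n$ is the braid group with standard (Artin) generators $\sigma_1,\dots,\sigma_{n-1}$; $B_n^+$ is the submonoid they generate (positive braids); $\Delta=\sigma_1(\sigma_2\sigma_1)\cdots(\sigma_{n-1}\cdots\sigma_1)$. Write $a\preccurlyeq b$ if $a^{-1}b\in B_n^+$ and $a\succcurlyeq b$ if $ab^{-1}\in B_n^+$; both are lattice orders, with gcd's $\wedge_L$ (for $\preccurlyeq$) and $\wedge_R$ (for $\succcurlyeq$). Simple braids are the $s$ with $1\preccurlyeq s\preccurlyeq\Delta$. Put $\tau(g)=\Delta^{-1}g\Delta$. Left normal form: $x=\Delta^p x_1\cdots x_r$ with $p$ maximal such that $\Delta^{-p}x$ is positive and $x_i=(x_i\cdots x_r)\wedge_L\Delta\ne1$ for all $i$. Right normal form: $x=y_1\cdots y_r\Delta^p$ with $p$ maximal such that $x\Delta^{-p}$ is positive and $y_i=(y_1\cdots y_i)\wedge_R\Delta\neq1$ for all $i$. Both exist, are unique, and have the same $p,r$; $\ell(x)=r$. If $r>0$, $\iota_L(x)=\tau^{-p}(x_1)$ and $\iota_R(x)=\tau^{p}(y_r)$; if $r=0$ both are $1$. Cyclings: $\mathbf c_L(x)=\iota_L(x)^{-1}x\,\iota_L(x)$, $\mathbf c_R(x)=\iota_R(x)\,x\,\iota_R(x)^{-1}$. $x$ is left rigid if $r>0$ and $\Delta^p x_1\cdots x_r\,\iota_L(x)$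 is in left normal form as written. $SSS(x)$ is the set of conjugates of $x$ of minimal canonical length; $USS_L(x)=\{y\in SSS(x): \mathbf c_L^t(y)=y \text{ for some } t\ge1\}$ and $USS_R(x)=\{y\in SSS(x): \mathbf c_R^t(y)=y\text{ for some }t\ge1\}$. $USG_L(x)$ is the directed graph with vertex set $USS_L(x)$, with an arrow labeled by the simple braid $s$ from $u$ to $v$ iff $s^{-1}us=v$. $USG_R(x)$ is the directed graph with vertex set $USS_R(x)$, with an arrow labeled by the simple braid $s$ from $u$ to $v$ iff $sus^{-1}=v$. $USG_R(x)^{op}$ is $USG_R(x)$ with all arrows reversed. Isomorphism of directed graphs means bijections on vertices and on arrows compatible with source and target (labels need not be preserved). *)

theory Defs
  imports "HOL-Algebra.Group" "Graph_Theory.Digraph_Isomorphism"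
begin

section \<open>The braid group on n strands\<close>

text \<open>
  The Artin presentation: words in the letters \<open>(i, True)\<close>, standing for the generator
  \<open>sigma_i\<close>, and \<open>(i, False)\<close>, standing for its inverse, modulo the congruence generated by free
  cancellation and the braid relations.
\<close>

type_synonym braid_word = "(nat \<times> bool) list"

type_synonym braid = "braid_word set"

definition braid_words :: "nat \<Rightarrow> braid_word set" where
  "braid_words n = lists ({1..<n} \<times> UNIV)"

inductive braid_eq :: "nat \<Rightarrow> braid_word \<Rightarrow> braid_word \<Rightarrow> bool" for n where
  refl: "w \<in> braid_words n \<Longrightarrow> braid_eq n w w"
| sym: "braid_eq n v w \<Longrightarrow> braid_eq n w v"
| trans: "braid_eq n u v \<Longrightarrow> braid_eq n v w \<Longrightarrow> braid_eq n u w"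
| append: "braid_eq n u u' \<Longrightarrow> braid_eq n v v' \<Longrightarrow> braid_eq n (u @ v) (u' @ v')"
| cancel: "i \<in> {1..<n} \<Longrightarrow> braid_eq n [(i, e), (i, \<not> e)] []"
| commute: "i \<in> {1..<n} \<Longrightarrow> j \<in> {1..<n} \<Longrightarrow> i + 2 \<le> j \<Longrightarrow>
    braid_eq n [(i, True), (j, True)] [(j, True), (i, True)]"
| braid: "i \<in> {1..<n} \<Longrightarrow> Suc i \<in> {1..<n} \<Longrightarrow>
    braid_eq n [(i, True), (Suc i, True), (i, True)] [(Suc i, True), (i, True), (Suc i, True)]"

definition braid_rel :: "nat \<Rightarrow> (braid_word \<times> braid_word) set" where
  "braid_rel n = {(v, w). braid_eq n v w}"

definition braid_class :: "nat \<Rightarrow> braid_word \<Rightarrow> braid" where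
  "braid_class n w = braid_rel n `` {w}"

definition braid_group :: "nat \<Rightarrow> braid monoid" (\<open>\<B>\<close>) where
  "\<B> n = \<lparr>carrier = braid_words n // braid_rel n,
         monoid.mult = (\<lambda>X Y. \<Union>v\<in>X. \<Union>w\<in>Y. braid_class n (v @ w)),
         monoid.one = braid_class n []\<rparr>"

lemma braid_eq_words:
  assumes "braid_eq n v w"
  shows "v \<in> braid_words n" "w \<in> braid_words n"
  using assms by (induction rule: braid_eq.induct) (auto simp: braid_words_def)

lemma equiv_braid_rel: "equiv (braid_words n) (braid_rel n)"
proof (rule equivI)
  show "braid_rel n \<subseteq> braid_words n \<times> braid_words n"
    by (auto simp: braid_rel_def dest: braid_eq_words)
  show "refl_on (braid_words n) (braid_rel n)"
    by (auto simp: braid_rel_def refl_on_def intro: braid_eq.refl)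
  show "sym (braid_rel n)"
    by (rule symI) (simp add: braid_rel_def braid_eq.sym)
  show "trans (braid_rel n)"
    by (rule transI) (simp add: braid_rel_def, rule braid_eq.trans)
qed

lemma braid_class_eq_iff:
  assumes "v \<in> braid_words n" "w \<in> braid_words n"
  shows "braid_class n v = braid_class n w \<longleftrightarrow> braid_eq n v w"
  unfolding braid_class_def
  using eq_equiv_class_iff[OF equiv_braid_rel assms] by (simp add: braid_rel_def)

lemma carrier_braid_group: "carrier (\<B> n) = braid_class n ` braid_words n"
  by (auto simp: braid_group_def quotient_def braid_class_def)

lemma braid_class_mult:
  assumes "v \<in> braid_words n" "w \<in> braid_words n"
  shows "braid_class n v \<otimes>\<^bsub>\<B> n\<^esub> braid_class n w = braid_class n (v @ w)"
proof -
  have "braid_class n (v' @ w') = braid_class n (v @ w)"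
    if "v' \<in> braid_class n v" "w' \<in> braid_class n w" for v' w'
  proof -
    have "braid_eq n v v'" "braid_eq n w w'"
      using that by (auto simp: braid_class_def braid_rel_def)
    then have *: "braid_eq n (v @ w) (v' @ w')"
      by (rule braid_eq.append)
    show ?thesis
      using braid_class_eq_iff[OF braid_eq_words[OF *]] * by simp
  qed
  moreover have "v \<in> braid_class n v" "w \<in> braid_class n w"
    using assms by (auto simp: braid_class_def braid_rel_def intro: braid_eq.refl)
  ultimately have "(\<Union>v'\<in>braid_class n v. \<Union>w'\<in>braid_class n w. braid_class n (v' @ w')) =
      braid_class n (v @ w)"
    by blast
  then show ?thesis
    by (simp add: braid_group_def)
qed

lemma braid_eq_inverse_word:
  assumes "w \<in> braid_words n"
  shows "braid_eq n (map (\<lambda>(i, e). (i, \<not> e)) (rev w) @ w) []"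
  using assms
proof (induction w)
  case Nil
  then show ?case by (auto intro: braid_eq.refl)
next
  case (Cons a w)
  obtain i e where a: "a = (i, e)" by fastforce
  let ?u = "map (\<lambda>(i, e). (i, \<not> e)) (rev w)"
  have w: "w \<in> braid_words n" "i \<in> {1..<n}"
    using Cons.prems a by (auto simp: braid_words_def)
  then have u: "?u \<in> braid_words n"
    by (fastforce simp: braid_words_def)
  have "braid_eq n [(i, \<not> e), (i, e)] []"
    using braid_eq.cancel[OF w(2), of "\<not> e"] by simp
  then have "braid_eq n ([(i, \<not> e), (i, e)] @ w) ([] @ w)"
    using w braid_eq.append braid_eq.refl by metis
  then have "braid_eq n (?u @ ([(i, \<not> e), (i, e)] @ w)) (?u @ ([] @ w))"
    using u braid_eq.append braid_eq.refl by metis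
  then show ?case
    using Cons.IH[OF w(1)] braid_eq.trans by (auto simp: a)
qed

lemma group_braid_group: "group (\<B> n)"
proof (rule groupI)
  have one: "\<one>\<^bsub>\<B> n\<^esub> = braid_class n []" "[] \<in> braid_words n"
    by (auto simp: braid_group_def braid_words_def)
  have app: "v @ w \<in> braid_words n" if "v \<in> braid_words n" "w \<in> braid_words n" for v w
    using that by (auto simp: braid_words_def)
  show "x \<otimes>\<^bsub>\<B> n\<^esub> y \<in> carrier (\<B> n)" if "x \<in> carrier (\<B> n)" "y \<in> carrier (\<B> n)" for x y
    using that app by (auto simp: carrier_braid_group braid_class_mult)
  show "\<one>\<^bsub>\<B> n\<^esub> \<in> carrier (\<B> n)"
    using one by (auto simp: carrier_braid_group)
  show "x \<otimes>\<^bsub>\<B> n\<^esub> y \<otimes>\<^bsub>\<B> n\<^esub> z = x \<otimes>\<^bsub>\<B> n\<^esub> (y \<otimes>\<^bsub>\<B> n\<^esub> z)"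
    if "x \<in> carrier (\<B> n)" "y \<in> carrier (\<B> n)" "z \<in> carrier (\<B> n)" for x y z
    using that app by (auto simp: carrier_braid_group braid_class_mult)
  show "\<one>\<^bsub>\<B> n\<^esub> \<otimes>\<^bsub>\<B> n\<^esub> x = x" if "x \<in> carrier (\<B> n)" for x
    using that one by (auto simp: carrier_braid_group braid_class_mult)
  show "\<exists>y\<in>carrier (\<B> n). y \<otimes>\<^bsub>\<B> n\<^esub> x = \<one>\<^bsub>\<B> n\<^esub>" if x: "x \<in> carrier (\<B> n)" for x
  proof -
    obtain w where w: "w \<in> braid_words n" "x = braid_class n w"
      using x by (auto simp: carrier_braid_group)
    let ?u = "map (\<lambda>(i, e). (i, \<not> e)) (rev w)"
    have u: "?u \<in> braid_words n"
      using w(1) by (fastforce simp: braid_words_def)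
    have "braid_class n ?u \<otimes>\<^bsub>\<B> n\<^esub> x = \<one>\<^bsub>\<B> n\<^esub>"
      using u w one app braid_eq_inverse_word[OF w(1)]
      by (simp add: braid_class_mult braid_class_eq_iff)
    then show ?thesis
      using u by (auto simp: carrier_braid_group)
  qed
qed

definition sigma :: "nat \<Rightarrow> nat \<Rightarrow> braid" where
  "sigma n i = braid_class n [(i, True)]"

inductive_set positive_braids :: "nat \<Rightarrow> braid set" for n where
  one: "\<one>\<^bsub>\<B> n\<^esub> \<in> positive_braids n"
| gen: "i \<in> {1..<n} \<Longrightarrow> sigma n i \<in> positive_braids n"
| mult: "a \<in> positive_braids n \<Longrightarrow> b \<in> positive_braids n \<Longrightarrow>
    a \<otimes>\<^bsub>\<B> n\<^esub> b \<in> positive_braids n"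

definition braid_prod :: "nat \<Rightarrow> braid list \<Rightarrow> braid" where
  "braid_prod n xs = foldr (\<lambda>a b. a \<otimes>\<^bsub>\<B> n\<^esub> b) xs \<one>\<^bsub>\<B> n\<^esub>"

definition Delta :: "nat \<Rightarrow> braid" where
  "Delta n = braid_prod n (map (\<lambda>k. braid_prod n (map (sigma n) (rev [1..<Suc k]))) [1..<n])"


section \<open>The two Garside lattice orders\<close>

definition prefix_order :: "nat \<Rightarrow> braid gorder" where
  "prefix_order n = \<lparr>carrier = carrier (\<B> n), eq = (=),
     le = (\<lambda>a b. inv\<^bsub>\<B> n\<^esub> a \<otimes>\<^bsub>\<B> n\<^esub> b \<in> positive_braids n)\<rparr>"

text \<open>
  The suffix order is oriented so that \<open>le a b\<close> means that \<open>a\<close> right-divides \<open>b\<close>; its meet is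
  therefore the greatest common right divisor.
\<close>

definition suffix_order :: "nat \<Rightarrow> braid gorder" where
  "suffix_order n = \<lparr>carrier = carrier (\<B> n), eq = (=),
     le = (\<lambda>a b. b \<otimes>\<^bsub>\<B> n\<^esub> inv\<^bsub>\<B> n\<^esub> a \<in> positive_braids n)\<rparr>"

definition simple_braids :: "nat \<Rightarrow> braid set" where
  "simple_braids n = {s \<in> carrier (\<B> n).
     \<one>\<^bsub>\<B> n\<^esub> \<sqsubseteq>\<^bsub>prefix_order n\<^esub> s \<and> s \<sqsubseteq>\<^bsub>prefix_order n\<^esub> Delta n}"

definition tau :: "nat \<Rightarrow> braid \<Rightarrow> braid" where
  "tau n g = inv\<^bsub>\<B> n\<^esub> (Delta n) \<otimes>\<^bsub>\<B> n\<^esub> g \<otimes>\<^bsub>\<B> n\<^esub> Delta n"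

text \<open>The integer powers of the automorphism \<^const>\<open>tau\<close>.\<close>

definition tau_pow :: "nat \<Rightarrow> int \<Rightarrow> braid \<Rightarrow> braid" where
  "tau_pow n k g = Delta n [^]\<^bsub>\<B> n\<^esub> (- k) \<otimes>\<^bsub>\<B> n\<^esub> g \<otimes>\<^bsub>\<B> n\<^esub> Delta n [^]\<^bsub>\<B> n\<^esub> k"

lemma sigma_closed: "i \<in> {1..<n} \<Longrightarrow> sigma n i \<in> carrier (\<B> n)"
  by (auto simp: sigma_def carrier_braid_group braid_words_def)

lemma braid_prod_closed: "set xs \<subseteq> carrier (\<B> n) \<Longrightarrow> braid_prod n xs \<in> carrier (\<B> n)"
proof -
  interpret group "\<B> n" by (rule group_braid_group)
  show "set xs \<subseteq> carrier (\<B> n) \<Longrightarrow> braid_prod n xs \<in> carrier (\<B> n)"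
    by (induction xs) (auto simp: braid_prod_def)
qed

lemma Delta_closed: "Delta n \<in> carrier (\<B> n)"
proof -
  have "set (map (sigma n) (rev [1..<Suc k])) \<subseteq> carrier (\<B> n)" if "k < n" for k
    using that by (force intro: sigma_closed simp del: upt_Suc)
  then have "braid_prod n (map (sigma n) (rev [1..<Suc k])) \<in> carrier (\<B> n)" if "k < n" for k
    using that by (blast intro: braid_prod_closed)
  then show ?thesis
    unfolding Delta_def by (intro braid_prod_closed) (force simp del: upt_Suc)
qed

lemma tau_pow_0:
  assumes "g \<in> carrier (\<B> n)"
  shows "tau_pow n 0 g = g"
proof -
  interpret group "\<B> n" by (rule group_braid_group)
  show ?thesis
    unfolding tau_pow_def minus_zero int_pow_0 using assms by (simp only: l_one r_one inv_one one_closed)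
qed

lemma tau_pow_succ:
  assumes "g \<in> carrier (\<B> n)"
  shows "tau_pow n (k + 1) g = tau n (tau_pow n k g)"
proof -
  interpret group "\<B> n" by (rule group_braid_group)
  have assoc: "(d' \<otimes>\<^bsub>\<B> n\<^esub> p) \<otimes>\<^bsub>\<B> n\<^esub> g \<otimes>\<^bsub>\<B> n\<^esub> (q \<otimes>\<^bsub>\<B> n\<^esub> d) =
      d' \<otimes>\<^bsub>\<B> n\<^esub> (p \<otimes>\<^bsub>\<B> n\<^esub> g \<otimes>\<^bsub>\<B> n\<^esub> q) \<otimes>\<^bsub>\<B> n\<^esub> d"
    if "d \<in> carrier (\<B> n)" "d' \<in> carrier (\<B> n)" "p \<in> carrier (\<B> n)" "q \<in> carrier (\<B> n)" for d d' p q
    using that assms by (simp only: m_assoc m_closed)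
  have "Delta n [^]\<^bsub>\<B> n\<^esub> (- (k + 1)) = inv\<^bsub>\<B> n\<^esub> (Delta n) \<otimes>\<^bsub>\<B> n\<^esub> Delta n [^]\<^bsub>\<B> n\<^esub> (- k)"
    using int_pow_mult[OF Delta_closed, of "- 1" "- k"]
    by (simp only: int_pow_neg int_pow_1 Delta_closed minus_add_distrib add.commute)
  moreover have "Delta n [^]\<^bsub>\<B> n\<^esub> (k + 1) = Delta n [^]\<^bsub>\<B> n\<^esub> k \<otimes>\<^bsub>\<B> n\<^esub> Delta n"
    using int_pow_mult[OF Delta_closed, of k 1] by (simp only: int_pow_1 Delta_closed)
  ultimately show ?thesis
    unfolding tau_pow_def tau_def
    by (simp only: assoc Delta_closed inv_closed int_pow_closed)
qed


section \<open>Normal forms, cyclings, rigidity\<close>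

definition is_left_normal_form :: "nat \<Rightarrow> braid \<Rightarrow> int \<Rightarrow> braid list \<Rightarrow> bool" where
  "is_left_normal_form n x p xs \<longleftrightarrow>
     x \<in> carrier (\<B> n) \<and> set xs \<subseteq> carrier (\<B> n) \<and>
     x = Delta n [^]\<^bsub>\<B> n\<^esub> p \<otimes>\<^bsub>\<B> n\<^esub> braid_prod n xs \<and>
     Delta n [^]\<^bsub>\<B> n\<^esub> (- p) \<otimes>\<^bsub>\<B> n\<^esub> x \<in> positive_braids n \<and>
     (\<forall>q::int. Delta n [^]\<^bsub>\<B> n\<^esub> (- q) \<otimes>\<^bsub>\<B> n\<^esub> x \<in> positive_braids n \<longrightarrow> q \<le> p) \<and>
     (\<forall>i<length xs. xs ! i = braid_prod n (drop i xs) \<sqinter>\<^bsub>prefix_order n\<^esub> Delta n \<and>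
        xs ! i \<noteq> \<one>\<^bsub>\<B> n\<^esub>)"

definition is_right_normal_form :: "nat \<Rightarrow> braid \<Rightarrow> braid list \<Rightarrow> int \<Rightarrow> bool" where
  "is_right_normal_form n x ys p \<longleftrightarrow>
     x \<in> carrier (\<B> n) \<and> set ys \<subseteq> carrier (\<B> n) \<and>
     x = braid_prod n ys \<otimes>\<^bsub>\<B> n\<^esub> Delta n [^]\<^bsub>\<B> n\<^esub> p \<and>
     x \<otimes>\<^bsub>\<B> n\<^esub> Delta n [^]\<^bsub>\<B> n\<^esub> (- p) \<in> positive_braids n \<and>
     (\<forall>q::int. x \<otimes>\<^bsub>\<B> n\<^esub> Delta n [^]\<^bsub>\<B> n\<^esub> (- q) \<in> positive_braids n \<longrightarrow> q \<le> p) \<and>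
     (\<forall>i<length ys. ys ! i = braid_prod n (take (Suc i) ys) \<sqinter>\<^bsub>suffix_order n\<^esub> Delta n \<and>
        ys ! i \<noteq> \<one>\<^bsub>\<B> n\<^esub>)"

definition left_normal_form :: "nat \<Rightarrow> braid \<Rightarrow> int \<times> braid list" where
  "left_normal_form n x = (THE (p, xs). is_left_normal_form n x p xs)"

definition right_normal_form :: "nat \<Rightarrow> braid \<Rightarrow> braid list \<times> int" where
  "right_normal_form n x = (THE (ys, p). is_right_normal_form n x ys p)"

definition canonical_length :: "nat \<Rightarrow> braid \<Rightarrow> nat" where
  "canonical_length n x = length (snd (left_normal_form n x))"

definition iota_L :: "nat \<Rightarrow> braid \<Rightarrow> braid" where
  "iota_L n x = (case left_normal_form n x of
     (p, xs) \<Rightarrow> if xs = [] then \<one>\<^bsub>\<B> n\<^esub> else tau_pow n (- p) (hd xs))"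

definition iota_R :: "nat \<Rightarrow> braid \<Rightarrow> braid" where
  "iota_R n x = (case right_normal_form n x of
     (ys, p) \<Rightarrow> if ys = [] then \<one>\<^bsub>\<B> n\<^esub> else tau_pow n p (last ys))"

definition cycling_L :: "nat \<Rightarrow> braid \<Rightarrow> braid" where
  "cycling_L n x = inv\<^bsub>\<B> n\<^esub> (iota_L n x) \<otimes>\<^bsub>\<B> n\<^esub> x \<otimes>\<^bsub>\<B> n\<^esub> iota_L n x"

definition cycling_R :: "nat \<Rightarrow> braid \<Rightarrow> braid" where
  "cycling_R n x = iota_R n x \<otimes>\<^bsub>\<B> n\<^esub> x \<otimes>\<^bsub>\<B> n\<^esub> inv\<^bsub>\<B> n\<^esub> (iota_R n x)"

definition left_rigid :: "nat \<Rightarrow> braid \<Rightarrow> bool" where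
  "left_rigid n x \<longleftrightarrow> (case left_normal_form n x of
     (p, xs) \<Rightarrow> xs \<noteq> [] \<and>
       is_left_normal_form n
         (Delta n [^]\<^bsub>\<B> n\<^esub> p \<otimes>\<^bsub>\<B> n\<^esub> braid_prod n (xs @ [iota_L n x])) p (xs @ [iota_L n x]))"


section \<open>Ultra summit sets and graphs\<close>

definition conjugates :: "nat \<Rightarrow> braid \<Rightarrow> braid set" where
  "conjugates n x = {inv\<^bsub>\<B> n\<^esub> g \<otimes>\<^bsub>\<B> n\<^esub> x \<otimes>\<^bsub>\<B> n\<^esub> g | g. g \<in> carrier (\<B> n)}"

definition SSS :: "nat \<Rightarrow> braid \<Rightarrow> braid set" where
  "SSS n x = {y \<in> conjugates n x. \<forall>z\<in>conjugates n x. canonical_length n y \<le> canonical_length n z}"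

definition USS_L :: "nat \<Rightarrow> braid \<Rightarrow> braid set" where
  "USS_L n x = {y \<in> SSS n x. \<exists>t\<ge>1. (cycling_L n ^^ t) y = y}"

definition USS_R :: "nat \<Rightarrow> braid \<Rightarrow> braid set" where
  "USS_R n x = {y \<in> SSS n x. \<exists>t\<ge>1. (cycling_R n ^^ t) y = y}"

text \<open>An arc \<open>(u, s, v)\<close> goes from \<open>u\<close> to \<open>v\<close> and is labelled by \<open>s\<close>.\<close>

definition USG_L :: "nat \<Rightarrow> braid \<Rightarrow> (braid, braid \<times> braid \<times> braid) pre_digraph" where
  "USG_L n x = \<lparr>verts = USS_L n x,
     arcs = {(u, s, v). u \<in> USS_L n x \<and> v \<in> USS_L n x \<and> s \<in> simple_braids n \<and>
       inv\<^bsub>\<B> n\<^esub> s \<otimes>\<^bsub>\<B> n\<^esub> u \<otimes>\<^bsub>\<B> n\<^esub> s = v},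
     tail = (\<lambda>(u, s, v). u), head = (\<lambda>(u, s, v). v)\<rparr>"

definition USG_R :: "nat \<Rightarrow> braid \<Rightarrow> (braid, braid \<times> braid \<times> braid) pre_digraph" where
  "USG_R n x = \<lparr>verts = USS_R n x,
     arcs = {(u, s, v). u \<in> USS_R n x \<and> v \<in> USS_R n x \<and> s \<in> simple_braids n \<and>
       s \<otimes>\<^bsub>\<B> n\<^esub> u \<otimes>\<^bsub>\<B> n\<^esub> inv\<^bsub>\<B> n\<^esub> s = v},
     tail = (\<lambda>(u, s, v). u), head = (\<lambda>(u, s, v). v)\<rparr>"

definition op_digraph :: "('a, 'b) pre_digraph \<Rightarrow> ('a, 'b) pre_digraph" where
  "op_digraph G = \<lparr>verts = verts G, arcs = arcs G, tail = head G, head = tail G\<rparr>"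

end

theory Submission
  imports Defs
begin

text \<open>
  Everything happens in the lattice formed by \<open>B\<^sub>n\<close> and the prefix order. Fix a braid \<open>u\<close> and integers
  \<open>p < q\<close>. The maps \<open>\<alpha> g = u g \<Delta>\<^sup>-\<^sup>p\<close>, \<open>\<psi> g = u\<^sup>-\<^sup>1 g \<Delta>\<^sup>q\<close> and \<open>\<phi> g = g \<Delta>\<close> are commuting automorphisms
  of this lattice, because right multiplication by \<open>\<Delta>\<close> preserves the order, and \<open>\<alpha> \<psi> = \<phi>\<^sup>q\<^sup>-\<^sup>p\<close>.
  Let \<open>\<Delta>\<^sup>p\<close> be the greatest power of \<open>\<Delta>\<close> below a left rigid conjugate, \<open>\<Delta>\<^sup>q\<close> the least power above it.
  Put \<open>L g = \<alpha> g \<and> \<psi> g\<close>, \<open>R g = \<alpha>\<^sup>-\<^sup>1 g \<or> \<psi>\<^sup>-\<^sup>1 g\<close> and \<open>c g = \<alpha> g \<and> \<phi> g\<close>, with meets and joins of the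
  lattice. A conjugate \<open>g\<^sup>-\<^sup>1 u g\<close> is in the super summit set iff \<open>g \<preceq> L g\<close>, it is left rigid iff
  \<open>L g = g\<close>, and its left cycling is the conjugate of \<open>u\<close> by \<open>c g\<close>. Inversion of conjugating elements
  exchanges the suffix order with the reversed prefix order, so that right rigidity becomes \<open>R g = g\<close>.

  The isomorphism comes from an adjunction: \<open>R g \<preceq> h\<close> iff \<open>g \<preceq> L h\<close>. If \<open>L g = g\<close>, then \<open>R\<^sup>N g \<preceq> g\<close>, hence
  \<open>L\<^sup>N (R\<^sup>N g) \<preceq> g\<close>, and the adjunction gives the opposite inequality. The super summit set is finite, which
  forces the decreasing sequence \<open>R\<^sup>N g\<close> to become constant, and its limit is fixed by \<open>R\<close>. So \<open>R\<^sup>N\<close>,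
  for a large \<open>N\<close>, is a bijection from the left rigid conjugating elements onto the right rigid ones,
  with inverse \<open>L\<^sup>N\<close>. Both maps are monotone and commute with \<open>\<phi>\<close> and with left multiplication
  by the centralizer of \<open>u\<close>; so they respect the relation \<open>g \<preceq> g s \<preceq> g \<Delta>\<close>, which says that \<open>s\<close> is
  simple, and they descend to conjugates. This is \<open>rigid_correspondence\<close>. A simple element \<open>s\<close> leads
  from \<open>g\<close> to \<open>g s\<close> in the left graph, but from \<open>g s\<close> to \<open>g\<close> in the right one: whence the reversed arrows.

  It remains to see that for \<open>q - p \<ge> 2\<close> the ultra summit sets consist of the rigid
  conjugates. On a rigid element cycling rotates the normal form, so \<open>c\<^sup>q\<^sup>-\<^sup>p = \<alpha>\<close> there and twice
  as many cyclings bring it back. Conversely, if the cycling orbit of \<open>u\<close> closes up through \<open>c\<^sup>t 1 = z\<close>,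
  comparison with the rigid element \<open>L\<^sup>N 1\<close> above \<open>1\<close> shows that a power of \<open>c\<close> agrees with a power of \<open>\<alpha>\<close>
  at \<open>1\<close>, and expanding that power of \<open>c\<close> as a meet of the \<open>\<alpha>\<^sup>i \<phi>\<^sup>j 1\<close> yields \<open>L 1 = 1\<close>
  (\<open>cyc_periodic_imp_rigid\<close>). For \<open>q - p = 1\<close> every summit element is periodic under both cyclings,
  so both graphs live on the super summit set and differ only in the direction of the arrows.

  All this needs only that \<open>B\<^sub>n\<close> is a Garside group, the content of the locale \<open>garside_group\<close>.
  This is proved with Garside's method: an exchange lemma gives left cancellation and least common
  multiples in the monoid presented by the braid relations, a central element divisible by all
  generators embeds that monoid in \<open>B\<^sub>n\<close>, and everything is carried over to the group by multiplying with
  powers of \<open>\<Delta>\<close>. The right-handed half of the theory is the left-handed one for the opposite group.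
\<close>

section \<open>Garside groups\<close>

text \<open>
  \<open>P\<close> is the monoid of positive elements, \<open>D\<close> the Garside element, and \<open>len\<close> the exponent sum, a
  homomorphism to the integers that plays the role of a height function: chains of divisors have
  bounded length, so extremal choices and terminating descents are available. The axioms are self-dual in the sense that
  reversing products yields another Garside group (\<open>garside_group_opposite\<close>).
\<close>

locale garside_group = group G for G (structure) +
  fixes P :: "'a set" and D :: 'a and len :: "'a \<Rightarrow> int"
  assumes P_carrier: "P \<subseteq> carrier G"
    and P_one: "\<one> \<in> P"
    and P_mult: "\<lbrakk>a \<in> P; b \<in> P\<rbrakk> \<Longrightarrow> a \<otimes> b \<in> P"
    and D_P: "D \<in> P"
    and D_not_one: "D \<noteq> \<one>"
    and conj_D: "a \<in> P \<Longrightarrow> D \<otimes> a \<otimes> inv D \<in> P"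
    and conj_inv_D: "a \<in> P \<Longrightarrow> inv D \<otimes> a \<otimes> D \<in> P"
    and D2_central: "g \<in> carrier G \<Longrightarrow> D \<otimes> D \<otimes> g = g \<otimes> (D \<otimes> D)"
    and len_mult: "\<lbrakk>a \<in> carrier G; b \<in> carrier G\<rbrakk> \<Longrightarrow> len (a \<otimes> b) = len a + len b"
    and len_nonneg: "a \<in> P \<Longrightarrow> 0 \<le> len a"
    and len_zero: "\<lbrakk>a \<in> P; len a = 0\<rbrakk> \<Longrightarrow> a = \<one>"
    and finite_len: "finite {a \<in> P. len a \<le> k}"
    and left_atom: "\<lbrakk>a \<in> P; a \<noteq> \<one>\<rbrakk> \<Longrightarrow>
      \<exists>s\<in>P. s \<noteq> \<one> \<and> inv s \<otimes> a \<in> P \<and> inv s \<otimes> D \<in> P"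
    and right_atom: "\<lbrakk>a \<in> P; a \<noteq> \<one>\<rbrakk> \<Longrightarrow>
      \<exists>s\<in>P. s \<noteq> \<one> \<and> a \<otimes> inv s \<in> P \<and> D \<otimes> inv s \<in> P"
    and fraction: "g \<in> carrier G \<Longrightarrow> \<exists>k::nat. D [^] k \<otimes> g \<in> P"
    and lub_ex: "\<lbrakk>a \<in> carrier G; b \<in> carrier G\<rbrakk> \<Longrightarrow>
      \<exists>m\<in>carrier G. inv a \<otimes> m \<in> P \<and> inv b \<otimes> m \<in> P \<and>
        (\<forall>c\<in>carrier G. inv a \<otimes> c \<in> P \<longrightarrow> inv b \<otimes> c \<in> P \<longrightarrow> inv m \<otimes> c \<in> P)"
begin

abbreviation "C \<equiv> carrier G"

abbreviation div_le :: "'a \<Rightarrow> 'a \<Rightarrow> bool" (infix \<open>\<preceq>\<close> 50) where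
  "a \<preceq> b \<equiv> inv a \<otimes> b \<in> P"

lemma P_closed [simp]: "a \<in> P \<Longrightarrow> a \<in> C"
  using P_carrier by blast

declare P_one [simp]

lemma D_closed [simp]: "D \<in> C"
  using D_P by simp

lemma cancel_inv [simp]:
  assumes "a \<in> C" "b \<in> C"
  shows "inv a \<otimes> (a \<otimes> b) = b" "a \<otimes> (inv a \<otimes> b) = b"
    "b \<otimes> a \<otimes> inv a = b" "b \<otimes> inv a \<otimes> a = b"
  using assms by (simp_all add: m_assoc[symmetric]) (simp_all add: m_assoc)

lemma len_one [simp]: "len \<one> = 0"
  using len_mult[of \<one> \<one>] by simp

lemma len_inv: "a \<in> C \<Longrightarrow> len (inv a) = - len a"
  using len_mult[of a "inv a"] by simp

lemma len_D: "len D > 0"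
  using len_nonneg[OF D_P] len_zero[OF D_P] D_not_one by linarith

lemma div_refl: "a \<in> C \<Longrightarrow> a \<preceq> a"
  by (simp add: P_one)

lemma div_trans:
  assumes "a \<preceq> b" "b \<preceq> c" "a \<in> C" "b \<in> C" "c \<in> C"
  shows "a \<preceq> c"
proof -
  have "inv a \<otimes> c = (inv a \<otimes> b) \<otimes> (inv b \<otimes> c)"
    using assms by (simp add: m_assoc)
  then show ?thesis using P_mult[OF assms(1,2)] by simp
qed

lemma div_len: "a \<preceq> b \<Longrightarrow> a \<in> C \<Longrightarrow> b \<in> C \<Longrightarrow> len a \<le> len b"
  using len_nonneg[of "inv a \<otimes> b"] by (simp add: len_mult len_inv)

lemma div_eqI:
  assumes "a \<preceq> b" "a \<in> C" "b \<in> C" "len b \<le> len a"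
  shows "a = b"
proof -
  have "len (inv a \<otimes> b) = 0"
    using assms len_nonneg[of "inv a \<otimes> b"] by (simp add: len_mult len_inv)
  then have "inv a \<otimes> b = \<one>" using assms len_zero by blast
  then show ?thesis using assms by (metis cancel_inv(2) r_one)
qed

lemma div_antisym: "a \<preceq> b \<Longrightarrow> b \<preceq> a \<Longrightarrow> a \<in> C \<Longrightarrow> b \<in> C \<Longrightarrow> a = b"
  using div_eqI div_len by blast

lemma conj_D_pow:
  assumes "a \<in> P" shows "D [^] (k::int) \<otimes> a \<otimes> D [^] (- k) \<in> P"
proof -
  have nat: "D [^] n \<otimes> a \<otimes> inv (D [^] n) \<in> P \<and> inv (D [^] n) \<otimes> a \<otimes> D [^] n \<in> P" for n :: nat
  proof (induction n)
    case (Suc n)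
    have "(D \<otimes> d) \<otimes> a \<otimes> inv (D \<otimes> d) = D \<otimes> (d \<otimes> a \<otimes> inv d) \<otimes> inv D" if "d \<in> C" for d
      using assms that by (simp add: inv_mult_group m_assoc)
    then have "D [^] Suc n \<otimes> a \<otimes> inv (D [^] Suc n) = D \<otimes> (D [^] n \<otimes> a \<otimes> inv (D [^] n)) \<otimes> inv D"
      by (simp only: nat_pow_Suc2[OF D_closed] nat_pow_closed D_closed)
    moreover have "inv (D [^] Suc n) \<otimes> a \<otimes> D [^] Suc n = inv D \<otimes> (inv (D [^] n) \<otimes> a \<otimes> D [^] n) \<otimes> D"
      using assms by (simp add: inv_mult_group m_assoc)
    ultimately show ?case using conj_D conj_inv_D Suc by simp
  qed (use assms in auto)
  obtain n where "k = int n \<or> k = - int n" using int_cases2 by metis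
  then show ?thesis using nat[of n] by (auto simp: int_pow_int int_pow_neg)
qed

text \<open>
  Conjugation by \<open>D\<close> permutes \<open>P\<close>. For this reason right multiplication by powers of \<open>D\<close> preserves
  left divisibility, although right multiplication by other elements does not.
\<close>

lemma conj_D_pow_iff:
  assumes "a \<in> C" shows "D [^] (- k::int) \<otimes> a \<otimes> D [^] k \<in> P \<longleftrightarrow> a \<in> P"
proof
  assume "D [^] (- k) \<otimes> a \<otimes> D [^] k \<in> P"
  from conj_D_pow[OF this, of k] show "a \<in> P"
    using assms by (simp add: m_assoc int_pow_neg)
next
  assume "a \<in> P"
  from conj_D_pow[OF this, of "- k"] show "D [^] (- k) \<otimes> a \<otimes> D [^] k \<in> P" by simp
qed

lemma swap_D_pow:
  assumes "a \<in> C" shows "a \<otimes> D [^] (k::int) \<in> P \<longleftrightarrow> D [^] k \<otimes> a \<in> P"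
proof -
  have "D [^] (- k) \<otimes> (D [^] k \<otimes> a) \<otimes> D [^] k = a \<otimes> D [^] k"
    using assms by (simp add: m_assoc[symmetric] int_pow_neg)
  then show ?thesis using conj_D_pow_iff[of "D [^] k \<otimes> a" k] assms by simp
qed

lemma D_pow_add: "D [^] (k::int) \<otimes> D [^] l = D [^] (k + l)"
  by (simp add: int_pow_mult)

lemma D_pow_even_central:
  assumes "g \<in> C" shows "D [^] (2 * k::int) \<otimes> g = g \<otimes> D [^] (2 * k)"
proof -
  let ?Z = "D \<otimes> D"
  have Z: "?Z = D [^] (2::int)"
    using D_pow_add[of 1 1] by simp
  have inv: "inv ?Z \<otimes> g = g \<otimes> inv ?Z" if "g \<in> C" for g
  proof -
    have "?Z \<otimes> (g \<otimes> inv ?Z) = g"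
      using D2_central[OF that] that by (metis D_closed cancel_inv(3) inv_closed m_assoc m_closed)
    then show ?thesis using that by (metis D_closed cancel_inv(1) inv_closed m_closed)
  qed
  have nat: "?Z [^] n \<otimes> g = g \<otimes> ?Z [^] n \<and> inv ?Z [^] n \<otimes> g = g \<otimes> inv ?Z [^] n" for n :: nat
  proof (induction n)
    case (Suc n)
    have "?Z [^] Suc n \<otimes> g = (?Z [^] n \<otimes> g) \<otimes> ?Z"
      using assms D2_central[OF assms] by (simp add: m_assoc)
    moreover have "inv ?Z [^] Suc n \<otimes> g = (inv ?Z [^] n \<otimes> g) \<otimes> inv ?Z"
      using assms inv[OF assms] by (simp add: m_assoc)
    ultimately show ?case using Suc assms by (simp add: m_assoc)
  qed (use assms in auto)
  obtain n where "k = int n \<or> k = - int n" using int_cases2 by metis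
  moreover have "D [^] (2 * k) = ?Z [^] k" by (simp add: Z int_pow_pow)
  ultimately show ?thesis using nat[of n]
    by (auto simp: int_pow_int int_pow_neg nat_pow_inv)
qed

lemma len_nat_pow: "a \<in> C \<Longrightarrow> len (a [^] (n::nat)) = int n * len a"
  by (induction n) (auto simp: len_mult algebra_simps)

lemma len_D_pow: "len (D [^] (k::int)) = k * len D"
proof -
  obtain n where "k = int n \<or> k = - int n" using int_cases2 by metis
  then show ?thesis by (auto simp: int_pow_int int_pow_neg len_inv len_nat_pow)
qed

lemma D_nat_pow_P: "D [^] (n::nat) \<in> P"
  by (induction n) (auto simp: P_one P_mult D_P)

lemma D_pow_mono: "k \<le> l \<Longrightarrow> D [^] (k::int) \<preceq> D [^] l"
  using D_nat_pow_P[of "nat (l - k)"] by (simp add: int_pow_neg[symmetric] D_pow_add int_pow_int[symmetric])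

text \<open>
  All lattice automorphisms in this theory have this form: a left multiplication, which preserves
  left divisibility trivially, followed by a right multiplication by a power of \<open>D\<close>. They
  compose like pairs \<open>(a, k)\<close>, so two of them commute as soon as the left factors do.
\<close>

definition act :: "'a \<Rightarrow> int \<Rightarrow> 'a \<Rightarrow> 'a" where
  "act a k g = a \<otimes> g \<otimes> D [^] k"

lemma act_closed [simp]: "a \<in> C \<Longrightarrow> g \<in> C \<Longrightarrow> act a k g \<in> C"
  by (simp add: act_def)

lemma act_act:
  assumes "a \<in> C" "b \<in> C" "g \<in> C"
  shows "act a k (act b l g) = act (a \<otimes> b) (k + l) g"
proof -
  have "act a k (act b l g) = a \<otimes> b \<otimes> g \<otimes> (D [^] l \<otimes> D [^] k)"
    using assms by (simp add: act_def m_assoc)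
  then show ?thesis by (simp add: D_pow_add act_def add.commute)
qed

lemma act_one [simp]: "g \<in> C \<Longrightarrow> act \<one> 0 g = g"
  by (simp add: act_def)

lemma act_mono_iff:
  assumes "a \<in> C" "g \<in> C" "h \<in> C"
  shows "act a k g \<preceq> act a k h \<longleftrightarrow> g \<preceq> h"
proof -
  have "inv (act a k g) \<otimes> act a k h = D [^] (- k) \<otimes> (inv g \<otimes> h) \<otimes> D [^] k"
    using assms by (simp add: act_def inv_mult_group m_assoc int_pow_neg)
  then show ?thesis using conj_D_pow_iff[of "inv g \<otimes> h" k] assms by simp
qed

lemma act_inverse:
  assumes "a \<in> C" "g \<in> C"
  shows "act (inv a) (- k) (act a k g) = g" "act a k (act (inv a) (- k) g) = g"
  using assms by (simp_all add: act_act)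

lemma le_act_iff:
  assumes "a \<in> C" "g \<in> C" "h \<in> C"
  shows "h \<preceq> act a k g \<longleftrightarrow> act (inv a) (- k) h \<preceq> g"
  using act_mono_iff[of a "act (inv a) (- k) h" g k] assms by (simp add: act_inverse)

lemma act_le_iff:
  assumes "a \<in> C" "g \<in> C" "h \<in> C"
  shows "act a k g \<preceq> h \<longleftrightarrow> g \<preceq> act (inv a) (- k) h"
  using act_mono_iff[of a g "act (inv a) (- k) h" k] assms by (simp add: act_inverse)

text \<open>Every element lies between two powers of \<open>D\<close>: clear the denominators of \<open>g\<close> and of its inverse.\<close>

lemma D_pow_bounds:
  assumes "g \<in> C"
  obtains b :: nat where "D [^] (- int b) \<preceq> g" "g \<preceq> D [^] int b"
proof -
  obtain k :: nat where k: "D [^] k \<otimes> g \<in> P" using fraction[OF assms] by blast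
  obtain l :: nat where l: "D [^] l \<otimes> inv g \<in> P" using fraction[of "inv g"] assms by auto
  have k': "D [^] (- int (max k l)) \<preceq> g"
  proof -
    have "D [^] (- int (max k l)) \<preceq> D [^] (- int k)" by (rule D_pow_mono) simp
    moreover have "D [^] (- int k) \<preceq> g" using k by (simp add: int_pow_neg int_pow_int)
    ultimately show ?thesis using div_trans assms by simp
  qed
  have "inv g \<otimes> D [^] int l \<in> P"
    using l swap_D_pow[of "inv g" "int l"] assms by (simp add: int_pow_int)
  moreover have "D [^] int l \<preceq> D [^] int (max k l)" by (rule D_pow_mono) simp
  ultimately have "g \<preceq> D [^] int (max k l)" using div_trans[of g "D [^] int l"] assms by simp
  then show ?thesis using k' that by blast
qed

section \<open>The lattice of left divisibility\<close>

text \<open>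
  For the braid group this record is literally the prefix order, and for its opposite group the suffix order.
\<close>

definition div_order :: "'a gorder" where
  "div_order = \<lparr>carrier = carrier G, eq = (=), le = (\<lambda>a b. a \<preceq> b)\<rparr>"

definition mt :: "'a \<Rightarrow> 'a \<Rightarrow> 'a" where
  "mt a b = a \<sqinter>\<^bsub>div_order\<^esub> b"

text \<open>
  A common lower bound of greatest length is the greatest one: its least upper bound with any other
  common lower bound is again a common lower bound, and cannot be longer.
\<close>

lemma glb_ex:
  assumes "a \<in> C" "b \<in> C"
  shows "\<exists>m\<in>C. m \<preceq> a \<and> m \<preceq> b \<and> (\<forall>c\<in>C. c \<preceq> a \<longrightarrow> c \<preceq> b \<longrightarrow> c \<preceq> m)"
proof -
  let ?L = "\<lambda>d. d \<in> C \<and> d \<preceq> a \<and> d \<preceq> b"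
  obtain k where k: "D [^] (- int k) \<preceq> a" using D_pow_bounds[OF assms(1)] by metis
  obtain l where l: "D [^] (- int l) \<preceq> b" using D_pow_bounds[OF assms(2)] by metis
  have "D [^] (- int (max k l)) \<preceq> D [^] (- int k)" "D [^] (- int (max k l)) \<preceq> D [^] (- int l)"
    by (rule D_pow_mono; simp)+
  then have "?L (D [^] (- int (max k l)))"
    using div_trans[OF _ k] div_trans[OF _ l] assms by simp
  then obtain d where d: "?L d" and min: "\<And>c. ?L c \<Longrightarrow> nat (len a - len d) \<le> nat (len a - len c)"
    using ex_has_least_nat[of ?L _ "\<lambda>d. nat (len a - len d)"] by blast
  have "c \<preceq> d" if c: "?L c" for c
  proof -
    obtain m where m: "m \<in> C" "d \<preceq> m" "c \<preceq> m" "\<And>x. x \<in> C \<Longrightarrow> d \<preceq> x \<Longrightarrow> c \<preceq> x \<Longrightarrow> m \<preceq> x"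
      using lub_ex[of d c] c d by blast
    then have "?L m" using c d assms by blast
    then have "len m \<le> len d"
      using min[of m] div_len[of m a] div_len[of d a] d assms by fastforce
    then have "d = m" using div_eqI m d by blast
    then show ?thesis using m by simp
  qed
  then show ?thesis using d by blast
qed

lemma mt_props:
  assumes "a \<in> C" "b \<in> C"
  shows mt_closed [simp]: "mt a b \<in> C"
    and le_mt_iff: "c \<in> C \<Longrightarrow> c \<preceq> mt a b \<longleftrightarrow> c \<preceq> a \<and> c \<preceq> b"
proof -
  have "\<exists>m. greatest div_order m (Lower div_order {a, b})"
    using glb_ex[OF assms] assms by (auto simp: greatest_def Lower_def div_order_def)
  then have "greatest div_order (mt a b) (Lower div_order {a, b})"
    unfolding mt_def meet_def inf_def by (rule someI_ex)
  then have m: "mt a b \<in> C" "mt a b \<preceq> a" "mt a b \<preceq> b" "\<And>c. c \<in> C \<Longrightarrow> c \<preceq> a \<Longrightarrow> c \<preceq> b \<Longrightarrow> c \<preceq> mt a b"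
    using assms by (auto simp: greatest_def Lower_def div_order_def)
  then show "mt a b \<in> C" "c \<in> C \<Longrightarrow> c \<preceq> mt a b \<longleftrightarrow> c \<preceq> a \<and> c \<preceq> b"
    using div_trans assms by blast+
qed

lemma mt_le: "a \<in> C \<Longrightarrow> b \<in> C \<Longrightarrow> mt a b \<preceq> a" "a \<in> C \<Longrightarrow> b \<in> C \<Longrightarrow> mt a b \<preceq> b"
  using le_mt_iff[of a b "mt a b"] div_refl by auto

definition jn :: "'a \<Rightarrow> 'a \<Rightarrow> 'a" where
  "jn a b = (SOME m. m \<in> C \<and> a \<preceq> m \<and> b \<preceq> m \<and> (\<forall>c\<in>C. a \<preceq> c \<longrightarrow> b \<preceq> c \<longrightarrow> m \<preceq> c))"

lemma jn_props:
  assumes "a \<in> C" "b \<in> C"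
  shows jn_closed [simp]: "jn a b \<in> C"
    and jn_le_iff: "c \<in> C \<Longrightarrow> jn a b \<preceq> c \<longleftrightarrow> a \<preceq> c \<and> b \<preceq> c"
proof -
  have "\<exists>m. m \<in> C \<and> a \<preceq> m \<and> b \<preceq> m \<and> (\<forall>c\<in>C. a \<preceq> c \<longrightarrow> b \<preceq> c \<longrightarrow> m \<preceq> c)"
    using lub_ex[OF assms] by blast
  then have "jn a b \<in> C \<and> a \<preceq> jn a b \<and> b \<preceq> jn a b \<and> (\<forall>c\<in>C. a \<preceq> c \<longrightarrow> b \<preceq> c \<longrightarrow> jn a b \<preceq> c)"
    unfolding jn_def by (rule someI_ex)
  then show "jn a b \<in> C" "c \<in> C \<Longrightarrow> jn a b \<preceq> c \<longleftrightarrow> a \<preceq> c \<and> b \<preceq> c"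
    using div_trans assms by blast+
qed

lemma le_eqI:
  assumes "a \<in> C" "b \<in> C" "\<And>h. h \<in> C \<Longrightarrow> h \<preceq> a \<longleftrightarrow> h \<preceq> b"
  shows "a = b"
  using assms div_refl div_antisym by blast

lemma ge_eqI:
  assumes "a \<in> C" "b \<in> C" "\<And>h. h \<in> C \<Longrightarrow> a \<preceq> h \<longleftrightarrow> b \<preceq> h"
  shows "a = b"
  using assms div_refl div_antisym by blast

lemma mt_commute: "a \<in> C \<Longrightarrow> b \<in> C \<Longrightarrow> mt a b = mt b a"
  by (rule le_eqI) (auto simp: le_mt_iff)

lemma mt_absorb: "a \<in> C \<Longrightarrow> b \<in> C \<Longrightarrow> a \<preceq> b \<Longrightarrow> mt a b = a"
  by (rule le_eqI) (auto simp: le_mt_iff intro: div_trans)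

lemma mt_P: "a \<in> P \<Longrightarrow> b \<in> P \<Longrightarrow> mt a b \<in> P"
  using le_mt_iff[of a b \<one>] by simp

lemma act_mt:
  assumes "a \<in> C" "g \<in> C" "h \<in> C"
  shows "act a k (mt g h) = mt (act a k g) (act a k h)"
  using assms by (intro le_eqI) (simp_all add: le_act_iff le_mt_iff)

lemma act_jn:
  assumes "a \<in> C" "g \<in> C" "h \<in> C"
  shows "act a k (jn g h) = jn (act a k g) (act a k h)"
  using assms by (intro ge_eqI) (simp_all add: act_le_iff jn_le_iff)

lemma mult_mt: "a \<in> C \<Longrightarrow> g \<in> C \<Longrightarrow> h \<in> C \<Longrightarrow> a \<otimes> mt g h = mt (a \<otimes> g) (a \<otimes> h)"
  using act_mt[of a g h 0] by (simp add: act_def)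

lemma mult_jn: "a \<in> C \<Longrightarrow> g \<in> C \<Longrightarrow> h \<in> C \<Longrightarrow> a \<otimes> jn g h = jn (a \<otimes> g) (a \<otimes> h)"
  using act_jn[of a g h 0] by (simp add: act_def)

lemma mult_le_iff: "a \<in> C \<Longrightarrow> g \<in> C \<Longrightarrow> h \<in> C \<Longrightarrow> a \<otimes> g \<preceq> a \<otimes> h \<longleftrightarrow> g \<preceq> h"
  using act_mono_iff[of a g h 0] by (simp add: act_def)

section \<open>Normal forms\<close>

definition prodl :: "'a list \<Rightarrow> 'a" where
  "prodl xs = foldr (\<otimes>) xs \<one>"

text \<open>The positive part of a left normal form, without the power of \<open>D\<close> in front.\<close>

definition greedy :: "'a list \<Rightarrow> bool" where
  "greedy xs \<longleftrightarrow> set xs \<subseteq> C \<and> (\<forall>i<length xs. xs ! i = mt (prodl (drop i xs)) D \<and> xs ! i \<noteq> \<one>)"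

lemma prodl_simps [simp]: "prodl [] = \<one>" "prodl (x # xs) = x \<otimes> prodl xs"
  by (simp_all add: prodl_def)

lemma prodl_closed [simp]: "set xs \<subseteq> C \<Longrightarrow> prodl xs \<in> C"
  by (induction xs) auto

lemma greedy_Nil [simp]: "greedy []"
  by (simp add: greedy_def)

lemma greedy_Cons:
  "greedy (x # xs) \<longleftrightarrow> x \<in> C \<and> x = mt (x \<otimes> prodl xs) D \<and> x \<noteq> \<one> \<and> greedy xs"
  by (auto simp: greedy_def All_less_Suc2)

lemma greedy_closed: "greedy xs \<Longrightarrow> set xs \<subseteq> C"
  by (simp add: greedy_def)

lemma greedy_tail_P:
  assumes "greedy (x # xs)" shows "prodl xs \<in> P"
proof -
  have "x \<in> C" "prodl xs \<in> C" using assms greedy_closed[of xs] by (auto simp: greedy_Cons)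
  moreover have "x \<preceq> x \<otimes> prodl xs"
    using assms calculation mt_le(1)[of "x \<otimes> prodl xs" D] by (auto simp: greedy_Cons)
  ultimately show ?thesis by simp
qed

lemma one_mt_D: "mt \<one> D = \<one>"
  using mt_absorb[of \<one> D] D_P by simp

lemma greedy_exists:
  "w \<in> P \<Longrightarrow> \<exists>xs. greedy xs \<and> prodl xs = w"
proof (induction "nat (len w)" arbitrary: w rule: less_induct)
  case less
  show ?case
  proof (cases "w = \<one>")
    case True
    then show ?thesis by (intro exI[of _ "[]"]) simp
  next
    case False
    let ?x = "mt w D"
    obtain s where s: "s \<in> P" "s \<noteq> \<one>" "s \<preceq> w" "s \<preceq> D" using left_atom less False by blast
    have xP: "?x \<in> P" using less D_P by (simp add: mt_P)
    have ne: "?x \<noteq> \<one>"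
    proof
      assume "?x = \<one>"
      then have "s \<preceq> \<one>" using s less le_mt_iff[of w D s] by simp
      then show False using s div_antisym[of s \<one>] by simp
    qed
    have w': "inv ?x \<otimes> w \<in> P" using mt_le(1)[of w D] less by simp
    have "len ?x > 0" using len_nonneg[OF xP] len_zero[OF xP] ne by linarith
    moreover have "len (inv ?x \<otimes> w) = len w - len ?x" using less xP by (simp add: len_mult len_inv)
    ultimately have "nat (len (inv ?x \<otimes> w)) < nat (len w)"
      using len_nonneg[OF w'] by linarith
    from less(1)[OF this w'] obtain xs where xs: "greedy xs" "prodl xs = inv ?x \<otimes> w" by blast
    have "?x \<otimes> prodl xs = w" using xs less xP by simp
    then show ?thesis using xs ne xP by (intro exI[of _ "?x # xs"]) (simp add: greedy_Cons)
  qed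
qed

lemma greedy_unique:
  "greedy xs \<Longrightarrow> greedy ys \<Longrightarrow> prodl xs = prodl ys \<Longrightarrow> xs = ys"
proof (induction xs arbitrary: ys)
  case Nil
  then show ?case using one_mt_D by (cases ys) (auto simp: greedy_Cons)
next
  case (Cons x xs)
  then have xm: "x = mt (prodl (x # xs)) D" "x \<noteq> \<one>" by (auto simp: greedy_Cons)
  then show ?case
  proof (cases ys)
    case Nil
    then show ?thesis using Cons xm one_mt_D by auto
  next
    case (Cons y ys')
    then have "y = mt (prodl ys) D" using Cons.prems by (auto simp: greedy_Cons)
    then have xy: "x = y" using xm(1) Cons.prems by simp
    have "x \<in> C" "prodl xs \<in> C" "prodl ys' \<in> C"
      using Cons.prems Cons greedy_closed by (auto simp: greedy_Cons)
    then have "prodl xs = prodl ys'" using Cons.prems Cons xy by simp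
    then show ?thesis using Cons.IH[of ys'] Cons.prems Cons xy by (simp add: greedy_Cons)
  qed
qed

text \<open>
  The greedy first factor of \<open>a\<close> is all that matters for the comparison with \<open>D\<^sup>k\<^sup>+\<^sup>1\<close>:
  in fact \<open>(a \<and> D) D\<^sup>k = a D\<^sup>k \<and> D\<^sup>k\<^sup>+\<^sup>1\<close>.
\<close>

lemma mt_D_pow:
  assumes "a \<in> P"
  shows "a \<preceq> D [^] (int (Suc k)) \<longleftrightarrow> a \<preceq> mt a D \<otimes> D [^] (int k)"
proof -
  have "a \<preceq> a \<otimes> D [^] (int k)" using assms D_nat_pow_P[of k] by (simp add: int_pow_int)
  moreover have "mt a D \<otimes> D [^] (int k) = mt (a \<otimes> D [^] (int k)) (D [^] (int (Suc k)))"
    using act_mt[of \<one> a D "int k"] assms D_pow_add[of 1 "int k"] by (simp add: act_def)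
  ultimately show ?thesis using assms by (simp add: le_mt_iff)
qed

text \<open>
  This turns canonical length, which is defined by lists, into a statement about the order. Removing the
  first factor lowers the bounding power of \<open>D\<close> by one, by \<open>mt_D_pow\<close>.
\<close>

lemma greedy_length:
  "greedy xs \<Longrightarrow> prodl xs \<in> P \<Longrightarrow> prodl xs \<preceq> D [^] (int k) \<longleftrightarrow> length xs \<le> k"
proof (induction xs arbitrary: k)
  case Nil
  then show ?case using D_nat_pow_P by (simp add: int_pow_int)
next
  case (Cons x xs)
  have c: "x \<in> C" "prodl xs \<in> C" and x: "x = mt (prodl (x # xs)) D" and ne: "x \<noteq> \<one>"
    using Cons greedy_closed[of "x # xs"] by (auto simp: greedy_Cons)
  show ?case
  proof (cases k)
    case 0
    have "\<not> prodl (x # xs) \<preceq> \<one>"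
    proof
      assume "prodl (x # xs) \<preceq> \<one>"
      then have "prodl (x # xs) = \<one>" using Cons.prems div_antisym[of "prodl (x # xs)" \<one>] by simp
      then show False using x ne one_mt_D by simp
    qed
    then show ?thesis using 0 by simp
  next
    case (Suc j)
    have "prodl (x # xs) \<preceq> D [^] (int k) \<longleftrightarrow> prodl (x # xs) \<preceq> x \<otimes> D [^] (int j)"
      using mt_D_pow[OF Cons.prems(2), of j] Suc x by simp
    also have "\<dots> \<longleftrightarrow> prodl xs \<preceq> D [^] (int j)"
      using c mult_le_iff[of x "prodl xs" "D [^] (int j)"] by simp
    also have "\<dots> \<longleftrightarrow> length xs \<le> j"
      using Cons.IH[of j] Cons.prems(1) greedy_tail_P[OF Cons.prems(1)] by (simp add: greedy_Cons)
    finally show ?thesis using Suc by simp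
  qed
qed

definition normal_form :: "'a \<Rightarrow> int \<Rightarrow> 'a list \<Rightarrow> bool" where
  "normal_form x p xs \<longleftrightarrow> x \<in> C \<and> set xs \<subseteq> C \<and> x = D [^] p \<otimes> prodl xs \<and>
     D [^] (- p) \<otimes> x \<in> P \<and> (\<forall>q::int. D [^] (- q) \<otimes> x \<in> P \<longrightarrow> q \<le> p) \<and>
     (\<forall>i<length xs. xs ! i = mt (prodl (drop i xs)) D \<and> xs ! i \<noteq> \<one>)"

definition is_inf :: "'a \<Rightarrow> int \<Rightarrow> bool" where
  "is_inf x p \<longleftrightarrow> D [^] (- p) \<otimes> x \<in> P \<and> (\<forall>q::int. D [^] (- q) \<otimes> x \<in> P \<longrightarrow> q \<le> p)"

lemma is_inf_unique: "is_inf x p \<Longrightarrow> is_inf x q \<Longrightarrow> p = q"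
  unfolding is_inf_def by (meson order_antisym)

text \<open>The exponents that occur are bounded above because the length of a positive element is not negative.\<close>

lemma is_inf_exists:
  assumes "x \<in> C" shows "\<exists>p. is_inf x p"
proof -
  let ?Q = "\<lambda>p::int. D [^] (- p) \<otimes> x \<in> P"
  obtain k :: nat where "D [^] k \<otimes> x \<in> P" using fraction[OF assms] by blast
  then have k: "?Q (- int k)" by (simp add: int_pow_int)
  have bound: "p \<le> \<bar>len x\<bar>" if "?Q p" for p
  proof -
    have "p * len D \<le> len x" using len_nonneg[OF that] assms by (simp add: len_mult len_D_pow)
    then show ?thesis using len_D
      by (smt (verit) mult_less_cancel_left2 mult_minus_right zero_less_mult_iff mult_le_cancel_left1)
  qed
  \<comment> \<open>Restricting to exponents from \<open>-k\<close> on makes the set of candidates finite.\<close>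
  define M where "M = {p. ?Q p \<and> - int k \<le> p}"
  have "M \<subseteq> {- int k..\<bar>len x\<bar>}" using bound by (auto simp: M_def)
  then have fin: "finite M" using finite_subset by blast
  have "- int k \<in> M" using k by (simp add: M_def)
  then have "Max M \<in> M" "\<And>q. q \<in> M \<Longrightarrow> q \<le> Max M" using fin by (auto intro: Max_in)
  then have "?Q (Max M)" "\<And>q. ?Q q \<Longrightarrow> q \<le> Max M"
    by (auto simp: M_def) (metis (no_types, lifting) linorder_le_cases order_trans)
  then show ?thesis unfolding is_inf_def by blast
qed

lemma normal_form_alt:
  "normal_form x p xs \<longleftrightarrow> x \<in> C \<and> is_inf x p \<and> greedy xs \<and> prodl xs = D [^] (- p) \<otimes> x"
proof -
  have "x = D [^] p \<otimes> prodl xs \<longleftrightarrow> prodl xs = D [^] (- p) \<otimes> x" if "x \<in> C" "set xs \<subseteq> C"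
    using that by (auto simp: int_pow_neg)
  then show ?thesis unfolding normal_form_def is_inf_def greedy_def by blast
qed

lemma normal_form_exists:
  assumes "x \<in> C" shows "\<exists>p xs. normal_form x p xs"
proof -
  obtain p where p: "is_inf x p" using is_inf_exists[OF assms] by blast
  then obtain xs where "greedy xs" "prodl xs = D [^] (- p) \<otimes> x"
    using greedy_exists unfolding is_inf_def by blast
  then show ?thesis using p assms unfolding normal_form_alt by blast
qed

lemma normal_form_unique:
  assumes "normal_form x p xs" "normal_form x q ys" shows "p = q" "xs = ys"
proof -
  show pq: "p = q" using assms is_inf_unique unfolding normal_form_alt by blast
  show "xs = ys" using assms greedy_unique unfolding normal_form_alt pq by metis
qed

lemma normal_form_THE: "normal_form x p xs \<Longrightarrow> (THE (p, xs). normal_form x p xs) = (p, xs)"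
  by (rule the_equality) (auto dest: normal_form_unique)

lemma normal_form_sup:
  assumes "normal_form x p xs"
  shows "inv x \<otimes> D [^] j \<in> P \<longleftrightarrow> p + int (length xs) \<le> j"
proof -
  have nf: "x \<in> C" "greedy xs" "prodl xs = D [^] (- p) \<otimes> x" "D [^] (- p) \<otimes> x \<in> P"
    using assms unfolding normal_form_alt is_inf_def by auto
  have eq: "inv x \<otimes> D [^] j = inv (prodl xs) \<otimes> D [^] (j - p)"
  proof -
    have "inv (prodl xs) = inv x \<otimes> D [^] p" using nf by (simp add: inv_mult_group int_pow_neg)
    then show ?thesis using nf by (simp add: m_assoc D_pow_add)
  qed
  show ?thesis
  proof (cases "j \<ge> p")
    case True
    then show ?thesis
      using greedy_length[of xs "nat (j - p)"] nf eq by auto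
  next
    case False
    have "\<not> inv (prodl xs) \<otimes> D [^] (j - p) \<in> P"
    proof
      assume "inv (prodl xs) \<otimes> D [^] (j - p) \<in> P"
      then have "len (prodl xs) \<le> (j - p) * len D" using nf div_len[of "prodl xs" "D [^] (j - p)"] by (simp add: len_D_pow)
      moreover have "0 \<le> len (prodl xs)" using nf len_nonneg by simp
      ultimately show False using False len_D by (smt (verit) mult_neg_pos)
    qed
    then show ?thesis using False eq by simp
  qed
qed

text \<open>
  The initial factor: the first factor of the normal form, carried across the power of \<open>D\<close> in
  front of it. Written as a meet it makes sense for every exponent and every normal form, also for an empty one.
\<close>

definition head_factor :: "'a \<Rightarrow> int \<Rightarrow> 'a" where
  "head_factor x p = mt (x \<otimes> D [^] (- p)) D"

text \<open>Conjugation by \<open>D\<^sup>p\<close> is an automorphism of the lattice that fixes \<open>D\<close>.\<close>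

lemma normal_form_head:
  assumes "normal_form x p xs"
  shows "(if xs = [] then \<one> else D [^] p \<otimes> hd xs \<otimes> D [^] (- p)) = head_factor x p"
proof -
  have nf: "x \<in> C" "greedy xs" "prodl xs = D [^] (- p) \<otimes> x"
    using assms unfolding normal_form_alt by auto
  have "head_factor x p = act (D [^] p) (- p) (mt (prodl xs) D)"
  proof -
    have "act (D [^] p) (- p) D = D"
      using D_pow_add[of p 1] D_pow_add[of "p + 1" "- p"] by (simp add: act_def)
    moreover have "act (D [^] p) (- p) (prodl xs) = x \<otimes> D [^] (- p)"
      using nf by (simp add: act_def int_pow_neg)
    ultimately show ?thesis using nf by (subst act_mt) (auto simp: head_factor_def)
  qed
  also have "mt (prodl xs) D = (if xs = [] then \<one> else hd xs)"
    using nf(2) one_mt_D by (cases xs) (auto simp: greedy_Cons)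
  finally show ?thesis by (simp add: act_def int_pow_neg)
qed

section \<open>Meets and joins of two commuting automorphisms\<close>

text \<open>Both the rigidity operator and cycling are of this form.\<close>

definition meet2 :: "'a \<Rightarrow> int \<Rightarrow> 'a \<Rightarrow> int \<Rightarrow> 'a \<Rightarrow> 'a" where
  "meet2 a k c l g = mt (act a k g) (act c l g)"

text \<open>The pointwise join of the inverses, which makes it the lower adjoint of \<open>meet2\<close> with the same parameters.\<close>

definition join2 :: "'a \<Rightarrow> int \<Rightarrow> 'a \<Rightarrow> int \<Rightarrow> 'a \<Rightarrow> 'a" where
  "join2 a k c l g = jn (act (inv a) (- k) g) (act (inv c) (- l) g)"

lemma meet2_closed [simp]: "\<lbrakk>a \<in> C; c \<in> C; g \<in> C\<rbrakk> \<Longrightarrow> meet2 a k c l g \<in> C"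
  by (simp add: meet2_def)

lemma join2_closed [simp]: "\<lbrakk>a \<in> C; c \<in> C; g \<in> C\<rbrakk> \<Longrightarrow> join2 a k c l g \<in> C"
  by (simp add: join2_def)

lemma meet2_pow_closed [simp]: "\<lbrakk>a \<in> C; c \<in> C; g \<in> C\<rbrakk> \<Longrightarrow> (meet2 a k c l ^^ n) g \<in> C"
  by (induction n) auto

lemma join2_pow_closed [simp]: "\<lbrakk>a \<in> C; c \<in> C; g \<in> C\<rbrakk> \<Longrightarrow> (join2 a k c l ^^ n) g \<in> C"
  by (induction n) auto

lemma le_meet2_iff: "\<lbrakk>a \<in> C; c \<in> C; g \<in> C; h \<in> C\<rbrakk> \<Longrightarrow>
    h \<preceq> meet2 a k c l g \<longleftrightarrow> h \<preceq> act a k g \<and> h \<preceq> act c l g"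
  by (simp add: meet2_def le_mt_iff)

lemma join2_adjoint: "\<lbrakk>a \<in> C; c \<in> C; g \<in> C; h \<in> C\<rbrakk> \<Longrightarrow>
    join2 a k c l g \<preceq> h \<longleftrightarrow> g \<preceq> meet2 a k c l h"
  by (simp add: join2_def meet2_def jn_le_iff le_mt_iff act_le_iff)

lemma join2_pow_adjoint: "\<lbrakk>a \<in> C; c \<in> C; g \<in> C; h \<in> C\<rbrakk> \<Longrightarrow>
    (join2 a k c l ^^ n) g \<preceq> h \<longleftrightarrow> g \<preceq> (meet2 a k c l ^^ n) h"
proof (induction n arbitrary: h)
  case (Suc n)
  then show ?case
    using join2_adjoint[of a c "(join2 a k c l ^^ n) g" h k l] by (simp add: funpow_swap1)
qed simp

lemma meet2_mono:
  assumes "a \<in> C" "c \<in> C" "g \<in> C" "h \<in> C" "g \<preceq> h"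
  shows "meet2 a k c l g \<preceq> meet2 a k c l h"
proof -
  have "act a k g \<preceq> act a k h" "act c l g \<preceq> act c l h"
    using assms by (simp_all add: act_mono_iff)
  moreover have "meet2 a k c l g \<preceq> act a k g" "meet2 a k c l g \<preceq> act c l g"
    using assms by (simp_all add: meet2_def mt_le)
  ultimately show ?thesis
    using assms div_trans[of "meet2 a k c l g"] by (simp add: le_meet2_iff)
qed

lemma meet2_pow_mono: "\<lbrakk>a \<in> C; c \<in> C; g \<in> C; h \<in> C; g \<preceq> h\<rbrakk> \<Longrightarrow>
    (meet2 a k c l ^^ n) g \<preceq> (meet2 a k c l ^^ n) h"
  by (induction n) (auto intro: meet2_mono)

lemma join2_mono:
  assumes "a \<in> C" "c \<in> C" "g \<in> C" "h \<in> C" "g \<preceq> h"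
  shows "join2 a k c l g \<preceq> join2 a k c l h"
proof -
  have "h \<preceq> meet2 a k c l (join2 a k c l h)"
    using assms join2_adjoint[of a c h "join2 a k c l h" k l] by (simp add: div_refl)
  then have "g \<preceq> meet2 a k c l (join2 a k c l h)" using assms div_trans[of g h] by simp
  then show ?thesis using assms by (simp add: join2_adjoint)
qed

lemma join2_pow_mono: "\<lbrakk>a \<in> C; c \<in> C; g \<in> C; h \<in> C; g \<preceq> h\<rbrakk> \<Longrightarrow>
    (join2 a k c l ^^ n) g \<preceq> (join2 a k c l ^^ n) h"
  by (induction n) (auto intro: join2_mono)

lemma act_swap: "\<lbrakk>z \<in> C; a \<in> C; g \<in> C; z \<otimes> a = a \<otimes> z\<rbrakk> \<Longrightarrow> act a k (act z j g) = act z j (act a k g)"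
  by (simp add: act_act add.commute)

lemma inv_comm:
  assumes "z \<in> C" "a \<in> C" "z \<otimes> a = a \<otimes> z" shows "z \<otimes> inv a = inv a \<otimes> z"
  using assms by (metis cancel_inv(1) cancel_inv(3) inv_closed m_assoc m_closed)

lemma meet2_act:
  assumes "z \<in> C" "a \<in> C" "c \<in> C" "g \<in> C" "z \<otimes> a = a \<otimes> z" "z \<otimes> c = c \<otimes> z"
  shows "meet2 a k c l (act z j g) = act z j (meet2 a k c l g)"
  using assms by (simp add: meet2_def act_swap act_mt)

lemma meet2_pow_act:
  assumes "z \<in> C" "a \<in> C" "c \<in> C" "g \<in> C" "z \<otimes> a = a \<otimes> z" "z \<otimes> c = c \<otimes> z"
  shows "(meet2 a k c l ^^ n) (act z j g) = act z j ((meet2 a k c l ^^ n) g)"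
  using assms by (induction n) (auto simp: meet2_act)

lemma join2_act:
  assumes "z \<in> C" "a \<in> C" "c \<in> C" "g \<in> C" "z \<otimes> a = a \<otimes> z" "z \<otimes> c = c \<otimes> z"
  shows "join2 a k c l (act z j g) = act z j (join2 a k c l g)"
  using assms by (simp add: join2_def act_swap act_jn inv_comm)

lemma join2_pow_act:
  assumes "z \<in> C" "a \<in> C" "c \<in> C" "g \<in> C" "z \<otimes> a = a \<otimes> z" "z \<otimes> c = c \<otimes> z"
  shows "(join2 a k c l ^^ n) (act z j g) = act z j ((join2 a k c l ^^ n) g)"
  using assms by (induction n) (auto simp: join2_act)

lemma act_pow: "\<lbrakk>a \<in> C; g \<in> C\<rbrakk> \<Longrightarrow> (act a k ^^ n) g = act (a [^] n) (int n * k) g"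
proof (induction n)
  case (Suc n)
  then show ?case by (simp add: act_act nat_pow_Suc2[symmetric] algebra_simps)
qed (simp add: act_def)

lemma act_pow_closed [simp]: "\<lbrakk>a \<in> C; g \<in> C\<rbrakk> \<Longrightarrow> (act a k ^^ n) g \<in> C"
  by (induction n) auto

lemma act_pow_swap:
  assumes "z \<in> C" "a \<in> C" "g \<in> C" "z \<otimes> a = a \<otimes> z"
  shows "(act a k ^^ n) (act z j g) = act z j ((act a k ^^ n) g)"
  using assms by (induction n) (auto simp: act_swap)

lemma act_pow_mono_iff:
  "\<lbrakk>a \<in> C; g \<in> C; h \<in> C\<rbrakk> \<Longrightarrow> (act a k ^^ n) g \<preceq> (act a k ^^ n) h \<longleftrightarrow> g \<preceq> h"
  by (induction n) (auto simp: act_mono_iff)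

text \<open>
  The \<open>n\<close>-th power of a meet of commuting automorphisms \<open>\<alpha>\<close>, \<open>\<gamma>\<close> is the meet of all \<open>\<alpha>\<^sup>i \<gamma>\<^sup>n\<^sup>-\<^sup>i\<close>, because
  automorphisms distribute over meets. Stated through lower bounds, this avoids meets of finite families.
\<close>

lemma le_meet2_pow_iff:
  assumes "a \<in> C" "c \<in> C" "g \<in> C" "h \<in> C" "a \<otimes> c = c \<otimes> a"
  shows "h \<preceq> (meet2 a k c l ^^ n) g \<longleftrightarrow> (\<forall>i\<le>n. h \<preceq> (act a k ^^ i) ((act c l ^^ (n - i)) g))"
  using assms(3,4)
proof (induction n arbitrary: h)
  case (Suc n)
  let ?A = "act a k" and ?B = "act c l" and ?M = "(meet2 a k c l ^^ n) g"
  let ?t = "\<lambda>i j. (?A ^^ i) ((?B ^^ j) g)"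
  have "h \<preceq> (meet2 a k c l ^^ Suc n) g \<longleftrightarrow> h \<preceq> ?A ?M \<and> h \<preceq> ?B ?M"
    using assms Suc by (simp add: le_meet2_iff)
  also have "h \<preceq> ?A ?M \<longleftrightarrow> (\<forall>i\<le>n. act (inv a) (- k) h \<preceq> ?t i (n - i))"
    using assms Suc by (simp add: le_act_iff)
  also have "\<dots> \<longleftrightarrow> (\<forall>i\<le>n. h \<preceq> ?t (Suc i) (n - i))"
    using assms Suc by (simp add: le_act_iff)
  also have "h \<preceq> ?B ?M \<longleftrightarrow> (\<forall>i\<le>n. act (inv c) (- l) h \<preceq> ?t i (n - i))"
    using assms Suc by (simp add: le_act_iff)
  also have "\<dots> \<longleftrightarrow> (\<forall>i\<le>n. h \<preceq> ?B (?t i (n - i)))"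
    using assms Suc by (simp add: le_act_iff)
  also have "\<dots> \<longleftrightarrow> (\<forall>i\<le>n. h \<preceq> ?t i (Suc n - i))"
  proof -
    have "?B (?t i (n - i)) = ?t i (Suc n - i)" if "i \<le> n" for i
      using that assms act_pow_swap[of c a "(?B ^^ (n - i)) g" i k l] by (simp add: Suc_diff_le)
    then show ?thesis by auto
  qed
  also have "(\<forall>i\<le>n. h \<preceq> ?t (Suc i) (n - i)) \<and> (\<forall>i\<le>n. h \<preceq> ?t i (Suc n - i)) \<longleftrightarrow>
      (\<forall>i\<le>Suc n. h \<preceq> ?t i (Suc n - i))"
  proof safe
    fix i assume *: "\<forall>i\<le>n. h \<preceq> ?t (Suc i) (n - i)" "\<forall>i\<le>n. h \<preceq> ?t i (Suc n - i)" "i \<le> Suc n"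
    show "h \<preceq> ?t i (Suc n - i)"
    proof (cases "i \<le> n")
      case False
      then have "i = Suc n" using *(3) by simp
      then show ?thesis using *(1)[rule_format, of n] by simp
    qed (use * in blast)
  next
    fix i assume *: "\<forall>i\<le>Suc n. h \<preceq> ?t i (Suc n - i)" "i \<le> n"
    show "h \<preceq> ?t (Suc i) (n - i)" using *(1)[rule_format, of "Suc i"] *(2) by simp
    show "h \<preceq> ?t i (Suc n - i)" using *(1)[rule_format, of i] *(2) by simp
  qed
  finally show ?case .
qed simp

lemma act_pow_increasing:
  assumes "a \<in> C" "g \<in> C" "g \<preceq> act a k g"
  shows "g \<preceq> (act a k ^^ n) g"
proof (induction n)
  case (Suc n)
  have "act a k g \<preceq> act a k ((act a k ^^ n) g)" using Suc assms by (simp add: act_mono_iff)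
  then show ?case using assms div_trans[of g "act a k g"] by simp
qed (use assms in \<open>simp add: div_refl\<close>)

lemma meet2_meet2:
  assumes "a \<in> C" "c \<in> C" "b \<in> C" "d \<in> C" "g \<in> C"
    and "b \<otimes> a = a \<otimes> b" "b \<otimes> c = c \<otimes> b" "d \<otimes> a = a \<otimes> d" "d \<otimes> c = c \<otimes> d"
  shows "meet2 a k c l (meet2 b i d j g) = meet2 b i d j (meet2 a k c l g)"
proof -
  have "meet2 a k c l (meet2 b i d j g) = mt (mt (act a k (act b i g)) (act a k (act d j g)))
      (mt (act c l (act b i g)) (act c l (act d j g)))"
    using assms by (simp add: meet2_def act_mt)
  moreover have "meet2 b i d j (meet2 a k c l g) = mt (mt (act b i (act a k g)) (act b i (act c l g)))
      (mt (act d j (act a k g)) (act d j (act c l g)))"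
    using assms by (simp add: meet2_def act_mt)
  moreover have "act a k (act b i g) = act b i (act a k g)" "act a k (act d j g) = act d j (act a k g)"
    "act c l (act b i g) = act b i (act c l g)" "act c l (act d j g) = act d j (act c l g)"
    using assms by (simp_all add: act_swap)
  ultimately show ?thesis
    using assms by (intro le_eqI) (auto simp: le_mt_iff)
qed

lemma funpow_commute_on:
  assumes "\<And>x. x \<in> A \<Longrightarrow> f x \<in> A" "\<And>x. x \<in> A \<Longrightarrow> h x \<in> A" "\<And>x. x \<in> A \<Longrightarrow> f (h x) = h (f x)" "x \<in> A"
  shows "(f ^^ m) ((h ^^ n) x) = (h ^^ n) ((f ^^ m) x)"
proof -
  have fA: "(f ^^ m) y \<in> A" if "y \<in> A" for m y using that assms(1) by (induction m) auto
  have hA: "(h ^^ m) y \<in> A" if "y \<in> A" for m y using that assms(2) by (induction m) auto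
  have 1: "(f ^^ m) (h y) = h ((f ^^ m) y)" if "y \<in> A" for y
    using that by (induction m) (auto simp: assms fA)
  show ?thesis
    using assms(4) by (induction n) (auto simp: 1 hA)
qed

section \<open>Rigid elements\<close>

text \<open>
  In the notation of the introduction these are \<open>L\<close>, \<open>R\<close> and \<open>c\<close>, for the base point \<open>u\<close>.
\<close>

abbreviation Lop :: "'a \<Rightarrow> int \<Rightarrow> int \<Rightarrow> 'a \<Rightarrow> 'a" where
  "Lop u p q \<equiv> meet2 u (- p) (inv u) q"

abbreviation Rop :: "'a \<Rightarrow> int \<Rightarrow> int \<Rightarrow> 'a \<Rightarrow> 'a" where
  "Rop u p q \<equiv> join2 u (- p) (inv u) q"

abbreviation Cyc :: "'a \<Rightarrow> int \<Rightarrow> 'a \<Rightarrow> 'a" where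
  "Cyc u p \<equiv> meet2 u (- p) \<one> 1"

definition conjby :: "'a \<Rightarrow> 'a \<Rightarrow> 'a" where
  "conjby u g = inv g \<otimes> u \<otimes> g"

lemma conjby_closed [simp]: "u \<in> C \<Longrightarrow> g \<in> C \<Longrightarrow> conjby u g \<in> C"
  by (simp add: conjby_def)

lemma conjby_mult: "\<lbrakk>u \<in> C; g \<in> C; h \<in> C\<rbrakk> \<Longrightarrow> conjby u (g \<otimes> h) = conjby (conjby u g) h"
  by (simp add: conjby_def inv_mult_group m_assoc)

lemma conjby_one [simp]: "u \<in> C \<Longrightarrow> conjby u \<one> = u"
  by (simp add: conjby_def)

lemma conjby_inv: "\<lbrakk>u \<in> C; g \<in> C\<rbrakk> \<Longrightarrow> inv (conjby u g) = conjby (inv u) g"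
  by (simp add: conjby_def inv_mult_group m_assoc)

lemma conjby_cancel: "\<lbrakk>u \<in> C; g \<in> C\<rbrakk> \<Longrightarrow> conjby (conjby u g) (inv g) = u"
  by (simp flip: conjby_mult)

lemma act_transport: "\<lbrakk>u \<in> C; g \<in> C; h \<in> C\<rbrakk> \<Longrightarrow> act u k (g \<otimes> h) = g \<otimes> act (conjby u g) k h"
  by (simp add: act_def conjby_def m_assoc)

text \<open>
  Change of base point: the operators of \<open>u\<close> at \<open>g h\<close> are those of the conjugate of \<open>u\<close> by \<open>g\<close> at \<open>h\<close>,
  translated by \<open>g\<close>. Statements about conjugates of \<open>u\<close> thus become statements about \<open>u\<close> and a conjugating element.
\<close>

lemma meet2_transport:
  assumes "u \<in> C" "v \<in> C" "g \<in> C" "h \<in> C"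
  shows "meet2 u k v l (g \<otimes> h) = g \<otimes> meet2 (conjby u g) k (conjby v g) l h"
  using assms by (simp add: meet2_def act_transport mult_mt)

lemma meet2_pow_transport:
  assumes "u \<in> C" "v \<in> C" "g \<in> C" "h \<in> C"
  shows "(meet2 u k v l ^^ n) (g \<otimes> h) = g \<otimes> (meet2 (conjby u g) k (conjby v g) l ^^ n) h"
  using assms by (induction n) (auto simp: meet2_transport)

lemma join2_transport:
  assumes "u \<in> C" "v \<in> C" "g \<in> C" "h \<in> C"
  shows "join2 u k v l (g \<otimes> h) = g \<otimes> join2 (conjby u g) k (conjby v g) l h"
  using assms by (simp add: join2_def act_transport mult_jn conjby_inv)

lemma join2_pow_transport:
  assumes "u \<in> C" "v \<in> C" "g \<in> C" "h \<in> C"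
  shows "(join2 u k v l ^^ n) (g \<otimes> h) = g \<otimes> (join2 (conjby u g) k (conjby v g) l ^^ n) h"
  using assms by (induction n) (auto simp: join2_transport)

text \<open>
  The formula amounts to \<open>u D\<^sup>-\<^sup>p \<and> u\<^sup>-\<^sup>1 D\<^sup>q = 1\<close>: the first factor of \<open>u\<close> and the complement of its
  last factor have no common divisor, which says that the normal form of \<open>u\<close> stays left weighted when it is closed up to a cycle.
\<close>

definition rigid :: "'a \<Rightarrow> int \<Rightarrow> int \<Rightarrow> bool" where
  "rigid u p q \<longleftrightarrow> u \<in> C \<and> Lop u p q \<one> = \<one>"

text \<open>The right-handed notion; see \<open>opposite_rigid_iff\<close>.\<close>

definition rrigid :: "'a \<Rightarrow> int \<Rightarrow> int \<Rightarrow> bool" where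
  "rrigid u p q \<longleftrightarrow> u \<in> C \<and> Rop u p q \<one> = \<one>"

definition bounded_by :: "'a \<Rightarrow> int \<Rightarrow> int \<Rightarrow> bool" where
  "bounded_by u p q \<longleftrightarrow> u \<otimes> D [^] (- p) \<in> P \<and> inv u \<otimes> D [^] q \<in> P"

lemma bounded_by_Lop: "u \<in> C \<Longrightarrow> bounded_by u p q \<longleftrightarrow> \<one> \<preceq> Lop u p q \<one>"
  using le_meet2_iff[of u "inv u" \<one> \<one> "- p" q] by (simp add: bounded_by_def act_def)

lemma rigid_bounded: "rigid u p q \<Longrightarrow> bounded_by u p q"
  using bounded_by_Lop[of u p q] by (simp add: rigid_def P_one)

lemma rrigid_bounded: "rrigid u p q \<Longrightarrow> bounded_by u p q"
  using bounded_by_Lop[of u p q] join2_adjoint[of u "inv u" \<one> \<one> "- p" q]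
  by (simp add: rrigid_def P_one)

lemma Lop_fixed_pow: "Lop u p q g = g \<Longrightarrow> (Lop u p q ^^ n) g = g"
  by (induction n) auto

text \<open>
  The rigidity of all powers of a rigid element. Below \<open>L\<^sup>m\<^sup>+\<^sup>n e = e\<close> lies everything that is below all
  \<open>\<alpha>\<^sup>i \<psi>\<^sup>m\<^sup>+\<^sup>n\<^sup>-\<^sup>i e\<close>, and each of these is above \<open>\<alpha>\<^sup>m e\<close> or above \<open>\<psi>\<^sup>n e\<close>.
\<close>

lemma Lop_fixed_stable:
  assumes "u \<in> C" "e \<in> C" "h \<in> C" "Lop u p q e = e"
    and "h \<preceq> (act u (- p) ^^ m) e" "h \<preceq> (act (inv u) q ^^ n) e"
  shows "h \<preceq> e"
proof -
  let ?A = "act u (- p)" and ?B = "act (inv u) q"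
  have le: "e \<preceq> ?A e" "e \<preceq> ?B e"
    using assms le_meet2_iff[of u "inv u" e e "- p" q] by (simp_all add: div_refl)
  have "h \<preceq> (?A ^^ i) ((?B ^^ (m + n - i)) e)" if "i \<le> m + n" for i
  proof (cases "m \<le> i")
    case True
    have "(?A ^^ m) e \<preceq> (?A ^^ i) e"
    proof -
      have "(?A ^^ m) e \<preceq> (?A ^^ m) ((?A ^^ (i - m)) e)"
        using act_pow_increasing[OF _ _ le(1)] assms by (simp add: act_pow_mono_iff)
      moreover have "(?A ^^ m) ((?A ^^ (i - m)) e) = (?A ^^ i) e"
        using True by (metis comp_apply funpow_add le_add_diff_inverse)
      ultimately show ?thesis by simp
    qed
    moreover have "(?A ^^ i) e \<preceq> (?A ^^ i) ((?B ^^ (m + n - i)) e)"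
      using assms act_pow_increasing[OF _ _ le(2)] by (simp add: act_pow_mono_iff)
    ultimately show ?thesis using assms div_trans by (meson act_pow_closed inv_closed)
  next
    case False
    have "(?B ^^ n) e \<preceq> (?B ^^ (m + n - i)) e"
    proof -
      have "(?B ^^ n) e \<preceq> (?B ^^ n) ((?B ^^ (m - i)) e)"
        using act_pow_increasing[OF _ _ le(2)] assms by (simp add: act_pow_mono_iff)
      moreover have "(?B ^^ n) ((?B ^^ (m - i)) e) = (?B ^^ (m + n - i)) e"
        using False by (metis comp_apply funpow_add add.commute Nat.add_diff_assoc nat_le_linear)
      ultimately show ?thesis by simp
    qed
    moreover have "(?B ^^ (m + n - i)) e \<preceq> (?A ^^ i) ((?B ^^ (m + n - i)) e)"
    proof -
      have "(?A ^^ i) ((?B ^^ j) e) = (?B ^^ j) ((?A ^^ i) e)" for j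
        by (rule funpow_commute_on[of C]) (use assms in \<open>auto simp: act_swap\<close>)
      then show ?thesis
        using assms act_pow_increasing[OF _ _ le(1), of i] by (simp add: act_pow_mono_iff)
    qed
    ultimately show ?thesis using assms div_trans by (meson act_pow_closed inv_closed)
  qed
  then have "h \<preceq> (Lop u p q ^^ (m + n)) e"
    using assms by (simp add: le_meet2_pow_iff)
  then show ?thesis using Lop_fixed_pow[OF assms(4)] by simp
qed

text \<open>
  The two bounds that single out the super summit set: if some conjugate of \<open>u\<close> lies between \<open>D\<^sup>p\<close> and
  \<open>D\<^sup>q\<close>, then the conjugates that do so are those of minimal canonical length.
\<close>

definition extremal :: "'a \<Rightarrow> int \<Rightarrow> int \<Rightarrow> bool" where
  "extremal u p q \<longleftrightarrow> (\<forall>g\<in>C. \<forall>j. (conjby u g \<otimes> D [^] (- j) \<in> P \<longrightarrow> j \<le> p) \<and>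
     (inv (conjby u g) \<otimes> D [^] j \<in> P \<longrightarrow> q \<le> j))"

lemma act_pow_le_act_pow:
  assumes "a \<in> C" "c \<in> C" "g \<in> C" "a \<otimes> c = c \<otimes> a" "act a k g \<preceq> act c l g"
  shows "(act a k ^^ n) g \<preceq> (act c l ^^ n) g"
proof (induction n)
  case (Suc n)
  have "act a k ((act a k ^^ n) g) \<preceq> act a k ((act c l ^^ n) g)"
    using Suc assms by (simp add: act_mono_iff)
  also have "act a k ((act c l ^^ n) g) = (act c l ^^ n) (act a k g)"
    using assms act_pow_swap[of a c g n l k] by simp
  finally have 1: "act a k ((act a k ^^ n) g) \<preceq> (act c l ^^ n) (act a k g)" .
  have "(act c l ^^ n) (act a k g) \<preceq> (act c l ^^ n) (act c l g)"
    using assms by (simp add: act_pow_mono_iff)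
  then show ?case using 1 assms div_trans[of "act a k ((act a k ^^ n) g)"] by (simp add: funpow_swap1)
qed (use assms in \<open>simp add: div_refl\<close>)

text \<open>
  If the conjugate by \<open>g\<close> were above \<open>D\<^sup>p\<^sup>+\<^sup>1\<close>, then \<open>\<phi>\<^sup>k g \<preceq> \<alpha>\<^sup>k g\<close> for all \<open>k\<close>. Since \<open>g\<close> is at bounded
  distance from \<open>1\<close>, this gives \<open>\<phi>\<^sup>k\<^sup>-\<^sup>2\<^sup>b 1 \<preceq> \<alpha>\<^sup>k 1\<close>. For \<open>k = 2 b + q - p\<close> the left-hand side is \<open>\<alpha> \<psi> 1\<close>, so
  that \<open>\<psi> 1\<close> is below a power of \<open>\<alpha>\<close> at \<open>1\<close>, and rigidity forces \<open>\<psi> 1 = 1\<close>.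
\<close>

lemma rigid_not_raised:
  assumes y: "rigid y p q" and "p < q" and ne: "inv y \<otimes> D [^] q \<noteq> \<one>" and g: "g \<in> C"
  shows "\<not> act \<one> 1 g \<preceq> act y (- p) g"
proof
  assume le: "act \<one> 1 g \<preceq> act y (- p) g"
  let ?A = "act y (- p)" and ?B = "act (inv y) q" and ?F = "act \<one> 1"
  have yC: "y \<in> C" and fix1: "Lop y p q \<one> = \<one>" using y by (auto simp: rigid_def)
  obtain b where b: "D [^] (- int b) \<preceq> g" "g \<preceq> D [^] int b" by (rule D_pow_bounds[OF g])
  \<comment> \<open>The predecessor of the exponent, so that one factor \<open>\<alpha>\<close> can be split off below.\<close>
  define k where "k = 2 * b + nat (q - p) - 1"
  have k: "int (Suc k) = 2 * int b + (q - p)" using assms(2) by (simp add: k_def)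
  have "(?F ^^ Suc k) (D [^] (- int b)) \<preceq> (?F ^^ Suc k) g"
    using b g by (subst act_pow_mono_iff) auto
  moreover have "(?F ^^ Suc k) g \<preceq> (?A ^^ Suc k) g"
    using le yC g by (intro act_pow_le_act_pow) auto
  moreover have "(?A ^^ Suc k) g \<preceq> (?A ^^ Suc k) (D [^] int b)"
    using b g yC by (subst act_pow_mono_iff) auto
  ultimately have "(?F ^^ Suc k) (D [^] (- int b)) \<preceq> (?A ^^ Suc k) (D [^] int b)"
    using div_trans g yC by (meson act_pow_closed D_closed int_pow_closed one_closed)
  moreover have "(?F ^^ Suc k) (D [^] (- int b)) = act \<one> (int b) (act \<one> (q - p) \<one>)"
    using k by (simp only: act_pow one_closed int_pow_closed D_closed nat_pow_one)
      (simp add: act_def D_pow_add add.commute)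
  moreover have "(?A ^^ Suc k) (D [^] int b) = act \<one> (int b) ((?A ^^ Suc k) \<one>)"
    using act_pow_swap[of \<one> y \<one> "Suc k" "- p" "int b"] yC by (simp add: act_def)
  ultimately have "act \<one> (q - p) \<one> \<preceq> (?A ^^ Suc k) \<one>"
    using yC by (simp add: act_mono_iff del: funpow.simps)
  moreover have "act \<one> (q - p) \<one> = ?A (?B \<one>)" using yC by (simp add: act_act)
  ultimately have "?B \<one> \<preceq> (?A ^^ k) \<one>" using yC by (simp add: act_mono_iff)
  then have "?B \<one> \<preceq> \<one>"
    using Lop_fixed_stable[OF yC _ _ fix1, of "?B \<one>" k 1] yC by (simp add: div_refl)
  moreover have "\<one> \<preceq> ?B \<one>"
    using rigid_bounded[OF y] yC by (simp add: bounded_by_def act_def)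
  ultimately have "?B \<one> = \<one>" by (rule div_antisym) (use yC in auto)
  then show False using ne yC by (simp add: act_def)
qed

lemma rigid_lower:
  assumes y: "rigid y p q" and "p < q" and ne: "inv y \<otimes> D [^] q \<noteq> \<one>" and g: "g \<in> C"
    and j: "conjby y g \<otimes> D [^] (- j) \<in> P"
  shows "j \<le> p"
proof (rule ccontr)
  assume "\<not> j \<le> p"
  have yC: "y \<in> C" using y by (simp add: rigid_def)
  let ?u = "conjby y g"
  have "?u \<otimes> D [^] (- j) \<otimes> D [^] (j - p - 1) \<in> P"
    using P_mult[OF j] D_nat_pow_P[of "nat (j - p - 1)"] \<open>\<not> j \<le> p\<close> by (simp flip: int_pow_int)
  then have "?u \<otimes> D [^] (- p) \<otimes> D [^] (- 1::int) \<in> P"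
    using yC g by (simp add: m_assoc D_pow_add)
  then have "D [^] (- 1::int) \<otimes> (?u \<otimes> D [^] (- p)) \<in> P"
    using yC g swap_D_pow[of "?u \<otimes> D [^] (- p)" "- 1"] by simp
  then have "D \<preceq> ?u \<otimes> D [^] (- p)" by (simp add: int_pow_neg)
  then have "g \<otimes> D \<preceq> g \<otimes> (?u \<otimes> D [^] (- p))" using yC g by (subst mult_le_iff) auto
  moreover have "g \<otimes> (?u \<otimes> D [^] (- p)) = act y (- p) g"
    using yC g by (simp add: conjby_def act_def m_assoc)
  ultimately show False using rigid_not_raised[OF y assms(2) ne g] g by (simp add: act_def)
qed

text \<open>Passing to the inverse exchanges \<open>\<alpha>\<close> and \<open>\<psi>\<close>; the upper bound on conjugates is therefore the lower one for the inverse.\<close>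

lemma rigid_inverse: "rigid y p q \<Longrightarrow> rigid (inv y) (- q) (- p)"
  by (auto simp: rigid_def meet2_def mt_commute)

lemma rigid_extremal:
  assumes y: "rigid y p q" and "p < q" and "inv y \<otimes> D [^] q \<noteq> \<one>" "y \<otimes> D [^] (- p) \<noteq> \<one>"
  shows "extremal y p q"
  unfolding extremal_def
proof (intro ballI allI conjI impI)
  fix g j assume g: "g \<in> C"
  have yC: "y \<in> C" using y by (simp add: rigid_def)
  show "j \<le> p" if "conjby y g \<otimes> D [^] (- j) \<in> P"
    by (rule rigid_lower[OF assms(1-3) g that])
  show "q \<le> j" if "inv (conjby y g) \<otimes> D [^] j \<in> P"
    using rigid_lower[OF rigid_inverse[OF y], of g "- j"] assms that g yC by (simp add: conjby_inv)
qed

lemma extremal_conjby: "extremal u p q \<Longrightarrow> u \<in> C \<Longrightarrow> g \<in> C \<Longrightarrow> extremal (conjby u g) p q"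
  unfolding extremal_def by (metis conjby_mult m_closed)

lemma extremal_is_inf:
  assumes "extremal u p q" "bounded_by u p q" "u \<in> C"
  shows "is_inf u p"
proof -
  have swap: "D [^] (- j) \<otimes> u \<in> P \<longleftrightarrow> u \<otimes> D [^] (- j) \<in> P" for j :: int
    by (rule swap_D_pow[OF assms(3), symmetric])
  have "u \<otimes> D [^] (- j) \<in> P \<Longrightarrow> j \<le> p" for j :: int
    using assms(1)[unfolded extremal_def, rule_format, OF one_closed, of j] assms(3) by simp
  then show ?thesis using assms(2) by (simp add: is_inf_def swap bounded_by_def)
qed

lemma bounded_conjby_iff:
  assumes "u \<in> C" "g \<in> C"
  shows "bounded_by (conjby u g) p q \<longleftrightarrow> g \<preceq> Lop u p q g"
proof -
  have "Lop u p q (g \<otimes> \<one>) = g \<otimes> Lop (conjby u g) p q \<one>"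
    using assms by (subst meet2_transport) (auto simp: conjby_inv)
  then show ?thesis
    using assms bounded_by_Lop[of "conjby u g" p q] by simp
qed

lemma rigid_conjby_iff:
  assumes "u \<in> C" "g \<in> C"
  shows "rigid (conjby u g) p q \<longleftrightarrow> Lop u p q g = g"
proof -
  have "Lop u p q (g \<otimes> \<one>) = g \<otimes> Lop (conjby u g) p q \<one>"
    using assms by (subst meet2_transport) (auto simp: conjby_inv)
  moreover have "g \<otimes> x = g \<longleftrightarrow> x = \<one>" if "x \<in> C" for x
    using that assms by (metis cancel_inv(1) r_one l_inv)
  ultimately show ?thesis
    using assms by (simp add: rigid_def)
qed

lemma rrigid_conjby_iff:
  assumes "u \<in> C" "g \<in> C"
  shows "rrigid (conjby u g) p q \<longleftrightarrow> Rop u p q g = g"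
proof -
  have "Rop u p q (g \<otimes> \<one>) = g \<otimes> Rop (conjby u g) p q \<one>"
    using assms by (subst join2_transport) (auto simp: conjby_inv)
  moreover have "g \<otimes> x = g \<longleftrightarrow> x = \<one>" if "x \<in> C" for x
    using that assms by (metis cancel_inv(1) r_one l_inv)
  ultimately show ?thesis
    using assms by (simp add: rrigid_def)
qed

section \<open>Cycling\<close>

definition cyc :: "'a \<Rightarrow> 'a" where
  "cyc u = conjby u (head_factor u (THE p. is_inf u p))"

lemma Lop_Cyc: "u \<in> C \<Longrightarrow> g \<in> C \<Longrightarrow> Cyc u p (Lop u p q g) = Lop u p q (Cyc u p g)"
  by (rule meet2_meet2) auto

lemma Cyc_bounded:
  assumes "u \<in> C" "g \<in> C" "g \<preceq> Lop u p q g"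
  shows "Cyc u p g \<preceq> Lop u p q (Cyc u p g)"
  using meet2_mono[of u \<one> g "Lop u p q g" "- p" 1] assms by (simp add: Lop_Cyc)

lemma Cyc_pow_bounded:
  assumes "u \<in> C" "bounded_by u p q"
  shows "(Cyc u p ^^ t) \<one> \<preceq> Lop u p q ((Cyc u p ^^ t) \<one>)"
proof (induction t)
  case 0
  then show ?case using assms bounded_by_Lop[of u p q] by simp
next
  case (Suc t)
  then show ?case using assms Cyc_bounded[of u "(Cyc u p ^^ t) \<one>" p q] by simp
qed

lemma cyc_eq:
  assumes "u \<in> C" "bounded_by u p q" "extremal u p q"
  shows "cyc u = conjby u (Cyc u p \<one>)"
proof -
  have "(THE p. is_inf u p) = p"
    using extremal_is_inf[OF assms(3,2,1)] is_inf_unique by blast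
  then show ?thesis using assms(1) by (simp add: cyc_def head_factor_def meet2_def act_def)
qed

text \<open>
  Iterated cycling is governed by iterates of one monotone operator on conjugating elements. The
  bounds of \<open>u\<close> enter because the exponent \<open>p\<close> in that operator must be the infimum of every element on the orbit.
\<close>

lemma cyc_pow_eq:
  assumes "u \<in> C" "bounded_by u p q" "extremal u p q"
  shows "(cyc ^^ t) u = conjby u ((Cyc u p ^^ t) \<one>)"
proof (induction t)
  case 0
  then show ?case using assms by simp
next
  case (Suc t)
  let ?g = "(Cyc u p ^^ t) \<one>"
  let ?v = "conjby u ?g"
  have g: "?g \<in> C" using assms by simp
  have "bounded_by ?v p q" using assms g Cyc_pow_bounded by (simp add: bounded_conjby_iff)
  moreover have "extremal ?v p q" using assms g by (intro extremal_conjby)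
  ultimately have "cyc ?v = conjby ?v (Cyc ?v p \<one>)" using assms by (intro cyc_eq) auto
  also have "\<dots> = conjby u (?g \<otimes> Cyc ?v p \<one>)" using assms g by (simp add: conjby_mult)
  also have "?g \<otimes> Cyc ?v p \<one> = Cyc u p (?g \<otimes> \<one>)"
  proof -
    have "conjby \<one> ?g = \<one>" using g by (simp add: conjby_def)
    then show ?thesis using assms g by (subst meet2_transport) auto
  qed
  finally show ?case using Suc g by simp
qed

lemma phi_increasing: "g \<in> C \<Longrightarrow> g \<preceq> act \<one> 1 g"
  using D_P by (simp add: act_def)

lemma phi_pow: "g \<in> C \<Longrightarrow> (act \<one> 1 ^^ n) g = act \<one> (int n) g"
  by (simp add: act_pow)

text \<open>
  With \<open>r = q - p\<close>, each \<open>\<alpha>\<^sup>i \<phi>\<^sup>r\<^sup>-\<^sup>i g\<close> is above \<open>\<alpha> g\<close>: for \<open>i \<ge> 1\<close> because \<open>\<alpha>\<close> and \<open>\<phi>\<close> increase \<open>g\<close>, and for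
  \<open>i = 0\<close> because \<open>\<phi>\<^sup>r = \<alpha> \<psi>\<close>.
\<close>

lemma act_le_Cyc_pow:
  assumes "u \<in> C" "g \<in> C" "g \<preceq> Lop u p q g" "int r = q - p" "r > 0"
  shows "act u (- p) g \<preceq> (Cyc u p ^^ r) g"
proof -
  let ?A = "act u (- p)" and ?F = "act \<one> 1"
  have le: "g \<preceq> ?A g" "g \<preceq> act (inv u) q g"
    using assms by (simp_all add: le_meet2_iff)
  have "?A g \<preceq> (?A ^^ i) ((?F ^^ (r - i)) g)" if "i \<le> r" for i
  proof (cases i)
    case 0
    have "(?F ^^ r) g = ?A (act (inv u) q g)"
      using assms by (simp add: phi_pow act_act)
    then show ?thesis using 0 le assms by (simp add: act_mono_iff)
  next
    case (Suc j)
    have "?A g \<preceq> ?A ((?A ^^ j) g)"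
      using act_pow_increasing[OF _ _ le(1), of j] assms by (simp add: act_mono_iff)
    moreover have "(?A ^^ i) g \<preceq> (?A ^^ i) ((?F ^^ (r - i)) g)"
      using act_pow_increasing[OF _ _ phi_increasing[OF assms(2)], of "r - i"] assms
      by (simp add: act_pow_mono_iff)
    ultimately show ?thesis
      using Suc assms div_trans[of "?A g" "(?A ^^ i) g"] by simp
  qed
  then show ?thesis using assms by (simp add: le_meet2_pow_iff)
qed

text \<open>
  A full round of cyclings of a rigid element rotates its normal form once, and so amounts to \<open>\<alpha>\<close>.
\<close>

lemma Cyc_pow_fixed:
  assumes "u \<in> C" "e \<in> C" "Lop u p q e = e" "int r = q - p" "r > 0"
  shows "(Cyc u p ^^ r) e = act u (- p) e"
proof -
  let ?A = "act u (- p)" and ?F = "act \<one> 1"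
  let ?h = "(Cyc u p ^^ r) e"
  have "\<forall>i\<le>r. ?h \<preceq> (?A ^^ i) ((?F ^^ (r - i)) e)"
    using le_meet2_pow_iff[of u \<one> e ?h r "- p" 1] assms by (simp add: div_refl)
  from this[rule_format, of r] this[rule_format, of 0]
  have h: "?h \<preceq> (?A ^^ r) e" "?h \<preceq> (?F ^^ r) e" by auto
  let ?k = "act (inv u) p ?h"
  obtain r' where r': "r = Suc r'" using assms by (cases r) auto
  have "?k \<preceq> (?A ^^ r') e"
    using h(1) assms r' by (simp add: le_act_iff)
  moreover have "?k \<preceq> act (inv u) q e"
  proof -
    have "(?F ^^ r) e = ?A (act (inv u) q e)"
      using assms by (simp add: phi_pow act_act)
    then show ?thesis using h(2) assms by (simp add: le_act_iff)
  qed
  ultimately have "?k \<preceq> e"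
    using Lop_fixed_stable[OF assms(1,2) _ assms(3), of ?k r' 1] assms by simp
  then have "?h \<preceq> ?A e" using assms by (simp add: le_act_iff)
  moreover have "?A e \<preceq> ?h"
    using act_le_Cyc_pow[of u e p q r] assms by (simp add: div_refl)
  ultimately show ?thesis using assms by (simp add: div_antisym)
qed

lemma Cyc_pow_length_one:
  assumes "u \<in> C" "g \<in> C" "g \<preceq> Lop u p q g" "q = p + 1"
  shows "Cyc u p g = act u (- p) g"
proof -
  have "g \<preceq> act (inv u) q g" using assms by (simp add: le_meet2_iff)
  then have "act u (- p) g \<preceq> act u (- p) (act (inv u) q g)" using assms by (simp add: act_mono_iff)
  then have "act u (- p) g \<preceq> act \<one> 1 g" using assms by (simp add: act_act)
  then show ?thesis using assms by (simp add: meet2_def mt_absorb)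
qed

lemma nat_pow_comm_self: "u \<in> C \<Longrightarrow> u [^] (k::nat) \<otimes> u = u \<otimes> u [^] k"
  by (induction k) (auto simp: m_assoc)

lemma funpow_mult_comp: "(f ^^ (m * Suc k)) x = (f ^^ m) ((f ^^ (m * k)) x)"
  by (simp add: funpow_add)

lemma Cyc_pow_mult_fixed:
  assumes "u \<in> C" "e \<in> C" "Lop u p q e = e" "int r = q - p" "r > 0"
  shows "(Cyc u p ^^ (r * k)) e = (act u (- p) ^^ k) e"
proof (induction k)
  case (Suc k)
  have "(Cyc u p ^^ (r * Suc k)) e = (Cyc u p ^^ r) ((act u (- p) ^^ k) e)"
    by (simp only: funpow_mult_comp Suc)
  also have "\<dots> = act (u [^] k) (int k * (- p)) ((Cyc u p ^^ r) e)"
    using assms by (simp only: act_pow) (intro meet2_pow_act; simp add: nat_pow_comm_self)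
  also have "\<dots> = act (u [^] k) (int k * (- p)) (act u (- p) e)"
    by (simp only: Cyc_pow_fixed[OF assms])
  also have "\<dots> = (act u (- p) ^^ k) (act u (- p) e)"
    using assms by (simp add: act_pow)
  finally show ?case by (simp add: funpow_swap1)
qed simp

text \<open>
  The converse of the previous computation. All \<open>\<alpha>\<^sup>i \<phi>\<^sup>r\<^sup>K\<^sup>-\<^sup>i g\<close> with \<open>i \<le> r K\<close> are above \<open>\<alpha>\<^sup>K (L g)\<close>. If \<open>i > K\<close>, one more
  \<open>\<alpha>\<close> is left over and \<open>L g \<preceq> \<alpha> g\<close>; if \<open>i < K\<close>, trading \<open>\<phi>\<^sup>r\<close> for \<open>\<alpha> \<psi>\<close> leaves over a \<open>\<psi>\<close>, and
  \<open>L g \<preceq> \<psi> g\<close>. For \<open>i = K\<close> there remains \<open>\<phi>\<^sup>(\<^sup>r\<^sup>-\<^sup>1\<^sup>)\<^sup>K g\<close>, which is above \<open>\<phi>\<^sup>r g = \<alpha> \<psi> g\<close> since \<open>(r - 1) K \<ge> r\<close>;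
  here \<open>r \<ge> 2\<close> is essential, as for \<open>r = 1\<close> this term is \<open>g\<close> itself.
\<close>

lemma fixed_of_Cyc_pow:
  assumes "u \<in> C" "g \<in> C" "g \<preceq> Lop u p q g" "int r = q - p" "r \<ge> 2" "K \<ge> 2"
    and eq: "(Cyc u p ^^ (r * K)) g = (act u (- p) ^^ K) g"
  shows "Lop u p q g = g"
proof -
  let ?A = "act u (- p)" and ?B = "act (inv u) q" and ?F = "act \<one> 1" and ?L = "Lop u p q g"
  have le: "g \<preceq> ?A g" "g \<preceq> ?B g"
    using assms by (simp_all add: le_meet2_iff)
  have L: "?L \<preceq> ?A g" "?L \<preceq> ?B g"
    using assms by (simp_all add: meet2_def mt_le)
  have LC: "?L \<in> C" using assms by simp
  have "(?A ^^ K) ?L \<preceq> (?A ^^ i) ((?F ^^ (r * K - i)) g)" if "i \<le> r * K" for i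
  proof -
    consider (gt) j where "i = Suc (K + j)" | (eq) "i = K" | (lt) a where "K = i + Suc a"
    proof -
      have "i < K \<or> i = K \<or> K < i" by linarith
      then show ?thesis using that by (metis less_iff_Suc_add add_Suc_right)
    qed
    then show ?thesis
    proof cases
      case gt
      have "?A g \<preceq> ?A ((?A ^^ j) ((?F ^^ (r * K - i)) g))"
      proof -
        have "g \<preceq> (?A ^^ j) g" using act_pow_increasing[OF _ _ le(1)] assms by simp
        moreover have "(?A ^^ j) g \<preceq> (?A ^^ j) ((?F ^^ (r * K - i)) g)"
          using act_pow_increasing[OF _ _ phi_increasing[OF assms(2)]] assms by (simp add: act_pow_mono_iff)
        ultimately show ?thesis using assms div_trans[of g "(?A ^^ j) g"] by (simp add: act_mono_iff)
      qed
      then have "?L \<preceq> (?A ^^ Suc j) ((?F ^^ (r * K - i)) g)"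
        using L(1) LC assms div_trans[of ?L "?A g"] by simp
      then have "(?A ^^ K) ?L \<preceq> (?A ^^ K) ((?A ^^ Suc j) ((?F ^^ (r * K - i)) g))"
        using LC assms by (subst act_pow_mono_iff) auto
      then show ?thesis
        unfolding gt by (metis add_Suc_right comp_apply funpow_add)
    next
      case eq
      have "(?F ^^ (r * K - K)) g = ?A (?B ((?F ^^ (r * K - K - r)) g))"
      proof -
        have "r * K - K \<ge> r" 
        proof -
          obtain r' where "r = 2 + r'" using assms(5) le_Suc_ex by blast
          moreover obtain K' where "K = 2 + K'" using assms(6) le_Suc_ex by blast
          ultimately show ?thesis by simp
        qed
        then have i: "int (r * K - K) = - p + (q + int (r * K - K - r))" using assms(4) by linarith
        show ?thesis unfolding phi_pow[OF assms(2)] i using assms(1,2) by (simp add: act_act)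
      qed
      moreover have "?A g \<preceq> ?A (?B ((?F ^^ (r * K - K - r)) g))"
      proof -
        have "?B g \<preceq> ?B ((?F ^^ (r * K - K - r)) g)"
          using act_pow_increasing[OF _ _ phi_increasing[OF assms(2)]] assms by (simp add: act_mono_iff)
        then show ?thesis using le(2) assms div_trans[of g "?B g"] by (simp add: act_mono_iff)
      qed
      ultimately have "?L \<preceq> (?F ^^ (r * K - K)) g"
        using L(1) LC assms div_trans[of ?L "?A g"] by simp
      then show ?thesis using eq LC assms by (simp add: act_pow_mono_iff)
    next
      case lt
      have "(?F ^^ (r * K - i)) g = (?A ^^ Suc a) (?B ((?B ^^ a) ((?F ^^ ((r - 1) * i)) g)))"
      proof -
        have r: "r * K - i = r * Suc a + (r - 1) * i"
          using lt assms(5) by (cases r) (auto simp: algebra_simps)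
        have "(?F ^^ (r * Suc a)) x = (?A ^^ Suc a) ((?B ^^ Suc a) x)" if "x \<in> C" for x a
        proof (induction a)
          case 0
          then show ?case using that assms by (simp add: phi_pow act_act)
        next
          case (Suc a)
          have "(?F ^^ (r * Suc (Suc a))) x = (?F ^^ r) ((?A ^^ Suc a) ((?B ^^ Suc a) x))"
            by (subst funpow_mult_comp) (simp only: Suc)
          also have "\<dots> = ?A (?B ((?A ^^ Suc a) ((?B ^^ Suc a) x)))"
            using that assms by (simp add: phi_pow act_act del: funpow.simps)
          also have "?B ((?A ^^ Suc a) ((?B ^^ Suc a) x)) = (?A ^^ Suc a) (?B ((?B ^^ Suc a) x))"
            using that assms by (intro act_pow_swap[symmetric]) auto
          finally show ?case by simp
        qed
        from this[of "(?F ^^ ((r - 1) * i)) g" a] show ?thesis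
          using assms unfolding r by (simp add: funpow_add)
      qed
      then have "(?A ^^ i) ((?F ^^ (r * K - i)) g) =
          (?A ^^ K) (?B ((?B ^^ a) ((?F ^^ ((r - 1) * i)) g)))"
        unfolding lt by (metis comp_apply funpow_add)
      moreover have "?B g \<preceq> ?B ((?B ^^ a) ((?F ^^ ((r - 1) * i)) g))"
      proof -
        have "g \<preceq> (?B ^^ a) g" using act_pow_increasing[OF _ _ le(2)] assms by simp
        moreover have "(?B ^^ a) g \<preceq> (?B ^^ a) ((?F ^^ ((r - 1) * i)) g)"
          using act_pow_increasing[OF _ _ phi_increasing[OF assms(2)]] assms by (simp add: act_pow_mono_iff)
        ultimately show ?thesis using assms div_trans[of g "(?B ^^ a) g"] by (simp add: act_mono_iff)
      qed
      ultimately show ?thesis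
        using L(2) LC assms div_trans[of ?L "?B g"] by (simp add: act_pow_mono_iff)
    qed
  qed
  then have "(?A ^^ K) ?L \<preceq> (Cyc u p ^^ (r * K)) g"
    using assms(1,2) LC by (subst le_meet2_pow_iff) auto
  then have "?L \<preceq> g" using eq assms LC by (simp add: act_pow_mono_iff)
  then show ?thesis using assms LC by (simp add: div_antisym)
qed

text \<open>
  The ascending sequence \<open>L\<^sup>n g\<close> cannot leave the region below a translate \<open>\<phi>\<^sup>b w\<close> of the fixed point
  \<open>w\<close>, because \<open>L\<close> is monotone and fixes the translate; so its lengths are bounded.
\<close>

lemma Lop_stabilises:
  assumes "u \<in> C" "w \<in> C" "g \<in> C" "Lop u p q w = w" "g \<preceq> Lop u p q g"
  shows "\<exists>N. Lop u p q ((Lop u p q ^^ N) g) = (Lop u p q ^^ N) g"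
proof (rule ccontr)
  let ?L = "Lop u p q"
  assume "\<not> ?thesis"
  then have ne: "(?L ^^ Suc n) g \<noteq> (?L ^^ n) g" for n by auto
  have up: "(?L ^^ n) g \<preceq> (?L ^^ Suc n) g" for n
    using meet2_pow_mono[OF _ _ _ _ assms(5), of u "inv u" n "- p" q] assms
    by (simp add: funpow_swap1)
  have grow: "len g + int n \<le> len ((?L ^^ n) g)" for n
  proof (induction n)
    case (Suc n)
    have "\<not> len ((?L ^^ Suc n) g) \<le> len ((?L ^^ n) g)"
    proof
      assume "len ((?L ^^ Suc n) g) \<le> len ((?L ^^ n) g)"
      then have "(?L ^^ n) g = (?L ^^ Suc n) g"
        using assms(1,3) by (intro div_eqI[OF up]) (simp_all only: meet2_pow_closed inv_closed)
      then show False by (rule ne[THEN notE, OF HOL.sym])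
    qed
    then show ?case using Suc by simp
  qed simp
  obtain b where b: "inv w \<otimes> g \<preceq> D [^] int b"
    using D_pow_bounds[of "inv w \<otimes> g"] assms by blast
  let ?m = "act \<one> (int b) w"
  have mC: "?m \<in> C" using assms by simp
  have "g \<preceq> ?m"
    using b assms mult_le_iff[of w "inv w \<otimes> g" "D [^] int b"] by (simp add: act_def)
  then have "(?L ^^ n) g \<preceq> (?L ^^ n) ?m" for n
    using assms by (intro meet2_pow_mono) auto
  moreover have "(?L ^^ n) ?m = ?m" for n
    using assms meet2_pow_act[of \<one> u "inv u" w n "- p" q "int b"] Lop_fixed_pow[OF assms(4), of n] by simp
  ultimately have "(?L ^^ n) g \<preceq> ?m" for n by simp
  from div_len[OF this] have "len ((?L ^^ n) g) \<le> len ?m" for n using assms mC by simp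
  from order_trans[OF grow this, of "nat (len ?m - len g + 1)"] show False by (simp split: if_splits)
qed

lemma conjby_fixed_iff: "u \<in> C \<Longrightarrow> z \<in> C \<Longrightarrow> conjby u z = u \<longleftrightarrow> z \<otimes> u = u \<otimes> z"
  by (metis cancel_inv(1,2) conjby_def inv_closed m_assoc m_closed)

lemma mult_pow_comm:
  assumes "z \<in> C" "u \<in> C" "z \<otimes> u = u \<otimes> z"
  shows "z [^] (j::nat) \<otimes> u = u \<otimes> z [^] j"
proof (induction j)
  case (Suc j)
  have "z [^] Suc j \<otimes> u = (z [^] j \<otimes> u) \<otimes> z" using assms by (simp add: m_assoc)
  then show ?case using assms Suc by (simp add: m_assoc)
qed (use assms in simp)

lemma Cyc_period_pow:
  assumes "u \<in> C" "z \<in> C" "e \<in> C" "z \<otimes> u = u \<otimes> z" "(Cyc u p ^^ t) e = z \<otimes> e"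
  shows "(Cyc u p ^^ (t * j)) e = z [^] j \<otimes> e"
proof (induction j)
  case (Suc j)
  have "(Cyc u p ^^ (t * Suc j)) e = (Cyc u p ^^ t) (act (z [^] j) 0 e)"
    using assms by (simp only: funpow_mult_comp Suc) (simp add: act_def)
  also have "\<dots> = act (z [^] j) 0 ((Cyc u p ^^ t) e)"
    using assms by (intro meet2_pow_act) (auto simp: mult_pow_comm)
  finally show ?case using assms by (simp add: act_def m_assoc)
qed (use assms in simp)

text \<open>Even powers are used since an even power of \<open>D\<close> is central and can be moved next to \<open>u\<close>.\<close>

lemma act_even_pow: "u \<in> C \<Longrightarrow> e \<in> C \<Longrightarrow>
    (act u (- p) ^^ (2 * t)) e = u [^] (2 * t) \<otimes> D [^] (2 * (- (int t * p))) \<otimes> e"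
  using D_pow_even_central[of e "- (int t * p)"] by (simp add: act_pow act_def m_assoc algebra_simps)

text \<open>
  Let \<open>z = c\<^sup>t 1\<close>, which centralizes \<open>u\<close>, and let \<open>e = L\<^sup>N 1\<close> be the fixed point of \<open>L\<close> above \<open>1\<close>. As \<open>c\<close>
  commutes with \<open>L\<close>, also \<open>c\<^sup>t e = z e\<close>; on the other hand \<open>c\<^sup>r = \<alpha>\<close> on the orbit of \<open>e\<close>. Comparing \<open>c\<^sup>2\<^sup>r\<^sup>t e\<close>
  computed in both ways determines the power \<open>z\<^sup>2\<^sup>r\<close>, after cancellation of \<open>e\<close>, and then
  \<open>c\<^sup>2\<^sup>r\<^sup>t 1 = \<alpha>\<^sup>2\<^sup>t 1\<close>, to which \<open>fixed_of_Cyc_pow\<close> applies.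
\<close>

theorem cyc_periodic_imp_rigid:
  assumes "u \<in> C" "bounded_by u p q" "extremal u p q" "p + 2 \<le> q"
    and w: "w \<in> C" "rigid (conjby u w) p q"
    and per: "t \<ge> 1" "(cyc ^^ t) u = u"
  shows "rigid u p q"
proof -
  define r where "r = nat (q - p)"
  have r: "int r = q - p" "r \<ge> 2" using assms(4) by (auto simp: r_def)
  let ?L = "Lop u p q" and ?C = "Cyc u p"
  define z where "z = (?C ^^ t) \<one>"
  have z: "z \<in> C" using assms by (simp add: z_def)
  have "conjby u z = u" using per cyc_pow_eq[OF assms(1-3)] by (simp add: z_def)
  then have comm: "z \<otimes> u = u \<otimes> z" using assms z by (simp add: conjby_fixed_iff)
  have one: "\<one> \<preceq> ?L \<one>" using assms bounded_by_Lop by blast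
  have "?L w = w" using w assms by (simp add: rigid_conjby_iff)
  then obtain N where N: "?L ((?L ^^ N) \<one>) = (?L ^^ N) \<one>"
    using Lop_stabilises[of u w \<one> p q] assms w one by auto
  define e where "e = (?L ^^ N) \<one>"
  have e: "e \<in> C" "?L e = e" using N assms by (simp_all add: e_def)
  have "(?C ^^ t) e = (?L ^^ N) z"
    unfolding e_def z_def
    by (rule funpow_commute_on[of C]) (use assms in \<open>auto simp: Lop_Cyc\<close>)
  also have "\<dots> = act z 0 e"
    using meet2_pow_act[of z u "inv u" \<one> N "- p" q 0] assms z comm
    by (simp add: e_def inv_comm act_def)
  finally have Ce: "(?C ^^ t) e = z \<otimes> e" using z e by (simp add: act_def)
  have "z [^] (2 * r) \<otimes> e = (act u (- p) ^^ (2 * t)) e"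
    using Cyc_period_pow[OF assms(1) z e(1) comm Ce, of "2 * r"]
      Cyc_pow_mult_fixed[OF assms(1) e r(1), of "2 * t"] r
    by (simp add: mult.commute mult.left_commute)
  also have "\<dots> = u [^] (2 * t) \<otimes> D [^] (2 * (- (int t * p))) \<otimes> e"
    by (rule act_even_pow[OF assms(1) e(1)])
  finally have "z [^] (2 * r) = u [^] (2 * t) \<otimes> D [^] (2 * (- (int t * p)))"
    using z e assms by simp
  then have "z [^] (2 * r) = (act u (- p) ^^ (2 * t)) \<one>"
    using act_even_pow[OF assms(1) one_closed, of t p] assms by simp
  moreover have "(?C ^^ (r * (2 * t))) \<one> = z [^] (2 * r)"
    using Cyc_period_pow[OF assms(1) z one_closed comm, of t p "2 * r"] z
    by (simp add: z_def mult.commute mult.left_commute)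
  ultimately have "?L \<one> = \<one>"
    using fixed_of_Cyc_pow[OF assms(1) one_closed one r(1) r(2), of "2 * t"] per by simp
  then show ?thesis using assms by (simp add: rigid_def)
qed

text \<open>The element in question is \<open>u\<^sup>2 D\<^sup>-\<^sup>2\<^sup>p\<close>, which commutes with \<open>u\<close>.\<close>

lemma conjby_act_two:
  assumes "u \<in> C" shows "conjby u ((act u (- p) ^^ 2) \<one>) = u"
proof -
  define E where "E = D [^] (2 * (- p))"
  have E: "E \<in> C" "E \<otimes> u = u \<otimes> E"
    using D_pow_even_central[of u "- p"] assms by (simp_all add: E_def)
  have "(act u (- p) ^^ 2) \<one> = u [^] (2::nat) \<otimes> E"
    using act_even_pow[of u \<one> 1 p] assms by (simp add: E_def)
  also have "conjby u \<dots> = u"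
    using assms E by (subst conjby_fixed_iff) (auto simp: numeral_2_eq_2 m_assoc)
  finally show ?thesis .
qed

theorem rigid_imp_cyc_periodic:
  assumes "u \<in> C" "extremal u p q" "rigid u p q" "p < q"
  shows "\<exists>t\<ge>1. (cyc ^^ t) u = u"
proof -
  define r where "r = nat (q - p)"
  have r: "int r = q - p" "r > 0" using assms(4) by (auto simp: r_def)
  have "(Cyc u p ^^ (r * 2)) \<one> = (act u (- p) ^^ 2) \<one>"
    using assms r by (intro Cyc_pow_mult_fixed[of u \<one> p q]) (auto simp: rigid_def)
  then have "(cyc ^^ (r * 2)) u = u"
    using cyc_pow_eq[OF assms(1) rigid_bounded[OF assms(3)] assms(2), of "r * 2"]
      conjby_act_two[OF assms(1)] by simp
  then show ?thesis using r by (intro exI[of _ "r * 2"]) auto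
qed

theorem length_one_cyc_periodic:
  assumes "u \<in> C" "bounded_by u p q" "extremal u p q" "q = p + 1"
  shows "\<exists>t\<ge>1. (cyc ^^ t) u = u"
proof -
  have 0: "\<one> \<preceq> Lop u p q \<one>" using assms bounded_by_Lop by blast
  have 1: "Cyc u p \<one> = act u (- p) \<one>"
    using Cyc_pow_length_one[of u \<one> p q] 0 assms by simp
  have "act u (- p) \<one> \<preceq> Lop u p q (act u (- p) \<one>)"
    using Cyc_bounded[of u \<one> p q] 0 assms 1 by simp
  then have "Cyc u p (act u (- p) \<one>) = act u (- p) (act u (- p) \<one>)"
    using Cyc_pow_length_one[of u "act u (- p) \<one>" p q] assms by simp
  then have "(Cyc u p ^^ 2) \<one> = (act u (- p) ^^ 2) \<one>"
    by (simp add: numeral_2_eq_2 1)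
  then have "(cyc ^^ 2) u = u"
    using cyc_pow_eq[OF assms(1-3), of 2] conjby_act_two[OF assms(1)] by simp
  then show ?thesis by (intro exI[of _ 2]) auto
qed

section \<open>Left rigid and right rigid conjugates\<close>

lemma finite_bounded_by: "finite {u \<in> C. bounded_by u p q}"
proof (rule finite_subset)
  show "{u \<in> C. bounded_by u p q} \<subseteq> (\<lambda>a. a \<otimes> D [^] p) ` {a \<in> P. len a \<le> (q - p) * len D}"
  proof
    fix u assume u: "u \<in> {u \<in> C. bounded_by u p q}"
    let ?a = "u \<otimes> D [^] (- p)"
    have "0 \<le> len (inv u \<otimes> D [^] q)" using u by (auto simp: bounded_by_def intro: len_nonneg)
    then have "len ?a \<le> (q - p) * len D"
      using u by (simp add: len_mult len_inv len_D_pow algebra_simps)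
    moreover have "u = ?a \<otimes> D [^] p" using u by (simp add: int_pow_neg)
    ultimately show "u \<in> (\<lambda>a. a \<otimes> D [^] p) ` {a \<in> P. len a \<le> (q - p) * len D}"
      using u by (auto simp: bounded_by_def)
  qed
qed (intro finite_imageI finite_len)

lemma Rop_pow_le_one:
  assumes "u \<in> C" "Lop u p q \<one> = \<one>" shows "(Rop u p q ^^ n) \<one> \<preceq> \<one>"
  using join2_pow_adjoint[of u "inv u" \<one> \<one> n "- p" q] assms Lop_fixed_pow[OF assms(2), of n] by simp

lemma Rop_pow_bounded:
  assumes "u \<in> C" "Lop u p q \<one> = \<one>"
  shows "bounded_by (conjby u ((Rop u p q ^^ n) \<one>)) p q"
proof -
  let ?R = "Rop u p q"
  have "?R \<one> \<preceq> \<one>" using Rop_pow_le_one[OF assms, of 1] by simp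
  then have "(?R ^^ n) (?R \<one>) \<preceq> (?R ^^ n) \<one>" using assms by (intro join2_pow_mono) auto
  then have "?R ((?R ^^ n) \<one>) \<preceq> (?R ^^ n) \<one>" by (simp add: funpow_swap1)
  then show ?thesis using assms by (simp add: bounded_conjby_iff join2_adjoint)
qed

text \<open>
  Finiteness of the super summit set makes two terms of the sequence \<open>R\<^sup>n 1\<close> give the same conjugate, so
  that \<open>R\<^sup>m h = z h\<close> for some term \<open>h\<close>, some \<open>m \<ge> 1\<close> and some \<open>z\<close> centralizing \<open>u\<close>. The sequence descends, so \<open>z\<close>
  has length at most \<open>0\<close>. By adjunction \<open>z\<^sup>-\<^sup>t h \<preceq> L\<^sup>m\<^sup>t h \<preceq> L\<^sup>m\<^sup>t 1 = 1\<close> for all \<open>t\<close>, which bounds the length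
  of \<open>z\<close> from below by \<open>0\<close>. Hence \<open>z h = h\<close>, and the descending sequence is constant from \<open>h\<close> on.
\<close>

lemma Rop_stabilises:
  assumes "u \<in> C" "Lop u p q \<one> = \<one>"
  shows "\<exists>N. Rop u p q ((Rop u p q ^^ N) \<one>) = (Rop u p q ^^ N) \<one>"
proof -
  let ?R = "Rop u p q" and ?L = "Lop u p q"
  let ?f = "\<lambda>n. conjby u ((?R ^^ n) \<one>)"
  have RC: "(?R ^^ n) \<one> \<in> C" for n using assms by simp
  have "range ?f \<subseteq> {v \<in> C. bounded_by v p q}"
    using assms Rop_pow_bounded by auto
  then have "finite (range ?f)" using finite_bounded_by finite_subset by blast
  then have "\<not> inj ?f" using finite_imageD infinite_UNIV_nat by blast
  then obtain i j where "?f i = ?f j" "i < j"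
    unfolding inj_on_def by (metis linorder_neqE_nat)
  then obtain m where m: "?f (i + Suc m) = ?f i" using less_imp_Suc_add by (metis add_Suc_right)
  \<comment> \<open>The sequence returns to the same conjugate after \<open>m + 1\<close> steps from \<open>h\<close>; \<open>z\<close> measures the return.\<close>
  define h where "h = (?R ^^ i) \<one>"
  define z where "z = (?R ^^ Suc m) h \<otimes> inv h"
  have hC: "h \<in> C" and kC: "(?R ^^ Suc m) h \<in> C" using assms by (simp_all add: h_def)
  then have zC: "z \<in> C" by (simp add: z_def)
  have zh: "(?R ^^ Suc m) h = z \<otimes> h" using hC kC by (simp add: z_def)
  have hn: "(?R ^^ n) h = (?R ^^ (n + i)) \<one>" for n by (simp add: h_def funpow_add)
  have "conjby u ((?R ^^ Suc m) h) = conjby u h"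
    unfolding hn using m by (simp only: h_def add.commute)
  then have "conjby u (z \<otimes> h) = conjby u h" by (simp only: zh)
  then have "conjby (conjby u z) h = conjby u h" using assms zC hC by (simp add: conjby_mult)
  then have "conjby u z = u" using assms zC hC by (metis conjby_cancel conjby_closed)
  then have comm: "z \<otimes> u = u \<otimes> z" using assms zC by (simp add: conjby_fixed_iff)
  have icomm: "inv z \<otimes> u = u \<otimes> inv z" using inv_comm[of u z] comm assms zC by simp
  have desc: "(?R ^^ Suc n) h \<preceq> (?R ^^ n) h" for n
  proof -
    have "?R ((?R ^^ n) h) \<preceq> (?R ^^ n) h"
      unfolding hn using Rop_pow_bounded[OF assms, of "n + i"] assms
      by (simp add: bounded_conjby_iff join2_adjoint)
    then show ?thesis by simp
  qed
  have desc': "(?R ^^ n) h \<preceq> h" for n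
  proof (induction n)
    case (Suc n)
    then show ?case using desc[of n] div_trans[of "(?R ^^ Suc n) h" "(?R ^^ n) h" h] assms hC by simp
  qed (use hC in \<open>simp add: div_refl\<close>)
  have step: "inv z \<otimes> h \<preceq> (?L ^^ Suc m) h"
  proof -
    have "h \<preceq> (?L ^^ Suc m) (act z 0 h)"
      using join2_pow_adjoint[of u "inv u" h "z \<otimes> h" "Suc m" "- p" q] zh assms hC zC
      by (simp add: div_refl act_def del: funpow.simps)
    also have "(?L ^^ Suc m) (act z 0 h) = act z 0 ((?L ^^ Suc m) h)"
      using assms zC hC comm by (intro meet2_pow_act) (auto simp: inv_comm)
    finally show ?thesis
      using assms hC zC le_act_iff[of z "(?L ^^ Suc m) h" h 0] by (simp add: act_def del: funpow.simps)
  qed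
  have bound: "inv z [^] t \<otimes> h \<preceq> (?L ^^ (Suc m * t)) h" for t :: nat
  proof (induction t)
    case (Suc t)
    have cu: "inv z [^] t \<otimes> u = u \<otimes> inv z [^] t"
      using icomm assms zC by (simp add: mult_pow_comm)
    have "inv z [^] Suc t \<otimes> h = act (inv z [^] t) 0 (inv z \<otimes> h)"
      using zC hC by (simp add: act_def m_assoc)
    moreover have "act (inv z [^] t) 0 (inv z \<otimes> h) \<preceq> act (inv z [^] t) 0 ((?L ^^ Suc m) h)"
      using step assms zC hC by (subst act_mono_iff) (auto simp del: funpow.simps)
    moreover have "act (inv z [^] t) 0 ((?L ^^ Suc m) h) = (?L ^^ Suc m) (act (inv z [^] t) 0 h)"
      using assms zC hC cu by (intro meet2_pow_act[symmetric]) (auto simp: inv_comm)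
    moreover have "(?L ^^ Suc m) (act (inv z [^] t) 0 h) \<preceq> (?L ^^ Suc m) ((?L ^^ (Suc m * t)) h)"
      using Suc assms zC hC by (intro meet2_pow_mono) (auto simp: act_def)
    ultimately have "inv z [^] Suc t \<otimes> h \<preceq> (?L ^^ Suc m) ((?L ^^ (Suc m * t)) h)"
      using div_trans assms zC hC
      by (smt (verit) act_closed inv_closed meet2_pow_closed nat_pow_closed m_closed)
    then show ?case by (simp only: funpow_mult_comp)
  qed (use hC in \<open>simp add: div_refl\<close>)
  have h1: "h \<preceq> \<one>" using Rop_pow_le_one[OF assms] by (simp add: h_def)
  have "int t * (- len z) + len h \<le> 0" for t :: nat
  proof -
    have "(?L ^^ (Suc m * t)) h \<preceq> \<one>"
      using meet2_pow_mono[of u "inv u" h \<one> "Suc m * t" "- p" q] h1 assms hC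
        Lop_fixed_pow[OF assms(2), of "Suc m * t"] by simp
    then have "inv z [^] t \<otimes> h \<preceq> \<one>"
      using bound[of t] div_trans assms zC hC by (meson inv_closed m_closed meet2_pow_closed nat_pow_closed one_closed)
    then have "len (inv z [^] t \<otimes> h) \<le> len \<one>" using zC hC by (intro div_len) auto
    then show ?thesis using zC hC by (simp add: len_mult len_nat_pow len_inv)
  qed
  \<comment> \<open>If \<open>len z \<le> -1\<close>, this many steps would exceed the bound, as \<open>len h \<le> 0\<close>.\<close>
  from this[of "nat (1 - len h)"] have "len z \<ge> 0"
  proof -
    assume a: "int (nat (1 - len h)) * (- len z) + len h \<le> 0"
    have "len h \<le> 0" using div_len[OF h1] hC by simp
    then have n: "int (nat (1 - len h)) = 1 - len h" by simp
    show ?thesis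
    proof (rule ccontr)
      assume "\<not> 0 \<le> len z"
      then have "(1 - len h) * 1 \<le> (1 - len h) * (- len z)"
        using \<open>len h \<le> 0\<close> by (intro mult_left_mono) auto
      also have "(1 - len h) * (- len z) \<le> - len h"
        using a unfolding n le_diff_eq[symmetric] by simp
      finally show False by simp
    qed
  qed
  then have "z \<otimes> h = h"
    using desc'[of "Suc m"] zh zC hC div_eqI[of "z \<otimes> h" h] by (simp add: len_mult)
  then have periodic: "(?R ^^ Suc m) h = h" using zh by simp
  have "h \<preceq> ?R h"
  proof -
    have "(?R ^^ Suc m) h \<preceq> ?R h"
      using desc'[of m] join2_mono[of u "inv u" "(?R ^^ m) h" h "- p" q] assms hC by simp
    then show ?thesis by (simp only: periodic)
  qed
  then have "?R h = h" using desc'[of 1] assms hC div_antisym[of "?R h" h] by simp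
  then show ?thesis by (auto simp: h_def)
qed

lemma funpow_fixed_from: "f ((f ^^ N) x) = (f ^^ N) x \<Longrightarrow> N \<le> n \<Longrightarrow> (f ^^ n) x = (f ^^ N) x"
  by (induction n) (auto simp: le_Suc_eq)

definition conj_class :: "'a \<Rightarrow> 'a set" where
  "conj_class y = conjby y ` C"

lemma conj_class_closed: "y \<in> C \<Longrightarrow> u \<in> conj_class y \<Longrightarrow> u \<in> C"
  by (auto simp: conj_class_def)

lemma conj_class_conjby: "y \<in> C \<Longrightarrow> u \<in> conj_class y \<Longrightarrow> g \<in> C \<Longrightarrow> conjby u g \<in> conj_class y"
  by (auto simp: conj_class_def conjby_mult[symmetric])

lemma conj_class_sym:
  assumes "y \<in> C" "u \<in> conj_class y" obtains g where "g \<in> C" "conjby u g = y"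
proof -
  obtain g where "g \<in> C" "u = conjby y g" using assms by (auto simp: conj_class_def)
  then show ?thesis using assms that[of "inv g"] by (simp add: conjby_cancel)
qed

text \<open>
  The conjugating element \<open>d u\<close> is \<open>R\<^sup>N 1\<close> for the base point \<open>u\<close>. Finiteness of the set of left rigid
  conjugates allows one \<open>N\<close> for all of them. The inverse map uses \<open>L\<^sup>N\<close>, and the equivalence on labels is
  monotonicity of \<open>R\<^sup>N\<close> and \<open>L\<^sup>N\<close> applied to \<open>1 \<preceq> s \<preceq> D\<close>, read off at the new base point.
\<close>

theorem rigid_correspondence:
  assumes y: "y \<in> C" "rigid y p q"
  defines "VL \<equiv> {u \<in> conj_class y. rigid u p q}" and "VR \<equiv> {u \<in> conj_class y. rrigid u p q}"
  shows "\<exists>d. (\<forall>u\<in>VL. d u \<in> C) \<and> bij_betw (\<lambda>u. conjby u (d u)) VL VR \<and>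
    (\<forall>u\<in>VL. \<forall>v\<in>VL. \<forall>s\<in>C. conjby u s = v \<longrightarrow>
      (s \<in> P \<and> s \<preceq> D \<longleftrightarrow> inv (d u) \<otimes> s \<otimes> d v \<in> P \<and> inv (d u) \<otimes> s \<otimes> d v \<preceq> D))"
proof -
  let ?R = "\<lambda>u. Rop u p q" and ?L = "\<lambda>u. Lop u p q"
  have VC: "u \<in> C" "?L u \<one> = \<one>" if "u \<in> VL" for u
    using that y conj_class_closed by (auto simp: VL_def rigid_def)
  have "finite VL"
    by (rule finite_subset[OF _ finite_bounded_by[of p q]])
      (use conj_class_closed[OF y(1)] in \<open>auto simp: VL_def intro: rigid_bounded\<close>)
  moreover have "\<forall>u\<in>VL. eventually (\<lambda>N. ?R u ((?R u ^^ N) \<one>) = (?R u ^^ N) \<one>) sequentially"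
  proof
    fix u assume "u \<in> VL"
    then obtain N where N: "?R u ((?R u ^^ N) \<one>) = (?R u ^^ N) \<one>"
      using Rop_stabilises[OF VC[OF \<open>u \<in> VL\<close>]] by blast
    show "eventually (\<lambda>N. ?R u ((?R u ^^ N) \<one>) = (?R u ^^ N) \<one>) sequentially"
      unfolding eventually_sequentially
    proof (intro exI allI impI)
      fix n assume "N \<le> n"
      with N have "(?R u ^^ n) \<one> = (?R u ^^ N) \<one>" by (rule funpow_fixed_from)
      then show "?R u ((?R u ^^ n) \<one>) = (?R u ^^ n) \<one>" by (simp only: N)
    qed
  qed
  ultimately have "eventually (\<lambda>N. \<forall>u\<in>VL. ?R u ((?R u ^^ N) \<one>) = (?R u ^^ N) \<one>) sequentially"
    by (rule eventually_ball_finite)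
  then obtain N where N: "\<And>u. u \<in> VL \<Longrightarrow> ?R u ((?R u ^^ N) \<one>) = (?R u ^^ N) \<one>"
    unfolding eventually_sequentially by blast
  define d where "d u = (?R u ^^ N) \<one>" for u
  let ?F = "\<lambda>u. conjby u (d u)"
  have dC: "d u \<in> C" if "u \<in> VL" for u using VC[OF that] by (simp add: d_def)
  have Ld: "(?L u ^^ N) (d u) = \<one>" if "u \<in> VL" for u
  proof (rule div_antisym)
    note u = VC[OF that] dC[OF that]
    show "(?L u ^^ N) (d u) \<preceq> \<one>"
      using meet2_pow_mono[of u "inv u" "d u" \<one> N "- p" q] u Rop_pow_le_one[OF u(1,2), of N]
        Lop_fixed_pow[OF u(2), of N] by (simp add: d_def)
    show "\<one> \<preceq> (?L u ^^ N) (d u)"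
      using join2_pow_adjoint[of u "inv u" \<one> "d u" N "- p" q] u div_refl[OF u(3)]
      by (simp add: d_def)
  qed (use VC[OF that] dC[OF that] in auto)
  \<comment> \<open>Seen from the new base point, the inverse map undoes the conjugation by \<open>d u\<close>.\<close>
  have LF: "(?L (?F u) ^^ N) \<one> = inv (d u)" if "u \<in> VL" for u
  proof -
    note u = VC[OF that] dC[OF that]
    have "(?L u ^^ N) (d u \<otimes> \<one>) = d u \<otimes> (?L (?F u) ^^ N) \<one>"
      using u by (subst meet2_pow_transport) (auto simp: conjby_inv)
    then have "d u \<otimes> (?L (?F u) ^^ N) \<one> = \<one>" using Ld[OF that] u by simp
    then show ?thesis using u by (metis cancel_inv(1) inv_closed meet2_pow_closed conjby_closed one_closed r_one)
  qed
  have Finj: "inj_on ?F VL"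
  proof (rule inj_onI)
    fix u v assume uv: "u \<in> VL" "v \<in> VL" and eq: "?F u = ?F v"
    have "inv (d u) = inv (d v)" using LF uv eq by metis
    then have "d u = d v" using dC uv by (metis inv_inv)
    then show "u = v" using eq conjby_cancel VC(1) dC uv by metis
  qed
  have FVR: "?F u \<in> VR" if "u \<in> VL" for u
    using that VC[OF that] dC[OF that] N[OF that] y conj_class_conjby
    by (simp add: VR_def VL_def rrigid_conjby_iff d_def)
  have surj: "\<exists>u\<in>VL. ?F u = v" if v: "v \<in> VR" for v
  proof -
    have vC: "v \<in> C" and vcl: "v \<in> conj_class y" and Rv: "?R v \<one> = \<one>"
      using v y conj_class_closed by (auto simp: VR_def rrigid_def)
    obtain w where w: "w \<in> C" "conjby v w = y" using conj_class_sym[OF y(1) vcl] .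
    have Lw: "?L v w = w" using rigid_conjby_iff[OF vC w(1), of p q] w y by simp
    have up: "\<one> \<preceq> ?L v \<one>"
      using bounded_by_Lop[OF vC] rrigid_bounded[of v p q] v by (auto simp: VR_def)
    obtain M where M: "?L v ((?L v ^^ M) \<one>) = (?L v ^^ M) \<one>"
      using Lop_stabilises[OF vC w(1) one_closed Lw up] by blast
    \<comment> \<open>Large enough for the iterates of \<open>L\<close> at \<open>v\<close> and those of \<open>R\<close> at every left rigid conjugate.\<close>
  define K where "K = max M N"
    define e where "e = (?L v ^^ K) \<one>"
    have eM: "e = (?L v ^^ M) \<one>" using funpow_fixed_from[OF M, of K] by (simp add: K_def e_def)
    have eC: "e \<in> C" using vC by (simp add: e_def)
    have Le: "?L v e = e" using M by (simp add: eM)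
    let ?u = "conjby v e"
    have u: "?u \<in> VL" using rigid_conjby_iff[OF vC eC] Le vcl eC y conj_class_conjby by (simp add: VL_def)
    have RK: "(?R v ^^ K) \<one> = \<one>" using Rv by (induction K) auto
    have up': "\<one> \<preceq> e"
    proof -
      have "(?R v ^^ K) \<one> \<preceq> \<one>" by (simp add: RK)
      then show ?thesis using join2_pow_adjoint[of v "inv v" \<one> \<one> K "- p" q] vC by (simp add: e_def)
    qed
    have "(?R v ^^ K) e = \<one>"
    proof (rule div_antisym)
      show "(?R v ^^ K) e \<preceq> \<one>"
        using join2_pow_adjoint[of v "inv v" e \<one> K "- p" q] vC eC by (simp add: e_def[symmetric])
      show "\<one> \<preceq> (?R v ^^ K) e"
        using join2_pow_mono[of v "inv v" \<one> e K "- p" q] vC eC up' by (simp add: RK)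
    qed (use vC eC in auto)
    moreover have "(?R v ^^ K) (e \<otimes> \<one>) = e \<otimes> (?R ?u ^^ K) \<one>"
      using vC eC by (subst join2_pow_transport) (auto simp: conjby_inv)
    moreover have "(?R ?u ^^ K) \<one> = d ?u"
      using funpow_fixed_from[OF N[OF u], of K] by (simp add: K_def d_def)
    ultimately have "e \<otimes> d ?u = \<one>" using eC by simp
    then have "conjby ?u (d ?u) = v" using vC eC dC[OF u] by (simp flip: conjby_mult)
    then show ?thesis using u by blast
  qed
  have arrows: "s \<in> P \<and> s \<preceq> D \<longleftrightarrow> inv (d u) \<otimes> s \<otimes> d v \<in> P \<and> inv (d u) \<otimes> s \<otimes> d v \<preceq> D"
    if uv: "u \<in> VL" "v \<in> VL" and s: "s \<in> C" "conjby u s = v" for u v s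
  proof -
    note u = VC[OF uv(1)] dC[OF uv(1)] and v = VC[OF uv(2)] dC[OF uv(2)]
    let ?t = "inv (d u) \<otimes> s \<otimes> d v"
    have iv: "conjby (inv u) s = inv v" using conjby_inv[of u s] u s by simp
    have Rs: "(?R u ^^ N) s = s \<otimes> d v"
      using join2_pow_transport[of u "inv u" s \<one> N "- p" q] u s by (simp add: d_def iv)
    have RD: "(?R u ^^ N) D = d u \<otimes> D"
      using join2_pow_act[of \<one> u "inv u" \<one> N "- p" q 1] u by (simp add: d_def act_def)
    have FuC: "?F u \<in> C" and FvC: "?F v \<in> C" and tC: "?t \<in> C" using u v s by auto
    have Ft: "conjby (?F u) ?t = ?F v"
    proof -
      have "conjby (?F u) ?t = conjby u (d u \<otimes> ?t)" using u v s by (simp add: conjby_mult)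
      also have "d u \<otimes> ?t = s \<otimes> d v" using u v s by (simp add: m_assoc)
      finally show ?thesis using u v s by (simp add: conjby_mult)
    qed
    have iFv: "conjby (inv (?F u)) ?t = inv (?F v)" using conjby_inv[OF FuC tC] Ft by simp
    have Lt: "(?L (?F u) ^^ N) ?t = inv (d u) \<otimes> s"
      using meet2_pow_transport[of "?F u" "inv (?F u)" ?t \<one> N "- p" q] FuC tC u v s
      by (simp add: Ft iFv LF[OF uv(2)])
    have LD: "(?L (?F u) ^^ N) D = inv (d u) \<otimes> D"
      using meet2_pow_act[of \<one> "?F u" "inv (?F u)" \<one> N "- p" q 1] FuC LF[OF uv(1)] u
      by (simp add: act_def)
    have 1: "?t \<in> P" if "s \<in> P"
    proof -
      have "\<one> \<preceq> s" using that by simp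
      then have "(?R u ^^ N) \<one> \<preceq> (?R u ^^ N) s" using u s by (intro join2_pow_mono) auto
      then show ?thesis using u v s by (simp add: Rs d_def[symmetric] m_assoc)
    qed
    have 2: "?t \<preceq> D" if "s \<preceq> D"
    proof -
      have "(?R u ^^ N) s \<preceq> (?R u ^^ N) D" using that u s by (intro join2_pow_mono) auto
      then show ?thesis using u v s by (simp add: Rs RD inv_mult_group m_assoc)
    qed
    have 3: "s \<in> P" if "?t \<in> P"
    proof -
      have "\<one> \<preceq> ?t" using that tC by simp
      then have "(?L (?F u) ^^ N) \<one> \<preceq> (?L (?F u) ^^ N) ?t" using FuC tC by (intro meet2_pow_mono) auto
      then show ?thesis using u v s by (simp add: Lt LF[OF uv(1)])
    qed
    have 4: "s \<preceq> D" if "?t \<preceq> D"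
    proof -
      have "(?L (?F u) ^^ N) ?t \<preceq> (?L (?F u) ^^ N) D" using that FuC tC by (intro meet2_pow_mono) auto
      then show ?thesis using u v s by (simp only: Lt LD) (simp add: mult_le_iff)
    qed
    show ?thesis using 1 2 3 4 by blast
  qed
  have "bij_betw ?F VL VR"
    unfolding bij_betw_def using Finj FVR surj by blast
  then show ?thesis using dC arrows by (intro exI[of _ d] conjI ballI impI) simp_all
qed

end

section \<open>The opposite group\<close>

definition opposite :: "('a, 'b) monoid_scheme \<Rightarrow> 'a monoid" where
  "opposite G = \<lparr>carrier = carrier G, monoid.mult = (\<lambda>x y. y \<otimes>\<^bsub>G\<^esub> x), one = \<one>\<^bsub>G\<^esub>\<rparr>"

lemma opposite_simps [simp]:
  "carrier (opposite G) = carrier G" "x \<otimes>\<^bsub>opposite G\<^esub> y = y \<otimes>\<^bsub>G\<^esub> x" "\<one>\<^bsub>opposite G\<^esub> = \<one>\<^bsub>G\<^esub>"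
  by (simp_all add: opposite_def)

lemma inv_opposite [simp]: "inv\<^bsub>opposite G\<^esub> x = inv\<^bsub>G\<^esub> x"
  by (auto simp: m_inv_def intro!: arg_cong[where f = The])

context group
begin

lemma group_opposite: "group (opposite G)"
  by (rule groupI) (auto simp: m_assoc intro: bexI[of _ "inv x" for x])

lemma nat_pow_opposite [simp]:
  assumes "x \<in> carrier G" shows "x [^]\<^bsub>opposite G\<^esub> (k::nat) = x [^] k"
proof -
  interpret op: group "opposite G" by (rule group_opposite)
  show ?thesis
  proof (induction k)
    case (Suc k)
    have "x [^]\<^bsub>opposite G\<^esub> Suc k = x \<otimes> x [^]\<^bsub>opposite G\<^esub> k" by simp
    then show ?case using Suc assms nat_pow_Suc2[OF assms, of k] by simp
  qed simp
qed

lemma int_pow_opposite [simp]: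
  assumes "x \<in> carrier G" shows "x [^]\<^bsub>opposite G\<^esub> (k::int) = x [^] k"
proof -
  interpret op: group "opposite G" by (rule group_opposite)
  obtain n where "k = int n \<or> k = - int n" using int_cases2 by metis
  then show ?thesis using assms
    by (auto simp: int_pow_int op.int_pow_neg[unfolded opposite_simps] int_pow_neg)
qed

end

context garside_group
begin

text \<open>
  The only axiom that is not its own mirror image, up to conjugation by \<open>D\<close>, is the existence of least upper
  bounds: inversion turns greatest lower bounds for left divisibility into least upper bounds for right divisibility.
\<close>

theorem garside_group_opposite: "garside_group (opposite G) P D len"
proof -
  interpret op: group "opposite G" by (rule group_opposite)
  show ?thesis
  proof (unfold_locales, unfold opposite_simps inv_opposite)
    fix a b g :: 'a and k :: int
    show "P \<subseteq> C" by (rule P_carrier)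
    show "\<one> \<in> P" by (rule P_one)
    show "b \<otimes> a \<in> P" if "a \<in> P" "b \<in> P" using that by (simp add: P_mult)
    show "D \<in> P" by (rule D_P)
    show "D \<noteq> \<one>" by (rule D_not_one)
    show "inv D \<otimes> (a \<otimes> D) \<in> P" if "a \<in> P" using conj_inv_D[OF that] that by (simp add: m_assoc)
    show "D \<otimes> (a \<otimes> inv D) \<in> P" if "a \<in> P" using conj_D[OF that] that by (simp add: m_assoc)
    show "g \<otimes> (D \<otimes> D) = D \<otimes> D \<otimes> g" if "g \<in> C" using D2_central[OF that] by simp
    show "len (b \<otimes> a) = len a + len b" if "a \<in> C" "b \<in> C" using that by (simp add: len_mult)
    show "0 \<le> len a" if "a \<in> P" by (rule len_nonneg[OF that])
    show "a = \<one>" if "a \<in> P" "len a = 0" by (rule len_zero[OF that])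
    show "finite {a \<in> P. len a \<le> k}" by (rule finite_len)
    show "\<exists>s\<in>P. s \<noteq> \<one> \<and> a \<otimes> inv s \<in> P \<and> D \<otimes> inv s \<in> P" if "a \<in> P" "a \<noteq> \<one>"
      by (rule right_atom[OF that])
    show "\<exists>s\<in>P. s \<noteq> \<one> \<and> inv s \<otimes> a \<in> P \<and> inv s \<otimes> D \<in> P" if "a \<in> P" "a \<noteq> \<one>"
      by (rule left_atom[OF that])
    show "\<exists>k::nat. g \<otimes> D [^]\<^bsub>opposite G\<^esub> k \<in> P" if g: "g \<in> C"
    proof -
      obtain k :: nat where "D [^] k \<otimes> g \<in> P" using fraction[OF g] by blast
      then have "g \<otimes> D [^] k \<in> P" using swap_D_pow[OF g, of "int k"] by (simp add: int_pow_int)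
      then show ?thesis by auto
    qed
    show "\<exists>m\<in>C. m \<otimes> inv a \<in> P \<and> m \<otimes> inv b \<in> P \<and>
        (\<forall>c\<in>C. c \<otimes> inv a \<in> P \<longrightarrow> c \<otimes> inv b \<in> P \<longrightarrow> c \<otimes> inv m \<in> P)"
      if ab: "a \<in> C" "b \<in> C"
    proof (intro bexI[of _ "inv (mt (inv a) (inv b))"] conjI ballI impI)
      show "inv (mt (inv a) (inv b)) \<otimes> inv a \<in> P" "inv (mt (inv a) (inv b)) \<otimes> inv b \<in> P"
        using ab by (simp_all add: mt_le)
      fix c assume c: "c \<in> C" "c \<otimes> inv a \<in> P" "c \<otimes> inv b \<in> P"
      then have "inv c \<preceq> mt (inv a) (inv b)"
        using ab le_mt_iff[of "inv a" "inv b" "inv c"] by simp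
      then show "c \<otimes> inv (inv (mt (inv a) (inv b))) \<in> P" using ab c by simp
    qed (use ab in simp)
  qed
qed

lemma opposite_meet_eq_one:
  assumes "a \<in> C" "b \<in> C"
  shows "garside_group.mt (opposite G) P a b = \<one> \<longleftrightarrow> jn (inv a) (inv b) = \<one>"
proof -
  interpret op: garside_group "opposite G" P D len by (rule garside_group_opposite)
  have le: "inv\<^bsub>opposite G\<^esub> h \<otimes>\<^bsub>opposite G\<^esub> x \<in> P \<longleftrightarrow> inv x \<preceq> inv h" if "h \<in> C" "x \<in> C" for h x
    using that by simp
  have m: "op.mt a b \<in> C" using op.mt_closed[of a b] assms by simp
  have "inv (op.mt a b) = jn (inv a) (inv b)"
  proof (rule ge_eqI)
    fix h assume h: "h \<in> C"
    have "inv (op.mt a b) \<preceq> h \<longleftrightarrow> inv a \<preceq> h \<and> inv b \<preceq> h"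
      using op.le_mt_iff[of a b "inv h"] assms h m by simp
    then show "inv (op.mt a b) \<preceq> h \<longleftrightarrow> jn (inv a) (inv b) \<preceq> h"
      using assms h by (simp add: jn_le_iff)
  qed (use m assms in auto)
  then show ?thesis using m by (metis inv_one inv_inv)
qed

text \<open>
  Inversion is an anti-isomorphism from the opposite lattice, so it turns the meet in the definition
  of left rigidity into a join.
\<close>

lemma opposite_rigid_iff:
  "garside_group.rigid (opposite G) P D u p q \<longleftrightarrow> rrigid u p q"
proof -
  interpret op: garside_group "opposite G" P D len by (rule garside_group_opposite)
  show ?thesis
  proof (cases "u \<in> C")
    case True
    have "op.Lop u p q \<one> = \<one> \<longleftrightarrow> jn (inv (D [^] (- p) \<otimes> u)) (inv (D [^] q \<otimes> inv u)) = \<one>"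
      using True opposite_meet_eq_one[of "D [^] (- p) \<otimes> u" "D [^] q \<otimes> inv u"]
      by (simp add: op.meet2_def op.act_def)
    also have "\<dots> \<longleftrightarrow> Rop u p q \<one> = \<one>"
      using True by (simp add: join2_def act_def inv_mult_group int_pow_neg)
    finally show ?thesis using True by (simp add: op.rigid_def rrigid_def)
  qed (simp add: op.rigid_def rrigid_def)
qed

lemma opposite_bounded_iff:
  assumes "u \<in> C" shows "garside_group.bounded_by (opposite G) P D u p q \<longleftrightarrow> bounded_by u p q"
proof -
  interpret op: garside_group "opposite G" P D len by (rule garside_group_opposite)
  show ?thesis
    using assms swap_D_pow[of u "- p"] swap_D_pow[of "inv u" q]
    by (simp add: op.bounded_by_def bounded_by_def)
qed

lemma opposite_conjby:
  assumes "u \<in> C" "g \<in> C" shows "garside_group.conjby (opposite G) u g = conjby u (inv g)"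
proof -
  interpret op: garside_group "opposite G" P D len by (rule garside_group_opposite)
  show ?thesis using assms by (simp add: op.conjby_def conjby_def m_assoc)
qed

lemma opposite_extremal:
  assumes "u \<in> C" "extremal u p q" shows "garside_group.extremal (opposite G) P D u p q"
proof -
  interpret op: garside_group "opposite G" P D len by (rule garside_group_opposite)
  show ?thesis
    unfolding op.extremal_def
  proof (intro ballI allI)
    fix g j assume "g \<in> carrier (opposite G)"
    then have g: "g \<in> C" by simp
    let ?v = "conjby u (inv g)"
    have ext: "(?v \<otimes> D [^] (- j) \<in> P \<longrightarrow> j \<le> p) \<and> (inv ?v \<otimes> D [^] j \<in> P \<longrightarrow> q \<le> j)"
      using assms(2)[unfolded extremal_def, THEN bspec, of "inv g"] g by simp
    have "?v \<in> C" using assms g by simp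
    then show "(op.conjby u g \<otimes>\<^bsub>opposite G\<^esub> D [^]\<^bsub>opposite G\<^esub> (- j) \<in> P \<longrightarrow> j \<le> p) \<and>
      (inv\<^bsub>opposite G\<^esub> (op.conjby u g) \<otimes>\<^bsub>opposite G\<^esub> D [^]\<^bsub>opposite G\<^esub> j \<in> P \<longrightarrow> q \<le> j)"
      using ext assms(1) g swap_D_pow[of ?v "- j"] swap_D_pow[of "inv ?v" j]
      by (simp add: opposite_conjby)
  qed
qed

text \<open>Left weightedness is a local condition: only the part \<open>b \<and> D\<close> of \<open>b\<close> that can be absorbed into one factor matters.\<close>

lemma mt_mult_D:
  assumes "a \<in> P" "b \<in> C" shows "mt (a \<otimes> b) D = mt (a \<otimes> mt b D) D"
proof (rule le_eqI)
  fix h assume h: "h \<in> C"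
  have "D \<preceq> a \<otimes> D" using conj_inv_D[OF assms(1)] assms by (simp add: m_assoc)
  then have "h \<preceq> D \<Longrightarrow> h \<preceq> a \<otimes> D" using h assms div_trans[of h D "a \<otimes> D"] by simp
  moreover have "a \<otimes> mt b D = mt (a \<otimes> b) (a \<otimes> D)" using assms by (simp add: mult_mt)
  ultimately show "h \<preceq> mt (a \<otimes> b) D \<longleftrightarrow> h \<preceq> mt (a \<otimes> mt b D) D"
    using h assms by (auto simp: le_mt_iff)
qed (use assms in auto)

lemma greedy_head: "greedy zs \<Longrightarrow> zs \<noteq> [] \<Longrightarrow> mt (prodl zs) D = hd zs"
  by (cases zs) (auto simp: greedy_Cons)

lemma prodl_P: "set xs \<subseteq> P \<Longrightarrow> prodl xs \<in> P"
  by (induction xs) (auto simp: P_mult)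

lemma greedy_extend_head:
  assumes "greedy (xs @ [mt c D])" "set xs \<subseteq> P" "c \<in> P"
  shows "mt (prodl xs \<otimes> c) D = hd (xs @ [mt c D])"
  using assms(1,2)
proof (induction xs)
  case Nil
  then show ?case using assms by simp
next
  case (Cons x xs)
  let ?zs = "xs @ [mt c D]"
  have x: "x \<in> P" and xs: "set xs \<subseteq> P" and gr: "greedy ?zs"
    using Cons.prems by (auto simp: greedy_Cons)
  have cl: "prodl xs \<in> C" "prodl ?zs \<in> C" using prodl_P[OF xs] greedy_closed[OF gr] by auto
  have "mt (x \<otimes> (prodl xs \<otimes> c)) D = mt (x \<otimes> mt (prodl xs \<otimes> c) D) D"
    using x cl assms by (intro mt_mult_D) auto
  also have "\<dots> = mt (x \<otimes> mt (prodl ?zs) D) D"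
    using Cons.IH gr xs greedy_head[OF gr] by simp
  also have "\<dots> = mt (x \<otimes> prodl ?zs) D" using x cl by (intro mt_mult_D[symmetric]) auto
  also have "\<dots> = x" using Cons.prems by (simp add: greedy_Cons)
  finally show ?case using x cl assms by (simp add: m_assoc)
qed

text \<open>
  Induction on \<open>xs\<close>: left weightedness fixes the first factor (\<open>greedy_extend_head\<close>), and since a divisor of \<open>D\<^sup>k\<^sup>+\<^sup>1\<close> can exceed
  the first factor \<open>x\<close> only within \<open>x D\<^sup>k\<close>, the comparison passes to the tail.
\<close>

lemma greedy_extend:
  assumes "greedy (xs @ [mt c D])" "set xs \<subseteq> P" "c \<in> P"
  shows "mt (prodl xs \<otimes> c) (D [^] (int (length xs))) = prodl xs"
  using assms(1,2)
proof (induction xs)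
  case Nil
  have "mt c \<one> = \<one>" using assms(3) mt_absorb[of \<one> c] mt_commute[of c \<one>] by simp
  then show ?case using assms by simp
next
  case (Cons x xs)
  let ?W = "prodl xs \<otimes> c" and ?E = "D [^] (int (length xs))"
  have x: "x \<in> P" and xs: "set xs \<subseteq> P" and gr: "greedy (xs @ [mt c D])"
    using Cons.prems by (auto simp: greedy_Cons)
  have W: "?W \<in> P" using prodl_P[OF xs] assms by (simp add: P_mult)
  have cl: "prodl xs \<in> C" using prodl_P[OF xs] by simp
  have E: "D [^] (int (length (x # xs))) = D \<otimes> ?E"
    using D_pow_add[of 1 "int (length xs)"] by (simp add: add.commute)
  have hd: "mt (x \<otimes> ?W) D = x"
    using greedy_extend_head[OF Cons.prems assms(3)] x cl assms by (simp add: m_assoc)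
  have "mt (x \<otimes> ?W) (D \<otimes> ?E) = mt (x \<otimes> ?W) (x \<otimes> ?E)"
  proof (rule le_eqI)
    fix h assume h: "h \<in> C"
    have mE: "x \<otimes> ?E = mt (x \<otimes> ?W \<otimes> ?E) (D \<otimes> ?E)"
      using act_mt[of \<one> "x \<otimes> ?W" D "int (length xs)"] hd x W by (simp add: act_def)
    have "x \<otimes> ?W \<preceq> x \<otimes> ?W \<otimes> ?E"
      using x W D_nat_pow_P[of "length xs"] by (simp add: int_pow_int del: cancel_inv)
        (simp add: m_assoc[symmetric] inv_mult_group)
    then have "h \<preceq> x \<otimes> ?W \<Longrightarrow> h \<preceq> x \<otimes> ?W \<otimes> ?E"
      using h x W div_trans[of h "x \<otimes> ?W" "x \<otimes> ?W \<otimes> ?E"] by simp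
    then show "h \<preceq> mt (x \<otimes> ?W) (D \<otimes> ?E) \<longleftrightarrow> h \<preceq> mt (x \<otimes> ?W) (x \<otimes> ?E)"
      using h x W by (auto simp: le_mt_iff mE)
  qed (use x W in auto)
  also have "\<dots> = x \<otimes> mt ?W ?E" using x W by (simp add: mult_mt)
  also have "\<dots> = x \<otimes> prodl xs" using Cons.IH gr xs by simp
  finally show ?case using E x cl assms by (simp add: m_assoc)
qed

text \<open>
  Apply the preceding lemma to \<open>w = D\<^sup>-\<^sup>p y\<close> and \<open>c = y D\<^sup>-\<^sup>p\<close>, whose greedy first factor is the initial factor
  of \<open>y\<close>: it gives \<open>w c \<and> D\<^sup>r = w\<close>, and left multiplication by \<open>w\<^sup>-\<^sup>1\<close> yields \<open>y D\<^sup>-\<^sup>p \<and> y\<^sup>-\<^sup>1 D\<^sup>q = 1\<close>.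
\<close>

theorem left_rigid_imp_rigid:
  assumes nf: "normal_form y p xs" and gr: "greedy (xs @ [head_factor y p])"
  shows "rigid y p (p + int (length xs))"
proof -
  have y: "y \<in> C" and w: "prodl xs = D [^] (- p) \<otimes> y" "prodl xs \<in> P" and grx: "greedy xs"
    using nf by (auto simp: normal_form_alt is_inf_def)
  let ?c = "y \<otimes> D [^] (- p)"
  have c: "?c \<in> P" using w swap_D_pow[OF y, of "- p"] by simp
  have xsP: "set xs \<subseteq> P" using grx w(2)
  proof (induction xs)
    case (Cons x xs)
    have "x = mt (prodl (x # xs)) D" using Cons.prems by (auto simp: greedy_Cons)
    then have "x \<in> P" using mt_P[OF Cons.prems(2) D_P] by simp
    then show ?case using Cons greedy_tail_P[OF Cons.prems(1)] by (auto simp: greedy_Cons)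
  qed simp
  let ?w = "prodl xs"
  have "mt (?w \<otimes> ?c) (D [^] (int (length xs))) = ?w"
    using greedy_extend[of xs ?c] gr xsP c by (simp add: head_factor_def)
  then have "inv ?w \<otimes> mt (?w \<otimes> ?c) (D [^] (int (length xs))) = \<one>" using w(2) by simp
  then have "mt ?c (inv ?w \<otimes> D [^] (int (length xs))) = \<one>"
    using w(2) c by (simp add: mult_mt)
  moreover have "inv ?w \<otimes> D [^] (int (length xs)) = inv y \<otimes> D [^] (p + int (length xs))"
    using y unfolding w(1) by (simp add: inv_mult_group m_assoc int_pow_neg D_pow_add)
  ultimately show ?thesis using y by (simp add: rigid_def meet2_def act_def)
qed

end

section \<open>The positive braid monoid\<close>

text \<open>
  The word that completes \<open>i\<close> to the least common right multiple of the generators \<open>i\<close> and \<open>j\<close>. The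
  braid relations are exactly the equations between \<open>i\<close> followed by \<open>compl i j\<close> and \<open>j\<close> followed by \<open>compl j i\<close>,
  so both kinds of relations are treated uniformly. The generators are indexed by all natural numbers;
  the monoid of a fixed number of strands is cut out afterwards by the supports of its elements.
\<close>

definition compl :: "nat \<Rightarrow> nat \<Rightarrow> nat list" where
  "compl i j = (if i = j then [] else if j = Suc i \<or> i = Suc j then [j, i] else [j])"

inductive pos_step :: "nat list \<Rightarrow> nat list \<Rightarrow> bool" where
  "i \<noteq> j \<Longrightarrow> pos_step (u @ (i # compl i j) @ v) (u @ (j # compl j i) @ v)"

abbreviation pos_eq :: "nat list \<Rightarrow> nat list \<Rightarrow> bool" where
  "pos_eq \<equiv> pos_step\<^sup>*\<^sup>*"

lemma pos_step_sym: "pos_step u v \<Longrightarrow> pos_step v u"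
  by (auto elim!: pos_step.cases intro!: pos_step.intros)

lemma pos_eq_sym: "pos_eq u v \<Longrightarrow> pos_eq v u"
  by (induction rule: rtranclp_induct) (auto intro: pos_step_sym converse_rtranclp_into_rtranclp)

lemma pos_step_context: "pos_step u v \<Longrightarrow> pos_step (x @ u @ y) (x @ v @ y)"
proof (induction rule: pos_step.induct)
  case (1 i j u v)
  then show ?case using pos_step.intros[of i j "x @ u" "v @ y"] by simp
qed

lemma pos_eq_context: "pos_eq u v \<Longrightarrow> pos_eq (x @ u @ y) (x @ v @ y)"
  by (induction rule: rtranclp_induct) (auto intro: pos_step_context rtranclp.rtrancl_into_rtrancl)

lemma pos_eq_append:
  assumes "pos_eq u u'" "pos_eq v v'" shows "pos_eq (u @ v) (u' @ v')"
proof -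
  have "pos_eq (u @ v) (u' @ v)"
    using pos_eq_context[OF assms(1), of "[]" v] by simp
  also have "pos_eq (u' @ v) (u' @ v')"
    using pos_eq_context[OF assms(2), of u' "[]"] by simp
  finally show ?thesis .
qed

lemma length_compl: "length (compl i j) = length (compl j i)"
  by (auto simp: compl_def)

lemma pos_eq_length: "pos_eq u v \<Longrightarrow> length u = length v"
  by (induction rule: rtranclp_induct) (auto elim!: pos_step.cases simp: length_compl)

lemma set_Cons_compl: "insert i (set (compl i j)) = {i, j}"
  by (auto simp: compl_def)

lemma pos_step_set: "pos_step u v \<Longrightarrow> set u = set v"
proof (induction rule: pos_step.induct)
  case (1 i j u v)
  have "set (u @ (i # compl i j) @ v) = set u \<union> insert i (set (compl i j)) \<union> set v"
    "set (u @ (j # compl j i) @ v) = set u \<union> insert j (set (compl j i)) \<union> set v" by auto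
  then show ?case unfolding set_Cons_compl by auto
qed

lemma pos_eq_set: "pos_eq u v \<Longrightarrow> set u = set v"
  by (induction rule: rtranclp_induct) (auto dest: pos_step_set)

quotient_type pos_braid = "nat list" / pos_eq
  by (rule equivpI) (auto intro!: reflpI sympI transpI intro: pos_eq_sym)

instantiation pos_braid :: monoid_mult
begin

lift_definition one_pos_braid :: pos_braid is "[]" .

lift_definition times_pos_braid :: "pos_braid \<Rightarrow> pos_braid \<Rightarrow> pos_braid" is "(@)"
  by (rule pos_eq_append)

instance
  by standard (transfer, simp)+

end

instance pos_braid :: Rings.dvd ..

lift_definition pos_gen :: "nat \<Rightarrow> pos_braid" is "\<lambda>i. [i]" .

lift_definition word_class :: "nat list \<Rightarrow> pos_braid" is "\<lambda>w. w" .

text \<open>Length and support are well defined on classes since the relations preserve the length of a word and the set of its letters.\<close>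

lift_definition word_length :: "pos_braid \<Rightarrow> nat" is length
  by (rule pos_eq_length)

lift_definition support :: "pos_braid \<Rightarrow> nat set" is set
  by (rule pos_eq_set)

lemma word_class_simps [simp]:
  "word_class [] = 1"
  "word_class (i # w) = pos_gen i * word_class w"
  "word_class (v @ w) = word_class v * word_class w"
  by (transfer, simp)+

lemma word_class_surj: obtains w where "a = word_class w"
  by transfer auto

lemma word_class_eq_iff: "word_class v = word_class w \<longleftrightarrow> pos_eq v w"
  by transfer simp

lemma word_length_simps [simp]:
  "word_length 1 = 0" "word_length (a * b) = word_length a + word_length b"
  "word_length (pos_gen i) = 1" "word_length (word_class w) = length w"
  by (transfer, simp)+

lemma word_length_0: "word_length a = 0 \<longleftrightarrow> a = 1"
  by (metis length_0_conv word_class_simps(1) word_class_surj word_length_simps(1,4))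

lemma support_simps [simp]:
  "support 1 = {}" "support (a * b) = support a \<union> support b"
  "support (pos_gen i) = {i}" "support (word_class w) = set w"
  by (transfer, simp)+

lemma support_power: "support (a ^ k) \<subseteq> support a"
  by (induction k) auto

lemma pos_braid_cases:
  obtains "a = 1" | i b where "a = pos_gen i * b"
proof -
  obtain w where "a = word_class w" by (rule word_class_surj)
  then show ?thesis using that by (cases w) auto
qed

definition compl_braid :: "nat \<Rightarrow> nat \<Rightarrow> pos_braid" where
  "compl_braid i j = word_class (compl i j)"

lemma gen_compl: "pos_gen i * compl_braid i j = pos_gen j * compl_braid j i"
proof (cases "i = j")
  case False
  then have "pos_eq (i # compl i j) (j # compl j i)"
    using pos_step.intros[of i j "[]" "[]"] by auto
  then have "word_class (i # compl i j) = word_class (j # compl j i)"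
    by (simp only: word_class_eq_iff)
  then show ?thesis
    by (simp add: compl_braid_def)
qed simp

abbreviation adj :: "nat \<Rightarrow> nat \<Rightarrow> bool" where
  "adj i j \<equiv> j = Suc i \<or> i = Suc j"

lemma compl_braid_eq [simp]: "compl_braid i i = 1"
  by (simp add: compl_braid_def compl_def)

lemma compl_braid_adj: "adj i j \<Longrightarrow> compl_braid i j = pos_gen j * pos_gen i"
  by (auto simp add: compl_braid_def compl_def)

lemma compl_braid_far: "i \<noteq> j \<Longrightarrow> \<not> adj i j \<Longrightarrow> compl_braid i j = pos_gen j"
  by (auto simp add: compl_braid_def compl_def)

lemma gen_commute: "i \<noteq> j \<Longrightarrow> \<not> adj i j \<Longrightarrow> pos_gen i * pos_gen j = pos_gen j * pos_gen i"
  using gen_compl[of i j] compl_braid_far[of i j] compl_braid_far[of j i] by auto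

lemma gen_braid: "adj i j \<Longrightarrow>
    pos_gen i * (pos_gen j * pos_gen i) = pos_gen j * (pos_gen i * pos_gen j)"
  using gen_compl[of i j] compl_braid_adj[of i j] compl_braid_adj[of j i] by auto

lemma gen_commute_left:
  "i \<noteq> j \<Longrightarrow> \<not> adj i j \<Longrightarrow> pos_gen i * (pos_gen j * x) = pos_gen j * (pos_gen i * x)"
  by (drule (1) gen_commute, drule arg_cong[where f = "\<lambda>y. y * x"]) (simp only: mult.assoc)

lemma gen_braid_left: "adj i j \<Longrightarrow>
    pos_gen i * (pos_gen j * (pos_gen i * x)) = pos_gen j * (pos_gen i * (pos_gen j * x))"
  by (drule gen_braid, drule arg_cong[where f = "\<lambda>y. y * x"]) (simp only: mult.assoc)

definition exchange_upto :: "nat \<Rightarrow> bool" where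
  "exchange_upto N \<longleftrightarrow> (\<forall>i j a b. word_length a < N \<longrightarrow> pos_gen i * a = pos_gen j * b \<longrightarrow>
     (\<exists>c. a = compl_braid i j * c \<and> b = compl_braid j i * c))"

lemma three_props_cases:
  assumes "\<not> (A \<and> B \<and> C)" "C \<longrightarrow> B"
  obtains "\<not> A" "\<not> B" "\<not> C" | "\<not> A" "B" "\<not> C" | "A" "\<not> B" "\<not> C" | "\<not> A" "B" "C" | "A" "B" "\<not> C"
  using assms by blast

text \<open>
  The step that links three first letters \<open>i\<close>, \<open>k\<close>, \<open>j\<close>. The cases are the possible adjacencies among
  three distinct letters on a line, up to exchanging \<open>i\<close> and \<open>j\<close>; in each of them the exchange property for
  shorter words is used to split off common multiples until the conclusion becomes an identity between explicit words.
\<close>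

lemma cube_condition_aux:
  assumes ex: "exchange_upto N" and len: "word_length (compl_braid k i * a) \<le> N"
    and eq: "compl_braid k i * a = compl_braid k j * b"
    and asym: "adj k j \<longrightarrow> adj k i"
  shows "\<exists>c. compl_braid i k * a = compl_braid i j * c \<and> compl_braid j k * b = compl_braid j i * c"
proof -
  let ?s = pos_gen
  have exch: "\<exists>c. x = compl_braid m n * c \<and> y = compl_braid n m * c"
    if "?s m * x = ?s n * y" "word_length x < N" for m n x y
    using ex that unfolding exchange_upto_def by blast
  have far: "\<exists>c. x = ?s n * c \<and> y = ?s m * c"
    if "?s m * x = ?s n * y" "m \<noteq> n" "\<not> adj m n" "word_length x < N" for m n x y
  proof -
    have "compl_braid m n = ?s n" "compl_braid n m = ?s m"
      using that by (auto intro!: compl_braid_far)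
    then show ?thesis using exch[OF that(1,4)] by simp
  qed
  have near: "\<exists>c. x = ?s n * (?s m * c) \<and> y = ?s m * (?s n * c)"
    if "?s m * x = ?s n * y" "adj m n" "word_length x < N" for m n x y
  proof -
    have "compl_braid m n = ?s n * ?s m" "compl_braid n m = ?s m * ?s n"
      using that by (auto intro!: compl_braid_adj)
    then show ?thesis using exch[OF that(1,3)] by (simp add: mult.assoc)
  qed
  have cancel: "x = y" if "?s m * x = ?s m * y" "word_length x < N" for m x y
    using exch[OF that] by simp
  have lens: "word_length (compl_braid k i) + word_length a \<le> N"
    "word_length (compl_braid k j) + word_length b \<le> N"
    using len eq by (metis word_length_simps(2))+
  note c = gen_commute_left
  note br = gen_braid_left
  consider "k = i" | "k = j" | "i = j" "i \<noteq> k" | "i \<noteq> j" "i \<noteq> k" "j \<noteq> k" by blast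
  then show ?thesis
  proof cases
    case 3
    have "a = b"
    proof (cases "adj k i")
      case True
      then have "?s i * (?s k * a) = ?s i * (?s k * b)" "word_length a + 2 \<le> N"
        using eq lens 3 by (simp_all add: compl_braid_adj mult.assoc)
      then have "?s k * a = ?s k * b" by - (rule cancel[of i], auto)
      then show ?thesis using \<open>word_length a + 2 \<le> N\<close> by - (rule cancel[of k], auto)
    next
      case False
      then show ?thesis
        using eq lens 3 cancel by (auto simp: compl_braid_far)
    qed
    then show ?thesis using 3 by auto
  next
    case 4
    have "\<not> (adj i j \<and> adj k i \<and> adj k j)" using 4 by arith
    then show ?thesis using asym
    proof (cases rule: three_props_cases)
      case 1
      have e: "?s i * a = ?s j * b"
        using eq 1 4 by (simp add: compl_braid_far)
      have "word_length a < N" using lens 1 4 by (simp add: compl_braid_far)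
      from far[OF e 4(1) 1(1) this] obtain d where d: "a = ?s j * d" "b = ?s i * d" by blast
      show ?thesis
        by (rule exI[of _ "?s k * d"]) (use d 1 4 c[of k j] c[of k i] in \<open>simp add: compl_braid_far\<close>)
    next
      case 2
      have e: "?s i * (?s k * a) = ?s j * b"
        using eq 2 4 by (simp add: compl_braid_far compl_braid_adj mult.assoc)
      have l: "word_length a + 2 \<le> N" using lens 2 4 by (simp add: compl_braid_adj)
      obtain x where x: "?s k * a = ?s j * x" "b = ?s i * x"
        using far[OF e 4(1) 2(1)] l by auto
      obtain d where d: "a = ?s j * d" "x = ?s k * d"
        using far[OF x(1)] l 2 4 by auto
      have "?s k * (?s i * (?s j * d)) = ?s j * (?s k * (?s i * d))"
        using c[of i j] c[of k j] 2 4 by metis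
      moreover have "?s k * (?s i * (?s k * d)) = ?s i * (?s k * (?s i * d))"
        using br[of k i] 2 by metis
      ultimately show ?thesis
        by (intro exI[of _ "?s k * (?s i * d)"])
          (use d x 2 4 in \<open>auto simp add: compl_braid_far compl_braid_adj mult.assoc\<close>)
    next
      case 3
      note ne = \<open>i \<noteq> j\<close> \<open>i \<noteq> k\<close> \<open>j \<noteq> k\<close>
      have e: "?s i * a = ?s j * b"
        using eq 3 ne by (simp add: compl_braid_far)
      have l: "word_length a < N" using lens 3 ne by (simp add: compl_braid_far)
      obtain d where d: "a = ?s j * (?s i * d)" "b = ?s i * (?s j * d)"
        using near[OF e 3(1) l] by blast
      have "?s k * (?s j * (?s i * d)) = ?s j * (?s i * (?s k * d))"
        "?s k * (?s i * (?s j * d)) = ?s i * (?s j * (?s k * d))"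
        using c[of k j] c[of k i] 3 ne by metis+
      then show ?thesis
        by (intro exI[of _ "?s k * d"])
          (use d 3 ne in \<open>auto simp add: compl_braid_far compl_braid_adj mult.assoc\<close>)
    next
      case 4
      note ne = \<open>i \<noteq> j\<close> \<open>i \<noteq> k\<close> \<open>j \<noteq> k\<close>
      have e: "?s i * (?s k * a) = ?s j * (?s k * b)"
        using eq 4 ne by (simp add: compl_braid_adj mult.assoc)
      have l: "word_length a + 2 \<le> N" "word_length b + 2 \<le> N"
        using lens 4 ne by (auto simp add: compl_braid_adj)
      obtain x where x: "?s k * a = ?s j * x" "?s k * b = ?s i * x"
        using far[OF e ne(1) 4(1)] l by auto
      obtain d where d: "a = ?s j * (?s k * d)" "x = ?s k * (?s j * d)"
        using near[OF x(1) 4(3)] l by auto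
      obtain f where f: "b = ?s i * (?s k * f)" "x = ?s k * (?s i * f)"
        using near[OF x(2) 4(2)] l by auto
      have "word_length d + 2 \<le> N" using l d by auto
      moreover have "?s j * d = ?s i * f"
        using cancel[of k "?s j * d" "?s i * f"] d f calculation by auto
      ultimately obtain g where g: "d = ?s i * g" "f = ?s j * g"
        using far[of j d i f] 4 ne by auto
      have ij: "?s i * (?s j * x) = ?s j * (?s i * x)" for x
        using c[of i j] 4 ne by metis
      have "?s k * (?s i * (?s j * (?s k * (?s i * g)))) = ?s k * (?s j * (?s i * (?s k * (?s i * g))))"
        using ij by metis
      also have "\<dots> = ?s k * (?s j * (?s k * (?s i * (?s k * g))))"
        using br[of i k] 4 by metis
      also have "\<dots> = ?s j * (?s k * (?s j * (?s i * (?s k * g))))"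
        using br[of k j] 4 by metis
      finally have 1: "?s k * (?s i * a) = ?s j * (?s k * (?s j * (?s i * (?s k * g))))"
        by (simp only: d g)
      have "?s k * (?s j * (?s i * (?s k * (?s j * g)))) = ?s k * (?s i * (?s j * (?s k * (?s j * g))))"
        using ij by metis
      also have "\<dots> = ?s k * (?s i * (?s k * (?s j * (?s k * g))))"
        using br[of j k] 4 by metis
      also have "\<dots> = ?s i * (?s k * (?s i * (?s j * (?s k * g))))"
        using br[of k i] 4 by metis
      finally have 2: "?s k * (?s j * b) = ?s i * (?s k * (?s j * (?s i * (?s k * g))))"
        by (simp only: f g ij)
      show ?thesis
        by (intro exI[of _ "?s k * (?s j * (?s i * (?s k * g)))"])
          (use 1 2 4 ne in \<open>auto simp add: compl_braid_far compl_braid_adj mult.assoc\<close>)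
    next
      case 5
      note ne = \<open>i \<noteq> j\<close> \<open>i \<noteq> k\<close> \<open>j \<noteq> k\<close>
      have e: "?s i * (?s k * a) = ?s j * b"
        using eq 5 ne by (simp add: compl_braid_adj compl_braid_far mult.assoc)
      have l: "word_length a + 2 \<le> N"
        using lens 5 ne by (auto simp add: compl_braid_adj)
      obtain x where x: "?s k * a = ?s j * (?s i * x)" "b = ?s i * (?s j * x)"
        using near[OF e 5(1)] l by auto
      obtain d where d: "a = ?s j * d" "?s i * x = ?s k * d"
        using far[OF x(1)] l 5 ne by auto
      have "word_length x + 2 \<le> N"
        using arg_cong[OF d(1), of word_length] arg_cong[OF d(2), of word_length] l by simp
      then obtain g where g: "x = ?s k * (?s i * g)" "d = ?s i * (?s k * g)"
        using near[OF d(2)] 5 by auto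
      have kj: "?s k * (?s j * x) = ?s j * (?s k * x)" for x
        using c[of k j] 5 ne by metis
      have "?s k * (?s i * (?s j * (?s i * (?s k * g)))) = ?s k * (?s j * (?s i * (?s j * (?s k * g))))"
        using br[of i j] 5 by metis
      also have "\<dots> = ?s j * (?s k * (?s i * (?s k * (?s j * g))))"
        using kj by metis
      also have "\<dots> = ?s j * (?s i * (?s k * (?s i * (?s j * g))))"
        using br[of k i] 5 by metis
      finally have 1: "?s k * (?s i * a) = ?s j * (?s i * (?s k * (?s i * (?s j * g))))"
        by (simp only: d g)
      have "?s k * (?s i * (?s j * (?s k * (?s i * g)))) = ?s k * (?s i * (?s k * (?s j * (?s i * g))))"
        using kj by metis
      also have "\<dots> = ?s i * (?s k * (?s i * (?s j * (?s i * g))))"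
        using br[of k i] 5 by metis
      also have "\<dots> = ?s i * (?s k * (?s j * (?s i * (?s j * g))))"
        using br[of i j] 5 by metis
      also have "\<dots> = ?s i * (?s j * (?s k * (?s i * (?s j * g))))"
        using kj by metis
      finally have 2: "?s k * b = ?s i * (?s j * (?s k * (?s i * (?s j * g))))"
        by (simp only: x g)
      show ?thesis
        by (intro exI[of _ "?s k * (?s i * (?s j * g))"])
          (use 1 2 5 ne in \<open>auto simp add: compl_braid_far compl_braid_adj mult.assoc\<close>)
    qed
  next
    case 1
    then show ?thesis using eq by (intro exI[of _ b]) simp
  next
    case 2
    then show ?thesis using eq by (intro exI[of _ a]) simp
  qed
qed

lemma cube_condition:
  assumes ex: "exchange_upto N" and len: "word_length (compl_braid k i * a) \<le> N"
    and eq: "compl_braid k i * a = compl_braid k j * b"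
  shows "\<exists>c. compl_braid i k * a = compl_braid i j * c \<and> compl_braid j k * b = compl_braid j i * c"
proof (cases "adj k j \<longrightarrow> adj k i")
  case True
  then show ?thesis by (rule cube_condition_aux[OF assms])
next
  case False
  then have "adj k i \<longrightarrow> adj k j" by blast
  with cube_condition_aux[OF ex len[unfolded eq] eq[symmetric]] show ?thesis by blast
qed

lemma pos_step_Cons:
  assumes "pos_step (k # w) x"
  obtains w' where "x = k # w'" "pos_step w w'"
  | j v where "k \<noteq> j" "w = compl k j @ v" "x = j # compl j k @ v"
  using assms
proof (cases rule: pos_step.cases)
  case (1 i j u v)
  show ?thesis
  proof (cases u)
    case Nil
    show ?thesis by (rule that(2)[of j v]) (use 1 Nil in simp_all)
  next
    case (Cons b u')
    have "w = u' @ (i # compl i j) @ v" using 1 Cons by simp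
    then have "pos_step w (u' @ (j # compl j i) @ v)"
      using pos_step.intros[OF \<open>i \<noteq> j\<close>, of u' v] by simp
    then show ?thesis
      by (intro that(1)[of "u' @ (j # compl j i) @ v"]) (use 1 Cons in simp_all)
  qed
qed

text \<open>
  Garside's exchange property, by induction on the length of the words. Along a chain of elementary steps one keeps track of
  how the initial word relates to the first letter of the current one; a step that alters this letter
  is where \<open>cube_condition\<close> enters, with the exchange property for shorter words.
\<close>

lemma exchange_upto: "exchange_upto N"
proof (induction N)
  case 0
  then show ?case by (simp add: exchange_upto_def)
next
  case (Suc N)
  have chain: "\<exists>j v c. x = j # v \<and> word_class u = compl_braid i j * c \<and> word_class v = compl_braid j i * c"
    if "pos_eq (i # u) x" "length u = N" for i u x
    using that(1)
  proof (induction rule: rtranclp_induct)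
    case base
    show ?case by auto
  next
    case (step x y)
    then obtain k w c where x: "x = k # w" "word_class u = compl_braid i k * c"
      "word_class w = compl_braid k i * c" by blast
    have "pos_step (k # w) y" using step x by simp
    then show ?case
    proof (cases rule: pos_step_Cons)
      case (1 w')
      then have "word_class w' = word_class w" by (auto simp: word_class_eq_iff intro: pos_eq_sym)
      then show ?thesis using 1 x by auto
    next
      case (2 j v)
      have l: "length w = N"
        using pos_eq_length[OF step(1)] that(2) x by simp
      have "compl_braid k i * c = compl_braid k j * word_class v"
        using x 2 by (simp add: compl_braid_def)
      moreover have "word_length (compl_braid k i * c) \<le> N"
        using x(3) l by (metis order_refl word_length_simps(4))
      ultimately obtain d where "compl_braid i k * c = compl_braid i j * d"
        "compl_braid j k * word_class v = compl_braid j i * d"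
        using cube_condition[OF Suc] by blast
      then show ?thesis using 2 x by (auto simp: compl_braid_def)
    qed
  qed
  have last: "\<exists>c. a = compl_braid i j * c \<and> b = compl_braid j i * c"
    if len: "word_length a = N" and eq: "pos_gen i * a = pos_gen j * b" for i j a b
  proof -
    obtain u v where uv: "a = word_class u" "b = word_class v" by (metis word_class_surj)
    then have "pos_eq (i # u) (j # v)" "length u = N"
      using eq len by (simp_all flip: word_class_eq_iff)
    from chain[OF this] obtain c where "word_class u = compl_braid i j * c"
      "word_class v = compl_braid j i * c" by blast
    then show ?thesis unfolding uv by (intro exI conjI)
  qed
  show ?case
    unfolding exchange_upto_def
  proof (intro allI impI)
    fix i j a b
    assume "word_length a < Suc N" and eq: "pos_gen i * a = pos_gen j * b"
    then consider "word_length a < N" | "word_length a = N" by linarith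
    then show "\<exists>c. a = compl_braid i j * c \<and> b = compl_braid j i * c"
    proof cases
      case 1
      then show ?thesis by (rule Suc[unfolded exchange_upto_def, rule_format, OF _ eq])
    next
      case 2
      then show ?thesis by (rule last[OF _ eq])
    qed
  qed
qed

text \<open>
  Garside's exchange lemma. Cancellation is the case \<open>i = j\<close>, and for \<open>i \<noteq> j\<close> the lemma exhibits the least
  common multiple of two generators.
\<close>

lemma gen_exchange:
  assumes "pos_gen i * a = pos_gen j * b"
  obtains c where "a = compl_braid i j * c" "b = compl_braid j i * c"
proof -
  have "\<exists>c. a = compl_braid i j * c \<and> b = compl_braid j i * c"
    by (rule exchange_upto[unfolded exchange_upto_def, rule_format, OF lessI assms])
  then show ?thesis by (elim exE conjE) (rule that)
qed

lemma pos_braid_left_cancel: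
  fixes a b c :: pos_braid
  assumes "a * b = a * c"
  shows "b = c"
proof -
  have gen: "b = c" if "pos_gen i * b = pos_gen i * c" for i b c
    by (rule gen_exchange[OF that]) simp
  obtain w where "a = word_class w" by (rule word_class_surj)
  moreover have "word_class w * b = word_class w * c \<Longrightarrow> b = c" for w
    by (induction w) (auto simp: mult.assoc dest: gen)
  ultimately show ?thesis using assms by simp
qed

definition left_lcm :: "pos_braid \<Rightarrow> pos_braid \<Rightarrow> pos_braid \<Rightarrow> bool" where
  "left_lcm m a b \<longleftrightarrow> a dvd m \<and> b dvd m \<and> (\<forall>c. a dvd c \<longrightarrow> b dvd c \<longrightarrow> m dvd c)"

lemma pos_dvd_trans: "a dvd b \<Longrightarrow> b dvd c \<Longrightarrow> a dvd c" for a b c :: pos_braid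
  by (auto simp: dvd_def mult.assoc)

lemma pos_dvd_refl [simp]: "a dvd a" "1 dvd a" for a :: pos_braid
  by (auto simp: dvd_def intro: exI[of _ 1])

lemma pos_dvd_triv [simp]: "a dvd a * b" for a b :: pos_braid
  by (auto simp: dvd_def)

lemma pos_dvd_mult_left [simp]: "a * b dvd a * c \<longleftrightarrow> b dvd c" for a b c :: pos_braid
  by (auto simp: dvd_def mult.assoc dest: pos_braid_left_cancel)

lemma left_lcm_mult: "left_lcm m a b \<Longrightarrow> left_lcm (c * m) (c * a) (c * b)"
  unfolding left_lcm_def by (metis dvd_def mult.assoc pos_dvd_mult_left)

lemma left_lcm_gens:
  assumes "i \<noteq> j"
  shows "left_lcm (pos_gen i * compl_braid i j) (pos_gen i) (pos_gen j)"
  unfolding left_lcm_def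
proof (intro conjI allI impI)
  show "pos_gen j dvd pos_gen i * compl_braid i j"
    unfolding gen_compl[of i j] by simp
  fix c assume "pos_gen i dvd c" "pos_gen j dvd c"
  then obtain a b where "c = pos_gen i * a" "pos_gen i * a = pos_gen j * b"
    by (auto simp: dvd_def)
  then show "pos_gen i * compl_braid i j dvd c"
    using gen_exchange[of i a j b] by (metis dvd_def mult.assoc)
qed simp

text \<open>
  Induction on the length of a common multiple. Elements with the same first letter are reduced to shorter ones by cancelling it.
  For different first letters \<open>i\<close> and \<open>j\<close> with least common multiple \<open>m\<close>, the least common multiples of \<open>m\<close> with \<open>a\<close>
  and of \<open>m\<close> with \<open>b\<close> exist by the first case, and have a common first letter themselves.
\<close>

theorem left_lcm_exists:
  "a dvd c \<Longrightarrow> b dvd c \<Longrightarrow> \<exists>m. left_lcm m a b"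
proof (induction "word_length c" arbitrary: a b c rule: less_induct)
  case less
  have same: "\<exists>m. left_lcm m (pos_gen i * a') (pos_gen i * b')"
    if dvds: "pos_gen i * a' dvd c" "pos_gen i * b' dvd c" for i a' b'
  proof -
    obtain c' where c': "c = pos_gen i * c'" using dvds(1) by (auto simp: dvd_def mult.assoc)
    then have "a' dvd c'" "b' dvd c'" "word_length c' < word_length c"
      using dvds by simp_all
    then show ?thesis using less(1) left_lcm_mult by blast
  qed
  consider "a = 1" | "b = 1" | i a' j b' where "a = pos_gen i * a'" "b = pos_gen j * b'"
    by (metis pos_braid_cases)
  then show ?case
  proof cases
    case 3
    show ?thesis
    proof (cases "i = j")
      case False
      let ?m = "pos_gen i * compl_braid i j"
      have m: "left_lcm ?m (pos_gen i) (pos_gen j)" by (rule left_lcm_gens[OF False])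
      have mj: "?m = pos_gen j * compl_braid j i" by (rule gen_compl)
      have "pos_gen i dvd c" "pos_gen j dvd c"
        using less 3 by (auto simp: dvd_def mult.assoc)
      then have mc: "?m dvd c" using m by (simp add: left_lcm_def)
      obtain m1 where m1: "left_lcm m1 ?m a" using same[of i "compl_braid i j" a'] mc less 3 by auto
      obtain m2 where m2: "left_lcm m2 ?m b" using same[of j "compl_braid j i" b'] mc less 3 mj by auto
      have "m1 dvd c" "m2 dvd c" using m1 m2 mc less by (auto simp: left_lcm_def)
      moreover obtain x y where "m1 = pos_gen i * x" "m2 = pos_gen i * y"
        using m1 m2 by (metis (no_types) left_lcm_def dvd_def mult.assoc)
      ultimately obtain m' where m': "left_lcm m' m1 m2" using same[of i x y] by auto
      have "left_lcm m' a b"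
        unfolding left_lcm_def
      proof (intro conjI allI impI)
        show "a dvd m'" "b dvd m'" using m' m1 m2 unfolding left_lcm_def by (metis pos_dvd_trans)+
        fix x assume ab: "a dvd x" "b dvd x"
        then have "pos_gen i dvd x" "pos_gen j dvd x"
          using 3 by (auto simp: dvd_def mult.assoc)
        then have "?m dvd x" using m by (simp add: left_lcm_def)
        then show "m' dvd x" using ab m1 m2 m' by (simp add: left_lcm_def)
      qed
      then show ?thesis by blast
    next
      case True
      then show ?thesis using same[of i a' b'] less(2,3) 3 by simp
    qed
  next
    case 1
    then show ?thesis by (intro exI[of _ b]) (simp add: left_lcm_def)
  next
    case 2
    then show ?thesis by (intro exI[of _ a]) (simp add: left_lcm_def)
  qed
qed

section \<open>The half twist\<close>

fun descent :: "nat \<Rightarrow> pos_braid" where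
  "descent 0 = 1"
| "descent (Suc k) = pos_gen (Suc k) * descent k"

fun shifted_descent :: "nat \<Rightarrow> pos_braid" where
  "shifted_descent 0 = 1"
| "shifted_descent (Suc k) = pos_gen (Suc (Suc k)) * shifted_descent k"

text \<open>\<open>half_twist m\<close> is the Garside element on \<open>m + 1\<close> strands.\<close>

fun half_twist :: "nat \<Rightarrow> pos_braid" where
  "half_twist 0 = 1"
| "half_twist (Suc m) = half_twist m * descent (Suc m)"

lemma descent_commute: "j \<ge> k + 2 \<Longrightarrow> pos_gen j * descent k = descent k * pos_gen j"
proof (induction k)
  case (Suc k)
  then show ?case
    using gen_commute_left[of j "Suc k" "descent k"] by (simp add: mult.assoc)
qed simp

lemma half_twist_commute: "j \<ge> m + 2 \<Longrightarrow> pos_gen j * half_twist m = half_twist m * pos_gen j"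
proof (induction m)
  case (Suc m)
  have "pos_gen j * half_twist (Suc m) = (pos_gen j * half_twist m) * descent (Suc m)"
    by (simp only: half_twist.simps mult.assoc)
  also have "\<dots> = half_twist m * (pos_gen j * descent (Suc m))"
    using Suc by (simp only: mult.assoc)
  also have "\<dots> = half_twist m * (descent (Suc m) * pos_gen j)"
    using descent_commute[of "Suc m" j] Suc by simp
  finally show ?case by (simp only: half_twist.simps mult.assoc)
qed simp

lemma descent_shift: "1 \<le> i \<Longrightarrow> i < k \<Longrightarrow> pos_gen i * descent k = descent k * pos_gen (Suc i)"
proof (induction k)
  case (Suc k)
  show ?case
  proof (cases "i = k")
    case True
    then obtain l where k: "k = Suc l" using Suc by (cases k) auto
    have "pos_gen k * descent (Suc k) = pos_gen k * (pos_gen (Suc k) * (pos_gen k * descent l))"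
      by (simp add: k)
    also have "\<dots> = pos_gen (Suc k) * (pos_gen k * (pos_gen (Suc k) * descent l))"
      by (rule gen_braid_left) simp
    also have "pos_gen (Suc k) * descent l = descent l * pos_gen (Suc k)"
      by (rule descent_commute) (simp add: k)
    finally show ?thesis using True by (simp add: k mult.assoc)
  next
    case False
    then have "pos_gen i * descent (Suc k) = pos_gen (Suc k) * (pos_gen i * descent k)"
      using Suc gen_commute_left[of i "Suc k"] by simp
    then show ?thesis using Suc False by (simp add: mult.assoc)
  qed
qed simp

lemma descent_descent: "j < k \<Longrightarrow> descent j * descent k = descent k * shifted_descent j"
proof (induction j)
  case (Suc j)
  have "descent (Suc j) * descent k = pos_gen (Suc j) * (descent j * descent k)"
    by (simp add: mult.assoc)
  also have "\<dots> = (pos_gen (Suc j) * descent k) * shifted_descent j"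
    using Suc by (simp add: mult.assoc)
  also have "\<dots> = descent k * shifted_descent (Suc j)"
    using Suc descent_shift[of "Suc j" k] by (simp add: mult.assoc)
  finally show ?case .
qed simp

lemma descent_Suc: "descent (Suc m) = shifted_descent m * pos_gen 1"
  by (induction m) (simp_all add: mult.assoc)

text \<open>
  Commuting a generator through the half twist reverses its index. For \<open>i \<le> m\<close> this follows from the smaller half twist and
  \<open>descent_shift\<close>; for the last generator \<open>i = m + 1\<close>, from the identity
  \<open>\<delta>\<^sub>m\<^sub>+\<^sub>1 \<delta>\<^sub>m\<^sub>+\<^sub>1 = \<delta>\<^sub>m \<delta>\<^sub>m\<^sub>+\<^sub>1 \<sigma>\<^sub>1\<close> for the descending products \<open>\<delta>\<close>.
\<close>

lemma half_twist_gen: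
  "1 \<le> i \<Longrightarrow> i \<le> m \<Longrightarrow> pos_gen i * half_twist m = half_twist m * pos_gen (Suc m - i)"
proof (induction m)
  case (Suc m)
  show ?case
  proof (cases "i \<le> m")
    case True
    have "pos_gen i * half_twist (Suc m) = (pos_gen i * half_twist m) * descent (Suc m)"
      by (simp only: half_twist.simps mult.assoc)
    also have "\<dots> = half_twist m * (pos_gen (Suc m - i) * descent (Suc m))"
      using Suc True by (simp only: mult.assoc)
    also have "pos_gen (Suc m - i) * descent (Suc m) = descent (Suc m) * pos_gen (Suc (Suc m - i))"
      using Suc True by (intro descent_shift) auto
    finally show ?thesis
      using True by (simp only: half_twist.simps mult.assoc Suc_diff_le le_SucI)
  next
    case False
    then have i: "i = Suc m" using Suc by simp
    show ?thesis
    proof (cases m)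
      case (Suc l)
      have "pos_gen (Suc m) * half_twist (Suc m)
          = (pos_gen (Suc m) * half_twist l) * (descent m * descent (Suc m))"
        by (simp only: Suc half_twist.simps mult.assoc)
      also have "\<dots> = half_twist l * (descent (Suc m) * descent (Suc m))"
        using half_twist_commute[of l "Suc m"] Suc by (simp add: mult.assoc)
      also have "descent (Suc m) * descent (Suc m) = (descent (Suc m) * shifted_descent m) * pos_gen 1"
        by (subst (2) descent_Suc) (simp only: mult.assoc)
      also have "\<dots> = descent m * descent (Suc m) * pos_gen 1"
        by (simp only: descent_descent lessI)
      finally show ?thesis
        unfolding i by (simp add: Suc mult.assoc)
    qed (simp add: i)
  qed
qed simp

text \<open>
  The new generator of a larger half twist is brought to the front with \<open>\<delta>\<^sub>m \<delta>\<^sub>m\<^sub>+\<^sub>1 = \<delta>\<^sub>m\<^sub>+\<^sub>1 \<delta>'\<close>, where \<open>\<delta>'\<close> is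
  the shifted descent: it is the first letter of \<open>\<delta>\<^sub>m\<^sub>+\<^sub>1\<close> and commutes with the half twist on two strands less.
\<close>

lemma gen_dvd_half_twist: "1 \<le> i \<Longrightarrow> i \<le> m \<Longrightarrow> pos_gen i dvd half_twist m"
proof (induction m)
  case (Suc m)
  show ?case
  proof (cases "i \<le> m")
    case True
    then show ?thesis using Suc by (auto simp: dvd_def mult.assoc)
  next
    case False
    then have i: "i = Suc m" using Suc by simp
    show ?thesis
    proof (cases m)
      case (Suc l)
      have "half_twist (Suc m) = half_twist l * (descent m * descent (Suc m))"
        by (simp only: Suc half_twist.simps mult.assoc)
      also have "\<dots> = half_twist l * (descent (Suc m) * shifted_descent m)"
        by (simp only: descent_descent lessI)
      also have "\<dots> = (half_twist l * pos_gen (Suc m)) * (descent m * shifted_descent m)"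
        by (simp only: descent.simps mult.assoc)
      also have "half_twist l * pos_gen (Suc m) = pos_gen (Suc m) * half_twist l"
        by (rule half_twist_commute[symmetric]) (simp add: Suc)
      also have "\<dots> * (descent m * shifted_descent m) = pos_gen (Suc m) * (half_twist l * (descent m * shifted_descent m))"
        by (simp only: mult.assoc)
      finally show ?thesis unfolding i dvd_def by blast
    qed (simp add: i)
  qed
qed simp

lemma support_descent: "support (descent k) = {1..k}"
  by (induction k) auto

lemma support_half_twist: "support (half_twist m) = {1..m}"
  by (induction m) (auto simp: support_descent simp del: descent.simps)

section \<open>The positive monoid embeds in the braid group\<close>

definition pos_word :: "nat list \<Rightarrow> braid_word" where
  "pos_word w = map (\<lambda>i. (i, True)) w"

lemma pos_word_append [simp]: "pos_word (v @ w) = pos_word v @ pos_word w"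
  by (simp add: pos_word_def)

lemma pos_word_in_braid_words: "pos_word w \<in> braid_words n \<longleftrightarrow> set w \<subseteq> {1..<n}"
  by (auto simp: pos_word_def braid_words_def)

lemma braid_words_append: "v @ w \<in> braid_words n \<longleftrightarrow> v \<in> braid_words n \<and> w \<in> braid_words n"
  by (auto simp: braid_words_def)

lemma compl_relation:
  assumes "i \<noteq> j" "i \<in> {1..<n}" "j \<in> {1..<n}"
  shows "braid_eq n (pos_word (i # compl i j)) (pos_word (j # compl j i))"
proof -
  consider "j = Suc i" | "i = Suc j" | "i + 2 \<le> j" | "j + 2 \<le> i" using assms by linarith
  then show ?thesis
  proof cases
    case 1
    then show ?thesis using braid_eq.braid[of i n] assms by (simp add: compl_def pos_word_def)
  next
    case 2
    then show ?thesis
      using braid_eq.sym[OF braid_eq.braid[of j n]] assms by (simp add: compl_def pos_word_def)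
  next
    case 3
    then show ?thesis using braid_eq.commute[of i n j] assms by (simp add: compl_def pos_word_def)
  next
    case 4
    then show ?thesis
      using braid_eq.sym[OF braid_eq.commute[of j n i]] assms by (simp add: compl_def pos_word_def)
  qed
qed

lemma pos_step_imp_braid_eq:
  assumes "pos_step u v" "set u \<subseteq> {1..<n}"
  shows "braid_eq n (pos_word u) (pos_word v)"
  using assms
proof (induction rule: pos_step.induct)
  case (1 i j u v)
  have "insert i (set (compl i j)) \<subseteq> {1..<n}" using 1(2) by auto
  then have ij: "i \<in> {1..<n}" "j \<in> {1..<n}" by (simp_all only: set_Cons_compl insert_subset)
  have uv: "pos_word u \<in> braid_words n" "pos_word v \<in> braid_words n"
    using 1(2) by (auto simp: pos_word_in_braid_words)
  show ?case
    unfolding pos_word_append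
    by (intro braid_eq.append braid_eq.refl compl_relation uv ij 1(1))
qed

lemma pos_eq_imp_braid_eq:
  assumes "pos_eq u v" "set u \<subseteq> {1..<n}"
  shows "braid_eq n (pos_word u) (pos_word v)"
  using assms
proof (induction rule: rtranclp_induct)
  case base
  then show ?case by (intro braid_eq.refl) (simp add: pos_word_in_braid_words)
next
  case (step y z)
  then have "set y \<subseteq> {1..<n}" using pos_eq_set by blast
  then show ?case
    using step by (blast intro: braid_eq.trans pos_step_imp_braid_eq)
qed

text \<open>
  The canonical map from the positive monoid to the braid group; it is meaningful on elements supported on \<open>{1..<n}\<close>.
\<close>

definition braid_of :: "nat \<Rightarrow> pos_braid \<Rightarrow> braid" where
  "braid_of n a = braid_class n (pos_word (SOME w. word_class w = a))"

definition full_twist :: "nat \<Rightarrow> pos_braid" where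
  "full_twist n = half_twist (n - 1) * half_twist (n - 1)"

abbreviation supported :: "nat \<Rightarrow> pos_braid \<Rightarrow> bool" where
  "supported n a \<equiv> support a \<subseteq> {1..<n}"

lemma supported_half_twist: "supported n (half_twist (n - 1))"
  by (auto simp: support_half_twist)

lemma supported_full_twist_power: "supported n (full_twist n ^ k)"
  using support_power[of "full_twist n" k] supported_half_twist[of n]
  by (auto simp: full_twist_def)

lemma full_twist_gen:
  assumes "i \<in> {1..<n}"
  shows "pos_gen i * full_twist n = full_twist n * pos_gen i"
proof -
  have 1: "pos_gen i * half_twist (n - 1) = half_twist (n - 1) * pos_gen (n - i)"
    using half_twist_gen[of i "n - 1"] assms by auto
  have 2: "pos_gen (n - i) * half_twist (n - 1) = half_twist (n - 1) * pos_gen i"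
    using half_twist_gen[of "n - i" "n - 1"] assms by auto
  have "pos_gen i * full_twist n = (pos_gen i * half_twist (n - 1)) * half_twist (n - 1)"
    by (simp only: full_twist_def mult.assoc)
  also have "\<dots> = half_twist (n - 1) * (pos_gen (n - i) * half_twist (n - 1))"
    by (simp only: 1 mult.assoc)
  finally show ?thesis by (simp only: 2 full_twist_def mult.assoc)
qed

lemma full_twist_central:
  assumes "supported n a"
  shows "a * full_twist n ^ k = full_twist n ^ k * a"
proof -
  have one: "word_class w * full_twist n = full_twist n * word_class w"
    if "set w \<subseteq> {1..<n}" for w using that
  proof (induction w)
    case (Cons i w)
    have "word_class (i # w) * full_twist n = pos_gen i * (full_twist n * word_class w)"
      using Cons by (simp add: mult.assoc)
    also have "\<dots> = full_twist n * (pos_gen i * word_class w)"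
      using full_twist_gen[of i n] Cons by (simp flip: mult.assoc)
    finally show ?case by simp
  qed simp
  obtain w where w: "a = word_class w" by (rule word_class_surj)
  then have comm: "a * full_twist n = full_twist n * a" using one[of w] assms by simp
  show ?thesis
  proof (induction k)
    case (Suc k)
    have "a * full_twist n ^ Suc k = (a * full_twist n) * full_twist n ^ k"
      by (simp add: mult.assoc)
    also have "\<dots> = full_twist n * (a * full_twist n ^ k)"
      by (simp only: comm mult.assoc)
    finally show ?case by (simp only: Suc power_Suc mult.assoc)
  qed simp
qed

lemma full_twist_cancel:
  assumes "supported n a" "supported n b" "a * full_twist n ^ k = b * full_twist n ^ k"
  shows "a = b"
  using assms pos_braid_left_cancel by (metis full_twist_central)

text \<open>
  The positive element that represents \<open>\<sigma>\<^sub>i\<^sup>-\<^sup>1\<close> up to the central factor \<open>full_twist n\<close>.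
\<close>

definition gen_star :: "nat \<Rightarrow> nat \<Rightarrow> pos_braid" where
  "gen_star n i = (SOME t. full_twist n = pos_gen i * t)"

lemma gen_star:
  assumes "i \<in> {1..<n}"
  shows "pos_gen i * gen_star n i = full_twist n" "gen_star n i * pos_gen i = full_twist n"
    and "supported n (gen_star n i)"
proof -
  have "1 \<le> i" "i \<le> n - 1" using assms by auto
  then obtain t where "half_twist (n - 1) = pos_gen i * t"
    using gen_dvd_half_twist unfolding dvd_def by blast
  then have "full_twist n = pos_gen i * (t * half_twist (n - 1))"
    by (simp add: full_twist_def mult.assoc)
  then show 1: "pos_gen i * gen_star n i = full_twist n"
    unfolding gen_star_def by (metis (mono_tags, lifting) someI)
  then have "pos_gen i * (gen_star n i * pos_gen i) = pos_gen i * full_twist n"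
    using full_twist_gen[OF assms] by (simp flip: mult.assoc)
  then show "gen_star n i * pos_gen i = full_twist n" by (rule pos_braid_left_cancel)
  have "support (gen_star n i) \<subseteq> support (full_twist n)" by (auto simp flip: 1)
  then show "supported n (gen_star n i)" using supported_full_twist_power[of n 1] by simp
qed

text \<open>
  A braid word is evaluated to a positive element by replacing each inverse generator with its star; the number
  of such replacements records the missing power of the full twist.
\<close>

fun eval_word :: "nat \<Rightarrow> braid_word \<Rightarrow> pos_braid" where
  "eval_word n [] = 1"
| "eval_word n ((i, e) # w) = (if e then pos_gen i else gen_star n i) * eval_word n w"

fun neg_count :: "braid_word \<Rightarrow> nat" where
  "neg_count [] = 0"
| "neg_count ((i, e) # w) = (if e then 0 else 1) + neg_count w"

lemma eval_word_append: "eval_word n (v @ w) = eval_word n v * eval_word n w"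
  by (induction v) (auto simp: mult.assoc)

lemma neg_count_append: "neg_count (v @ w) = neg_count v + neg_count w"
  by (induction v) auto

lemma supported_eval_word: "w \<in> braid_words n \<Longrightarrow> supported n (eval_word n w)"
proof (induction w)
  case (Cons a w)
  then show ?case
    using gen_star(3)[of "fst a" n] by (cases a) (auto simp: braid_words_def)
qed simp

lemma eval_word_pos_word: "eval_word n (pos_word w) = word_class w"
  by (induction w) (auto simp: pos_word_def)

lemma neg_count_pos_word: "neg_count (pos_word w) = 0"
  by (induction w) (auto simp: pos_word_def)

text \<open>
  The pair of \<open>eval_word n w\<close> and \<open>neg_count w\<close>, read as a fraction with denominator a power of the
  central full twist, is an invariant of the braid. Hence equal braids with positive words are already equal in the monoid.
\<close>

lemma braid_eq_eval:
  "braid_eq n v w \<Longrightarrow>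
    eval_word n v * full_twist n ^ neg_count w = eval_word n w * full_twist n ^ neg_count v"
proof (induction rule: braid_eq.induct)
  case (trans u v w)
  let ?e = "eval_word n" and ?Z = "\<lambda>w. full_twist n ^ neg_count w"
  have comm: "?Z x * ?Z y = ?Z y * ?Z x" for x y by (simp flip: power_add add: add.commute)
  have sup: "supported n (?e u * ?Z w)" "supported n (?e w * ?Z u)"
    using supported_eval_word[OF braid_eq_words(1)[OF trans.hyps(1)]]
      supported_eval_word[OF braid_eq_words(2)[OF trans.hyps(2)]] supported_full_twist_power
    by auto
  have "(?e u * ?Z w) * ?Z v = (?e u * ?Z v) * ?Z w" by (simp only: mult.assoc comm)
  also have "\<dots> = (?e v * ?Z u) * ?Z w" by (simp only: trans.IH)
  also have "\<dots> = (?e v * ?Z w) * ?Z u" by (simp only: mult.assoc comm[of u w])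
  also have "\<dots> = (?e w * ?Z v) * ?Z u" by (simp only: trans.IH)
  also have "\<dots> = (?e w * ?Z u) * ?Z v" by (simp only: mult.assoc comm[of u v])
  finally show ?case by (rule full_twist_cancel[OF sup])
next
  case (append u u' v v')
  let ?e = "eval_word n" and ?Z = "\<lambda>w. full_twist n ^ neg_count w"
  have v: "supported n (?e v)" and v': "supported n (?e v')"
    using supported_eval_word braid_eq_words[OF append.hyps(2)] by auto
  have "?e u * ?e v * (?Z u' * ?Z v') = ?e u * (?e v * ?Z u') * ?Z v'"
    by (simp only: mult.assoc)
  also have "\<dots> = (?e u * ?Z u') * (?e v * ?Z v')"
    by (simp only: full_twist_central[OF v] mult.assoc)
  also have "\<dots> = ?e u' * (?Z u * ?e v') * ?Z v"
    by (simp only: append.IH mult.assoc)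
  also have "\<dots> = ?e u' * ?e v' * (?Z u * ?Z v)"
    by (simp only: full_twist_central[OF v', symmetric] mult.assoc)
  finally show ?case by (simp only: eval_word_append neg_count_append power_add)
next
  case (cancel i e)
  then show ?case using gen_star by (cases e) auto
next
  case (commute i j)
  then show ?case using gen_commute[of i j] by simp
next
  case (braid i)
  then show ?case using gen_braid[of i "Suc i"] by simp
qed auto

lemma braid_of_word_class:
  assumes "set w \<subseteq> {1..<n}"
  shows "braid_of n (word_class w) = braid_class n (pos_word w)"
proof -
  let ?v = "SOME v. word_class v = word_class w"
  have "word_class ?v = word_class w" by (rule someI) (rule HOL.refl)
  then have "pos_eq w ?v" by (simp add: word_class_eq_iff pos_eq_sym)
  then have "braid_eq n (pos_word w) (pos_word ?v)"
    using assms by (rule pos_eq_imp_braid_eq)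
  then show ?thesis
    unfolding braid_of_def using braid_eq_words braid_class_eq_iff by metis
qed

lemma braid_of_closed:
  assumes "supported n a" shows "braid_of n a \<in> carrier (\<B> n)"
proof -
  obtain w where w: "a = word_class w" by (rule word_class_surj)
  then show ?thesis
    using assms by (auto simp: braid_of_word_class carrier_braid_group pos_word_in_braid_words)
qed

lemma braid_of_mult:
  assumes "supported n a" "supported n b"
  shows "braid_of n (a * b) = braid_of n a \<otimes>\<^bsub>\<B> n\<^esub> braid_of n b"
proof -
  obtain v w where vw: "a = word_class v" "b = word_class w" by (metis word_class_surj)
  then have s: "set v \<subseteq> {1..<n}" "set w \<subseteq> {1..<n}" using assms by auto
  have "braid_of n (word_class (v @ w)) = braid_class n (pos_word v @ pos_word w)"
    using s by (subst braid_of_word_class) auto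
  then show ?thesis
    using s vw by (simp add: braid_of_word_class braid_class_mult pos_word_in_braid_words)
qed

lemma braid_of_1: "braid_of n 1 = \<one>\<^bsub>\<B> n\<^esub>"
  using braid_of_word_class[of "[]" n] by (simp add: pos_word_def braid_group_def)

lemma braid_of_gen: "i \<in> {1..<n} \<Longrightarrow> braid_of n (pos_gen i) = sigma n i"
  using braid_of_word_class[of "[i]" n] by (simp add: pos_word_def sigma_def)

text \<open>Positive words contain no inverse letters, so for them the fractions have denominator \<open>1\<close>.\<close>

lemma braid_of_inject:
  assumes "supported n a" "supported n b" "braid_of n a = braid_of n b"
  shows "a = b"
proof -
  obtain v w where vw: "a = word_class v" "b = word_class w" by (metis word_class_surj)
  then have s: "set v \<subseteq> {1..<n}" "set w \<subseteq> {1..<n}" using assms by auto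
  then have "braid_eq n (pos_word v) (pos_word w)"
    using assms vw braid_class_eq_iff
    by (metis braid_of_word_class pos_word_in_braid_words)
  from braid_eq_eval[OF this] show ?thesis
    by (simp add: vw eval_word_pos_word neg_count_pos_word)
qed

lemma positive_braids_eq: "positive_braids n = braid_of n ` {a. supported n a}"
proof (intro equalityI subsetI)
  fix x assume "x \<in> positive_braids n"
  then show "x \<in> braid_of n ` {a. supported n a}"
  proof (induction rule: positive_braids.induct)
    case one
    then show ?case using braid_of_1[of n] by (intro image_eqI[of _ _ 1]) auto
  next
    case (gen i)
    then show ?case using braid_of_gen[of i n] by (intro image_eqI[of _ _ "pos_gen i"]) auto
  next
    case (mult a b)
    then obtain a' b' where "a = braid_of n a'" "supported n a'" "b = braid_of n b'" "supported n b'"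
      by auto
    then show ?case by (intro image_eqI[of _ _ "a' * b'"]) (auto simp: braid_of_mult)
  qed
next
  fix x assume "x \<in> braid_of n ` {a. supported n a}"
  then obtain a where a: "supported n a" "x = braid_of n a" by auto
  obtain w where w: "a = word_class w" by (rule word_class_surj)
  have "set w \<subseteq> {1..<n} \<Longrightarrow> braid_of n (word_class w) \<in> positive_braids n"
  proof (induction w)
    case Nil
    then show ?case by (simp add: braid_of_1 positive_braids.one)
  next
    case (Cons i w)
    then have "braid_of n (word_class (i # w)) = sigma n i \<otimes>\<^bsub>\<B> n\<^esub> braid_of n (word_class w)"
      by (simp add: braid_of_mult braid_of_gen)
    then show ?case using Cons positive_braids.mult positive_braids.gen by simp
  qed
  then show "x \<in> positive_braids n" using a w by simp
qed

lemma positive_braidE: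
  assumes "x \<in> positive_braids n"
  obtains a where "supported n a" "x = braid_of n a"
  using assms unfolding positive_braids_eq by auto

lemma braid_of_positive: "supported n a \<Longrightarrow> braid_of n a \<in> positive_braids n"
  unfolding positive_braids_eq by blast

definition word_exponent :: "braid_word \<Rightarrow> int" where
  "word_exponent w = int (length w) - 2 * int (neg_count w)"

lemma word_exponent_append: "word_exponent (v @ w) = word_exponent v + word_exponent w"
  by (simp add: word_exponent_def neg_count_append)

lemma braid_eq_exponent: "braid_eq n v w \<Longrightarrow> word_exponent v = word_exponent w"
  by (induction rule: braid_eq.induct) (auto simp: word_exponent_append, auto simp: word_exponent_def)

definition exponent_sum :: "braid \<Rightarrow> int" where
  "exponent_sum x = word_exponent (SOME w. w \<in> x)"

lemma exponent_sum_class: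
  assumes "w \<in> braid_words n" shows "exponent_sum (braid_class n w) = word_exponent w"
proof -
  have "w \<in> braid_class n w"
    using assms by (auto simp: braid_class_def braid_rel_def intro: braid_eq.refl)
  then have "(SOME v. v \<in> braid_class n w) \<in> braid_class n w" by (rule someI)
  then show ?thesis
    unfolding exponent_sum_def using braid_eq_exponent
    by (fastforce simp: braid_class_def braid_rel_def)
qed

lemma exponent_sum_mult:
  assumes "x \<in> carrier (\<B> n)" "y \<in> carrier (\<B> n)"
  shows "exponent_sum (x \<otimes>\<^bsub>\<B> n\<^esub> y) = exponent_sum x + exponent_sum y"
  using assms
  by (auto simp: carrier_braid_group braid_class_mult exponent_sum_class braid_words_append
      word_exponent_append)

lemma exponent_sum_braid_of:
  assumes "supported n a" shows "exponent_sum (braid_of n a) = int (word_length a)"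
proof -
  obtain w where w: "a = word_class w" by (rule word_class_surj)
  then show ?thesis
    using assms by (simp add: braid_of_word_class exponent_sum_class pos_word_in_braid_words
        word_exponent_def neg_count_pos_word) (simp add: pos_word_def)
qed

lemma braid_group_induct [consumes 1, case_names one gen inv_gen]:
  assumes "g \<in> carrier (\<B> n)" and "Q \<one>\<^bsub>\<B> n\<^esub>"
    and "\<And>i g. i \<in> {1..<n} \<Longrightarrow> g \<in> carrier (\<B> n) \<Longrightarrow> Q g \<Longrightarrow> Q (sigma n i \<otimes>\<^bsub>\<B> n\<^esub> g)"
    and "\<And>i g. i \<in> {1..<n} \<Longrightarrow> g \<in> carrier (\<B> n) \<Longrightarrow> Q g \<Longrightarrow>
      Q (inv\<^bsub>\<B> n\<^esub> (sigma n i) \<otimes>\<^bsub>\<B> n\<^esub> g)"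
  shows "Q g"
proof -
  interpret group "\<B> n" by (rule group_braid_group)
  have "Q (braid_class n w)" if "w \<in> braid_words n" for w
    using that
  proof (induction w)
    case Nil
    then show ?case using assms(2) by (simp add: braid_group_def)
  next
    case (Cons a w)
    obtain i e where a: "a = (i, e)" by fastforce
    have i: "i \<in> {1..<n}" and w: "w \<in> braid_words n" and l: "[(i, e)] \<in> braid_words n" for e
      using Cons.prems a by (auto simp: braid_words_def)
    have c: "braid_class n w \<in> carrier (\<B> n)" using w by (auto simp: carrier_braid_group)
    have eq: "braid_class n (a # w) = braid_class n [(i, e)] \<otimes>\<^bsub>\<B> n\<^esub> braid_class n w"
      using l[of e] w by (simp add: braid_class_mult a)
    show ?case
    proof (cases e)
      case True
      then show ?thesis using eq assms(3)[OF i c] Cons w by (simp add: sigma_def)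
    next
      case False
      have "braid_class n [(i, False)] \<otimes>\<^bsub>\<B> n\<^esub> sigma n i = \<one>\<^bsub>\<B> n\<^esub>"
      proof -
        have "braid_class n [(i, False)] \<otimes>\<^bsub>\<B> n\<^esub> sigma n i = braid_class n [(i, False), (i, True)]"
          using braid_class_mult[OF l l, of False True] by (simp add: sigma_def)
        also have "\<dots> = braid_class n []"
          using braid_eq.cancel[OF i, of False] braid_eq_words braid_class_eq_iff by fastforce
        finally show ?thesis by (simp add: braid_group_def)
      qed
      then have "inv\<^bsub>\<B> n\<^esub> (sigma n i) = braid_class n [(i, False)]"
        using inv_equality sigma_closed[OF i] l by (metis carrier_braid_group imageI)
      then show ?thesis using eq assms(4)[OF i c] Cons w False by simp
    qed
  qed
  then show ?thesis using assms(1) by (auto simp: carrier_braid_group)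
qed

lemma braid_prod_sigma:
  assumes "set w \<subseteq> {1..<n}"
  shows "braid_prod n (map (sigma n) w) = braid_of n (word_class w)"
  using assms
proof (induction w)
  case Nil
  then show ?case by (simp add: braid_prod_def braid_of_1)
next
  case (Cons i w)
  then show ?case
    by (simp add: braid_prod_def braid_of_mult braid_of_gen)
qed

lemma word_class_descent: "word_class (rev [1..<Suc k]) = descent k"
  by (induction k) auto

lemma braid_prod_append:
  assumes "set xs \<subseteq> carrier (\<B> n)" "set ys \<subseteq> carrier (\<B> n)"
  shows "braid_prod n (xs @ ys) = braid_prod n xs \<otimes>\<^bsub>\<B> n\<^esub> braid_prod n ys"
proof -
  interpret group "\<B> n" by (rule group_braid_group)
  show ?thesis
    using assms(1)
  proof (induction xs)
    case Nil
    then show ?case using braid_prod_closed[OF assms(2)] by (simp add: braid_prod_def)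
  next
    case (Cons x xs)
    then show ?case
      using braid_prod_closed[OF assms(2)] braid_prod_closed[of xs n]
      by (simp add: braid_prod_def m_assoc)
  qed
qed

lemma Delta_eq_half_twist:
  assumes "n \<ge> 1"
  shows "Delta n = braid_of n (half_twist (n - 1))"
proof -
  interpret group "\<B> n" by (rule group_braid_group)
  have d: "braid_prod n (map (sigma n) (rev [1..<Suc k])) = braid_of n (descent k)" if "k < n" for k
    using that word_class_descent[of k] by (subst braid_prod_sigma) (auto simp del: upt_Suc)
  have s: "supported n (descent k)" if "k < n" for k
    using that by (auto simp: support_descent)
  have "m < n \<Longrightarrow> braid_prod n (map (\<lambda>k. braid_of n (descent k)) [1..<Suc m])
      = braid_of n (half_twist m)" for m
  proof (induction m)
    case 0
    then show ?case by (simp add: braid_prod_def braid_of_1)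
  next
    case (Suc m)
    have sm: "supported n (half_twist m)" using Suc by (auto simp: support_half_twist)
    have "[1..<Suc (Suc m)] = [1..<Suc m] @ [Suc m]" by simp
    then have "braid_prod n (map (\<lambda>k. braid_of n (descent k)) [1..<Suc (Suc m)]) =
        braid_prod n (map (\<lambda>k. braid_of n (descent k)) [1..<Suc m] @ [braid_of n (descent (Suc m))])"
      by (simp only: map_append list.map)
    also have "\<dots> = braid_of n (half_twist m) \<otimes>\<^bsub>\<B> n\<^esub> braid_prod n [braid_of n (descent (Suc m))]"
      using Suc s by (subst braid_prod_append) (auto intro!: braid_of_closed[OF s] simp del: upt_Suc descent.simps)
    also have "\<dots> = braid_of n (half_twist m * descent (Suc m))"
      using s[of "Suc m"] Suc sm
      by (simp add: braid_prod_def braid_of_mult braid_of_closed del: descent.simps)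
    finally show ?case by simp
  qed
  from this[of "n - 1"] have "braid_prod n (map (\<lambda>k. braid_of n (descent k)) [1..<n])
      = braid_of n (half_twist (n - 1))" using assms by simp
  moreover have "map (\<lambda>k. braid_prod n (map (sigma n) (rev [1..<Suc k]))) [1..<n] =
      map (\<lambda>k. braid_of n (descent k)) [1..<n]"
    using d by (intro map_cong) (auto simp del: upt_Suc)
  ultimately show ?thesis unfolding Delta_def by (simp only:)
qed

section \<open>The braid group is a Garside group\<close>

locale braids =
  fixes n :: nat
begin

abbreviation "C \<equiv> carrier (\<B> n)"

abbreviation "Pos \<equiv> positive_braids n"

abbreviation braid_mult :: "braid \<Rightarrow> braid \<Rightarrow> braid" (infixl \<open>\<cdot>\<close> 70) where
  "x \<cdot> y \<equiv> x \<otimes>\<^bsub>\<B> n\<^esub> y"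

abbreviation braid_inv :: "braid \<Rightarrow> braid" (\<open>inv\<^sub>B _\<close> [81] 80) where
  "inv\<^sub>B x \<equiv> inv\<^bsub>\<B> n\<^esub> x"

abbreviation braid_one :: braid (\<open>\<one>\<^sub>B\<close>) where
  "\<one>\<^sub>B \<equiv> \<one>\<^bsub>\<B> n\<^esub>"

abbreviation braid_pow :: "braid \<Rightarrow> 'k::semiring_1 \<Rightarrow> braid" (infixr \<open>[^]\<^sub>B\<close> 75) where
  "x [^]\<^sub>B k \<equiv> x [^]\<^bsub>\<B> n\<^esub> k"

sublocale group "\<B> n"
  by (rule group_braid_group)

lemma braid_of_dvd_iff:
  assumes "supported n a" "supported n b"
  shows "inv\<^sub>B (braid_of n a) \<cdot> braid_of n b \<in> Pos \<longleftrightarrow> a dvd b"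
proof -
  have cl: "braid_of n a \<in> C" "braid_of n b \<in> C"
    using assms by (simp_all only: braid_of_closed)
  show ?thesis
  proof
    assume "inv\<^sub>B (braid_of n a) \<cdot> braid_of n b \<in> Pos"
    then obtain c where c: "supported n c"
      "inv\<^sub>B (braid_of n a) \<cdot> braid_of n b = braid_of n c"
      by (rule positive_braidE)
    then have "braid_of n b = braid_of n a \<cdot> braid_of n c"
      using cl by (metis inv_closed inv_solve_left braid_of_closed)
    then have "braid_of n b = braid_of n (a * c)" using assms c by (simp add: braid_of_mult)
    then have "b = a * c" using assms c by (intro braid_of_inject) auto
    then show "a dvd b" by simp
  next
    assume "a dvd b"
    then obtain c where c: "b = a * c" by (auto simp: dvd_def)
    then have s: "supported n c" using assms by simp
    then have "inv\<^sub>B (braid_of n a) \<cdot> braid_of n b = braid_of n c"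
      using assms cl braid_of_closed[OF s]
      by (simp add: c braid_of_mult m_assoc[symmetric])
    then show "inv\<^sub>B (braid_of n a) \<cdot> braid_of n b \<in> Pos"
      using braid_of_positive[OF s] by simp
  qed
qed

lemma positive_closed: "a \<in> Pos \<Longrightarrow> a \<in> C"
  by (auto elim!: positive_braidE intro: braid_of_closed)

lemma finite_positive_bounded: "finite {a \<in> Pos. exponent_sum a \<le> k}"
proof (rule finite_subset)
  show "{a \<in> Pos. exponent_sum a \<le> k} \<subseteq>
      (\<lambda>w. braid_class n (pos_word w)) ` {w. set w \<subseteq> {1..<n} \<and> length w \<le> nat k}"
  proof
    fix a assume a: "a \<in> {a \<in> Pos. exponent_sum a \<le> k}"
    then obtain b where b: "supported n b" "a = braid_of n b" by (auto elim: positive_braidE)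
    obtain w where w: "b = word_class w" by (rule word_class_surj)
    have "int (length w) \<le> k" using a b w exponent_sum_braid_of[OF b(1)] by simp
    then show "a \<in> (\<lambda>w. braid_class n (pos_word w)) ` {w. set w \<subseteq> {1..<n} \<and> length w \<le> nat k}"
      using b w by (auto simp: braid_of_word_class intro!: image_eqI[of _ _ w])
  qed
qed (intro finite_imageI finite_lists_length_le finite_atLeastLessThan)

lemma sigma_Delta:
  assumes i: "i \<in> {1..<n}"
  shows "sigma n i \<cdot> Delta n = Delta n \<cdot> sigma n (n - i)"
proof -
  have "pos_gen i * half_twist (n - 1) = half_twist (n - 1) * pos_gen (n - i)"
    using half_twist_gen[of i "n - 1"] i by auto
  then have "braid_of n (pos_gen i * half_twist (n - 1)) = braid_of n (half_twist (n - 1) * pos_gen (n - i))"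
    by simp
  moreover have "n - i \<in> {1..<n}" using i by auto
  ultimately show ?thesis
    using i supported_half_twist[of n] by (simp add: braid_of_mult Delta_eq_half_twist braid_of_gen)
qed

lemma sigma_div_Delta:
  assumes i: "i \<in> {1..<n}"
  shows "inv\<^sub>B (sigma n i) \<cdot> Delta n \<in> Pos"
    and "Delta n \<cdot> inv\<^sub>B (sigma n i) \<in> Pos"
proof -
  have 1: "inv\<^sub>B (sigma n i) \<cdot> Delta n \<in> Pos" if i: "i \<in> {1..<n}" for i
  proof -
    have "supported n (pos_gen i)" "pos_gen i dvd half_twist (n - 1)" "n \<ge> 1"
      using i gen_dvd_half_twist[of i "n - 1"] by auto
    then show ?thesis
      using braid_of_dvd_iff[of "pos_gen i" "half_twist (n - 1)"] supported_half_twist[of n]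
      by (simp only: braid_of_gen[OF i] Delta_eq_half_twist simp_thms)
  qed
  show "inv\<^sub>B (sigma n i) \<cdot> Delta n \<in> Pos" by (rule 1[OF i])
  \<comment> \<open>Conjugation by \<open>\<Delta>\<close> exchanges \<open>\<sigma>\<^sub>i\<close> and \<open>\<sigma>\<^sub>n\<^sub>-\<^sub>i\<close>, which turns left divisors into right divisors.\<close>
  let ?j = "n - i"
  have j: "?j \<in> {1..<n}" using i by auto
  have cl: "sigma n i \<in> C" "sigma n ?j \<in> C" "Delta n \<in> C"
    using i j sigma_closed Delta_closed by blast+
  have "sigma n ?j \<cdot> Delta n = Delta n \<cdot> sigma n i"
    using sigma_Delta[OF j] i by simp
  then have "inv\<^sub>B (sigma n ?j) \<cdot> Delta n = Delta n \<cdot> inv\<^sub>B (sigma n i)"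
    using cl by (metis inv_closed inv_solve_left' inv_solve_right' m_assoc m_closed)
  then show "Delta n \<cdot> inv\<^sub>B (sigma n i) \<in> Pos"
    using 1[OF j] by simp
qed

lemma conj_Delta_positive:
  assumes "a \<in> Pos"
  shows "Delta n \<cdot> a \<cdot> inv\<^sub>B (Delta n) \<in> Pos"
    and "inv\<^sub>B (Delta n) \<cdot> a \<cdot> Delta n \<in> Pos"
proof -
  have D: "Delta n \<in> C" by (rule Delta_closed)
  have split: "d \<cdot> (a \<cdot> b) \<cdot> inv\<^sub>B d =
      (d \<cdot> a \<cdot> inv\<^sub>B d) \<cdot> (d \<cdot> b \<cdot> inv\<^sub>B d)"
    if "d \<in> C" "a \<in> C" "b \<in> C" for d a b
  proof -
    have "inv\<^sub>B d \<cdot> (d \<cdot> (b \<cdot> inv\<^sub>B d)) = b \<cdot> inv\<^sub>B d"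
      using that by (simp add: m_assoc[symmetric])
    then show ?thesis using that by (simp add: m_assoc)
  qed
  show "Delta n \<cdot> a \<cdot> inv\<^sub>B (Delta n) \<in> Pos"
    using assms
  proof (induction rule: positive_braids.induct)
    case one
    then show ?case using D positive_braids.one by simp
  next
    case (gen i)
    have j: "n - i \<in> {1..<n}" using gen by auto
    have "sigma n (n - i) \<cdot> Delta n = Delta n \<cdot> sigma n i"
      using sigma_Delta[OF j] gen by simp
    then have "Delta n \<cdot> sigma n i \<cdot> inv\<^sub>B (Delta n) = sigma n (n - i)"
      using D sigma_closed[OF j] sigma_closed[OF gen] by (metis inv_solve_right' m_closed)
    then show ?case using positive_braids.gen[OF j] by simp
  next
    case (mult a b)
    then show ?case using split[OF D] positive_closed positive_braids.mult by metis
  qed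
  show "inv\<^sub>B (Delta n) \<cdot> a \<cdot> Delta n \<in> Pos"
    using assms
  proof (induction rule: positive_braids.induct)
    case one
    then show ?case using D positive_braids.one by simp
  next
    case (gen i)
    have j: "n - i \<in> {1..<n}" using gen by auto
    have "inv\<^sub>B (Delta n) \<cdot> (sigma n i \<cdot> Delta n) = sigma n (n - i)"
      using D sigma_closed[OF j] sigma_closed[OF gen] sigma_Delta[OF gen]
      by (simp add: m_assoc[symmetric])
    then show ?case using positive_braids.gen[OF j] D sigma_closed[OF gen] by (simp add: m_assoc)
  next
    case (mult a b)
    then show ?case using split[of "inv\<^sub>B (Delta n)"] D positive_closed positive_braids.mult
      by (metis inv_closed inv_inv)
  qed
qed

lemma Delta_squared_central:
  assumes "g \<in> C"
  shows "Delta n \<cdot> Delta n \<cdot> g = g \<cdot> (Delta n \<cdot> Delta n)"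
proof -
  let ?Z = "Delta n \<cdot> Delta n"
  have D: "Delta n \<in> C" by (rule Delta_closed)
  have Zs: "?Z \<cdot> sigma n i = sigma n i \<cdot> ?Z" if i: "i \<in> {1..<n}" for i
  proof -
    have j: "n - i \<in> {1..<n}" using i by auto
    have cl: "sigma n i \<in> C" "sigma n (n - i) \<in> C"
      using i j sigma_closed by blast+
    have "sigma n i \<cdot> ?Z = (Delta n \<cdot> sigma n (n - i)) \<cdot> Delta n"
      using sigma_Delta[OF i] cl D by (simp add: m_assoc[symmetric])
    also have "\<dots> = Delta n \<cdot> (Delta n \<cdot> sigma n i)"
      using sigma_Delta[OF j] cl D i by (simp add: m_assoc)
    finally show ?thesis using cl D by (simp add: m_assoc)
  qed
  have comm_mult: "?Z \<cdot> (s \<cdot> g) = (s \<cdot> g) \<cdot> ?Z"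
    if "s \<in> C" "g \<in> C" "?Z \<cdot> s = s \<cdot> ?Z"
      "?Z \<cdot> g = g \<cdot> ?Z" for s g
    using that D by (metis m_assoc m_closed)
  have ZC: "?Z \<in> C" using D by simp
  have Zi: "?Z \<cdot> inv\<^sub>B (sigma n i) = inv\<^sub>B (sigma n i) \<cdot> ?Z"
    if "i \<in> {1..<n}" for i
    using Zs[OF that] sigma_closed[OF that] ZC
    by (metis inv_closed inv_solve_left inv_solve_right m_assoc m_closed)
  show ?thesis
    using assms
  proof (induction rule: braid_group_induct)
    case one
    then show ?case using D by simp
  next
    case (gen i g)
    show ?case
      by (rule comm_mult[OF sigma_closed _ Zs]) (use gen in \<open>blast+\<close>)
  next
    case (inv_gen i g)
    show ?case
      by (rule comm_mult[OF inv_closed[OF sigma_closed] _ Zi]) (use inv_gen in \<open>blast+\<close>)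
  qed
qed

lemma Delta_positive: "n \<ge> 1 \<Longrightarrow> Delta n \<in> Pos"
  using braid_of_positive[OF supported_half_twist] by (simp add: Delta_eq_half_twist)

text \<open>
  Induction on the word of \<open>g\<close>. A power of \<open>\<Delta>\<close> moves past a positive letter up to conjugation, which
  preserves positivity, and one more factor \<open>\<Delta>\<close> absorbs an inverse letter.
\<close>

lemma Delta_power_positive:
  assumes "g \<in> C" "n \<ge> 1"
  shows "\<exists>k::nat. Delta n [^]\<^sub>B k \<cdot> g \<in> Pos"
proof -
  have D: "Delta n \<in> C" by (rule Delta_closed)
  have conj: "Delta n [^]\<^sub>B k \<cdot> (a \<cdot> g) \<in> Pos"
    if a: "a \<in> Pos" and g: "g \<in> C"
      and k: "Delta n [^]\<^sub>B k \<cdot> g \<in> Pos" for a g and k :: nat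
  proof -
    have "\<exists>b\<in>Pos. Delta n [^]\<^sub>B k \<cdot> a = b \<cdot> Delta n [^]\<^sub>B k"
      for k :: nat
    proof (induction k)
      case 0
      then show ?case using a positive_closed by auto
    next
      case (Suc k)
      then obtain b where b: "b \<in> Pos"
        "Delta n [^]\<^sub>B k \<cdot> a = b \<cdot> Delta n [^]\<^sub>B k" by blast
      let ?b = "Delta n \<cdot> b \<cdot> inv\<^sub>B (Delta n)"
      have bc: "b \<in> C" "a \<in> C" using b a positive_closed by auto
      have "Delta n [^]\<^sub>B Suc k \<cdot> a = Delta n \<cdot> (Delta n [^]\<^sub>B k \<cdot> a)"
        using bc D by (simp only: nat_pow_Suc2[OF D] m_assoc nat_pow_closed)
      also have "\<dots> = ?b \<cdot> Delta n [^]\<^sub>B Suc k"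
      proof -
        have "inv\<^sub>B (Delta n) \<cdot> Delta n [^]\<^sub>B Suc k = Delta n [^]\<^sub>B k"
        proof -
          have "inv\<^sub>B (Delta n) \<cdot> (Delta n \<cdot> x) = x"
            if "x \<in> C" for x
            using that D by (simp add: m_assoc[symmetric])
          then show ?thesis by (simp only: nat_pow_Suc2[OF D] nat_pow_closed[OF D])
        qed
        then show ?thesis using bc D by (simp add: b m_assoc del: nat_pow_Suc)
      qed
      finally show ?case using conj_Delta_positive(1)[OF b(1)] by blast
    qed
    then obtain b where b: "b \<in> Pos"
      "Delta n [^]\<^sub>B k \<cdot> a = b \<cdot> Delta n [^]\<^sub>B k" by blast
    have "Delta n [^]\<^sub>B k \<cdot> (a \<cdot> g) = b \<cdot> (Delta n [^]\<^sub>B k \<cdot> g)"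
      using b a g D positive_closed by (simp add: m_assoc[symmetric])
    then show ?thesis using positive_braids.mult[OF b(1) k] by simp
  qed
  show ?thesis
    using assms(1)
  proof (induction rule: braid_group_induct)
    case one
    have "Delta n [^]\<^sub>B (0::nat) \<cdot> \<one>\<^sub>B \<in> Pos"
      using positive_braids.one by simp
    then show ?case by blast
  next
    case (gen i g)
    then show ?case using conj[OF positive_braids.gen] by blast
  next
    case (inv_gen i g)
    then obtain k :: nat where k: "Delta n [^]\<^sub>B k \<cdot> g \<in> Pos" by blast
    have s: "sigma n i \<in> C" using inv_gen sigma_closed by blast
    have "Delta n [^]\<^sub>B Suc k \<cdot> (inv\<^sub>B (sigma n i) \<cdot> g) =
      Delta n [^]\<^sub>B k \<cdot> ((Delta n \<cdot> inv\<^sub>B (sigma n i)) \<cdot> g)"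
      using s D inv_gen by (simp add: m_assoc)
    then have "Delta n [^]\<^sub>B Suc k \<cdot> (inv\<^sub>B (sigma n i) \<cdot> g) \<in> Pos"
      using conj[OF sigma_div_Delta(2) _ k] inv_gen by simp
    then show ?case by blast
  qed
qed

text \<open>
  Multiplication by a high central power \<open>E\<close> of \<open>\<Delta>\<^sup>2\<close> makes \<open>a\<close> and \<open>b\<close> positive, and another power \<open>F\<close> is a common
  multiple of the results. Their least common multiple in the monoid is least among all upper bounds in the group, since
  every upper bound of \<open>E a\<close> is positive too.
\<close>

lemma braid_lub:
  assumes n: "n \<ge> 1" and ab: "a \<in> C" "b \<in> C"
  shows "\<exists>m\<in>C. inv\<^sub>B a \<cdot> m \<in> Pos \<and>
    inv\<^sub>B b \<cdot> m \<in> Pos \<and>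
    (\<forall>c\<in>C. inv\<^sub>B a \<cdot> c \<in> Pos \<longrightarrow>
      inv\<^sub>B b \<cdot> c \<in> Pos \<longrightarrow> inv\<^sub>B m \<cdot> c \<in> Pos)"
proof -
  let ?P = "Pos" and ?D = "Delta n" and ?C = "C"
  have D: "?D \<in> ?C" by (rule Delta_closed)
  have DP: "?D [^]\<^sub>B (k::nat) \<in> ?P" for k
    by (induction k) (auto intro: positive_braids.one positive_braids.mult Delta_positive[OF n])
  define Z where "Z = ?D \<cdot> ?D"
  have ZC: "Z \<in> ?C" using D by (simp add: Z_def)
  have Zpow: "Z [^]\<^sub>B (k::nat) \<cdot> g = g \<cdot> Z [^]\<^sub>B k" if "g \<in> ?C" for k g
  proof (induction k)
    case (Suc k)
    have "Z [^]\<^sub>B Suc k \<cdot> g = Z [^]\<^sub>B k \<cdot> (g \<cdot> Z)"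
      using that ZC Delta_squared_central[OF that] by (simp add: m_assoc flip: Z_def)
    also have "\<dots> = (g \<cdot> Z [^]\<^sub>B k) \<cdot> Z"
      using that ZC Suc by (simp add: m_assoc[symmetric])
    finally show ?case using that ZC by (simp add: m_assoc)
  qed (use that in simp)
  have frac: "\<exists>k::nat. \<forall>l\<ge>k. Z [^]\<^sub>B l \<cdot> g \<in> ?P" if g: "g \<in> ?C" for g
  proof -
    obtain k :: nat where k: "?D [^]\<^sub>B k \<cdot> g \<in> ?P" using Delta_power_positive[OF g n] by blast
    have "Z [^]\<^sub>B l \<cdot> g \<in> ?P" if "l \<ge> k" for l
    proof -
      have "Z = ?D [^]\<^sub>B (2::nat)" using D by (simp add: Z_def numeral_2_eq_2)
      then have "Z [^]\<^sub>B l = ?D [^]\<^sub>B (2 * l)" using D by (simp add: nat_pow_pow)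
      also have "2 * l = (2 * l - k) + k" using that by simp
      finally have "Z [^]\<^sub>B l \<cdot> g = ?D [^]\<^sub>B (2 * l - k) \<cdot> (?D [^]\<^sub>B k \<cdot> g)"
        using D g by (simp add: nat_pow_mult[symmetric] m_assoc)
      then show ?thesis using positive_braids.mult[OF DP k] by simp
    qed
    then show ?thesis by blast
  qed
  obtain k1 :: nat where k1: "\<forall>l\<ge>k1. Z [^]\<^sub>B l \<cdot> a \<in> ?P" using frac[OF ab(1)] by blast
  obtain k2 :: nat where k2: "\<forall>l\<ge>k2. Z [^]\<^sub>B l \<cdot> b \<in> ?P" using frac[OF ab(2)] by blast
  define E where "E = Z [^]\<^sub>B (max k1 k2)"
  have EC: "E \<in> ?C" using ZC by (simp add: E_def)
  obtain a' where a': "supported n a'" "E \<cdot> a = braid_of n a'"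
    using k1[rule_format, of "max k1 k2"] by (auto simp: E_def elim: positive_braidE)
  obtain b' where b': "supported n b'" "E \<cdot> b = braid_of n b'"
    using k2[rule_format, of "max k1 k2"] by (auto simp: E_def elim: positive_braidE)
  have cl: "E \<cdot> a \<in> ?C" "E \<cdot> b \<in> ?C" using EC ab by auto
  obtain l1 :: nat where l1: "\<forall>l\<ge>l1. Z [^]\<^sub>B l \<cdot> inv\<^sub>B (E \<cdot> a) \<in> ?P"
    using frac[OF inv_closed[OF cl(1)]] by blast
  obtain l2 :: nat where l2: "\<forall>l\<ge>l2. Z [^]\<^sub>B l \<cdot> inv\<^sub>B (E \<cdot> b) \<in> ?P"
    using frac[OF inv_closed[OF cl(2)]] by blast
  define F where "F = Z [^]\<^sub>B (max l1 l2)"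
  have ZP: "Z \<in> ?P" unfolding Z_def by (intro positive_braids.mult Delta_positive[OF n])
  have "Z [^]\<^sub>B (k::nat) \<in> ?P" for k
    by (induction k) (simp_all add: positive_braids.one positive_braids.mult ZP)
  then have "F \<in> ?P" unfolding F_def .
  then obtain f where f: "supported n f" "F = braid_of n f" by (rule positive_braidE)
  have "inv\<^sub>B (E \<cdot> a) \<cdot> F \<in> ?P" "inv\<^sub>B (E \<cdot> b) \<cdot> F \<in> ?P"
    using l1[rule_format, of "max l1 l2"] l2[rule_format, of "max l1 l2"] Zpow cl by (simp_all add: F_def)
  then have "a' dvd f" "b' dvd f"
    using braid_of_dvd_iff a' b' f by simp_all
  then obtain m' where m': "left_lcm m' a' b'" using left_lcm_exists by blast
  then have "m' dvd f" using \<open>a' dvd f\<close> \<open>b' dvd f\<close> by (simp add: left_lcm_def)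
  then have sm: "supported n m'" using f by (auto simp: dvd_def)
  define m where "m = inv\<^sub>B E \<cdot> braid_of n m'"
  have mC: "m \<in> ?C" using EC braid_of_closed[OF sm] by (simp add: m_def)
  have Em: "E \<cdot> m = braid_of n m'"
    using EC braid_of_closed[OF sm] by (simp add: m_def m_assoc[symmetric])
  have shift: "inv\<^sub>B (E \<cdot> x) \<cdot> (E \<cdot> y) = inv\<^sub>B x \<cdot> y"
    if "x \<in> ?C" "y \<in> ?C" for x y
  proof -
    have "inv\<^sub>B E \<cdot> (E \<cdot> y) = y" using that EC by (simp add: m_assoc[symmetric])
    then show ?thesis using that EC by (simp add: inv_mult_group m_assoc)
  qed
  have div: "inv\<^sub>B x \<cdot> y \<in> ?P \<longleftrightarrow> x' dvd y'"
    if "x \<in> ?C" "y \<in> ?C" "E \<cdot> x = braid_of n x'" "E \<cdot> y = braid_of n y'"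
      "supported n x'" "supported n y'" for x y x' y'
    unfolding shift[OF that(1,2), symmetric] that(3,4) by (rule braid_of_dvd_iff[OF that(5,6)])
  show ?thesis
  proof (intro bexI[OF _ mC] conjI ballI impI)
    show "inv\<^sub>B a \<cdot> m \<in> ?P" "inv\<^sub>B b \<cdot> m \<in> ?P"
      using div[OF ab(1) mC a'(2) Em a'(1) sm] div[OF ab(2) mC b'(2) Em b'(1) sm] m'
      by (simp_all add: left_lcm_def)
    fix c assume c: "c \<in> ?C" "inv\<^sub>B a \<cdot> c \<in> ?P" "inv\<^sub>B b \<cdot> c \<in> ?P"
    have "E \<cdot> c = (E \<cdot> a) \<cdot> (inv\<^sub>B a \<cdot> c)"
    proof -
      have "a \<cdot> (inv\<^sub>B a \<cdot> c) = c" using c ab by (simp add: m_assoc[symmetric])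
      then show ?thesis using c ab EC by (simp add: m_assoc)
    qed
    then have "E \<cdot> c \<in> ?P"
      using positive_braids.mult[OF _ c(2)] a' braid_of_positive by metis
    then obtain c' where c': "supported n c'" "E \<cdot> c = braid_of n c'" by (rule positive_braidE)
    have "a' dvd c'" "b' dvd c'"
      using div[OF ab(1) c(1) a'(2) c'(2) a'(1) c'(1)] div[OF ab(2) c(1) b'(2) c'(2) b'(1) c'(1)] c
      by simp_all
    then have "m' dvd c'" using m' by (simp add: left_lcm_def)
    then show "inv\<^sub>B m \<cdot> c \<in> ?P"
      using div[OF mC c(1) Em c'(2) sm c'(1)] by simp
  qed
qed

theorem braid_garside_group:
  assumes n: "n \<ge> 2"
  shows "garside_group (\<B> n) (Pos) (Delta n) exponent_sum"
proof -
  have n1: "n \<ge> 1" using n by simp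
  have atom: "\<exists>i\<in>{1..<n}. \<exists>b. supported n b \<and> a = pos_gen i * b" if "supported n a" "a \<noteq> 1" for a
    using that(1)
  proof (cases a rule: pos_braid_cases)
    case (2 i b)
    then show ?thesis using that(1) by (intro bexI[of _ i] exI[of _ b]) auto
  qed (use that in simp)
  have atom_right: "\<exists>i\<in>{1..<n}. \<exists>b. supported n b \<and> a = b * pos_gen i" if "supported n a" "a \<noteq> 1" for a
  proof -
    obtain w where w: "a = word_class w" by (rule word_class_surj)
    show ?thesis
    proof (cases w rule: rev_cases)
      case (snoc v i)
      then show ?thesis using that(1) w by (intro bexI[of _ i] exI[of _ "word_class v"]) auto
    qed (use that w in simp)
  qed
  have sigma_ne: "sigma n i \<noteq> \<one>\<^sub>B" if "i \<in> {1..<n}" for i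
    using braid_of_inject[of "pos_gen i" n 1] that
    by (metis braid_of_1 braid_of_gen empty_subsetI insert_subset support_simps(1,3) word_length_simps(1,3) zero_neq_one)
  show ?thesis
  proof (unfold_locales)
    fix a b g :: braid and k :: int
    show "Pos \<subseteq> C" using positive_closed by blast
    show "\<one>\<^sub>B \<in> Pos" by (rule positive_braids.one)
    show "a \<cdot> b \<in> Pos" if "a \<in> Pos" "b \<in> Pos"
      using that by (rule positive_braids.mult)
    show "Delta n \<in> Pos" by (rule Delta_positive[OF n1])
    show "Delta n \<noteq> \<one>\<^sub>B"
    proof
      assume "Delta n = \<one>\<^sub>B"
      then have "braid_of n (half_twist (n - 1)) = braid_of n 1"
        using Delta_eq_half_twist[OF n1] by (simp add: braid_of_1)
      then have "half_twist (n - 1) = 1"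
        using supported_half_twist by (intro braid_of_inject) auto
      then have "support (half_twist (n - 1)) = {}" by simp
      then show False using n by (simp add: support_half_twist)
    qed
    show "Delta n \<cdot> a \<cdot> inv\<^sub>B (Delta n) \<in> Pos"
      "inv\<^sub>B (Delta n) \<cdot> a \<cdot> Delta n \<in> Pos"
      if "a \<in> Pos"
      using conj_Delta_positive[OF that] by simp_all
    show "Delta n \<cdot> Delta n \<cdot> g = g \<cdot> (Delta n \<cdot> Delta n)"
      if "g \<in> C" by (rule Delta_squared_central[OF that])
    show "exponent_sum (a \<cdot> b) = exponent_sum a + exponent_sum b"
      if "a \<in> C" "b \<in> C" using that by (rule exponent_sum_mult)
    show "0 \<le> exponent_sum a" if "a \<in> Pos"
      using that by (auto elim!: positive_braidE simp: exponent_sum_braid_of)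
    show "a = \<one>\<^sub>B" if "a \<in> Pos" "exponent_sum a = 0"
      using that by (auto elim!: positive_braidE simp: exponent_sum_braid_of word_length_0 braid_of_1)
    show "finite {a \<in> Pos. exponent_sum a \<le> k}" by (rule finite_positive_bounded)
    show "\<exists>s\<in>Pos. s \<noteq> \<one>\<^sub>B \<and> inv\<^sub>B s \<cdot> a \<in> Pos \<and>
        inv\<^sub>B s \<cdot> Delta n \<in> Pos"
      if a: "a \<in> Pos" "a \<noteq> \<one>\<^sub>B"
    proof -
      obtain a' where a': "supported n a'" "a = braid_of n a'" using a(1) by (rule positive_braidE)
      then have "a' \<noteq> 1" using a braid_of_1 by auto
      then obtain i b where i: "i \<in> {1..<n}" "supported n b" "a' = pos_gen i * b"
        using atom a' by blast
      have "inv\<^sub>B (sigma n i) \<cdot> a \<in> Pos"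
        using braid_of_dvd_iff[of "pos_gen i" a'] i a' by (simp add: braid_of_gen)
      then show ?thesis
        using sigma_ne[OF i(1)] sigma_div_Delta(1)[OF i(1)] positive_braids.gen[OF i(1)] by blast
    qed
    show "\<exists>s\<in>Pos. s \<noteq> \<one>\<^sub>B \<and> a \<cdot> inv\<^sub>B s \<in> Pos \<and>
        Delta n \<cdot> inv\<^sub>B s \<in> Pos"
      if a: "a \<in> Pos" "a \<noteq> \<one>\<^sub>B"
    proof -
      obtain a' where a': "supported n a'" "a = braid_of n a'" using a(1) by (rule positive_braidE)
      then have "a' \<noteq> 1" using a braid_of_1 by auto
      then obtain i b where i: "i \<in> {1..<n}" "supported n b" "a' = b * pos_gen i"
        using atom_right a' by blast
      have "a \<cdot> inv\<^sub>B (sigma n i) = braid_of n b"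
        using i a' sigma_closed[OF i(1)] braid_of_closed[OF i(2)]
        by (simp add: braid_of_mult braid_of_gen m_assoc)
      then have "a \<cdot> inv\<^sub>B (sigma n i) \<in> Pos"
        using braid_of_positive[OF i(2)] by simp
      then show ?thesis
        using sigma_ne[OF i(1)] sigma_div_Delta(2)[OF i(1)] positive_braids.gen[OF i(1)] by blast
    qed
    show "\<exists>k::nat. Delta n [^]\<^sub>B k \<cdot> g \<in> Pos" if "g \<in> C"
      by (rule Delta_power_positive[OF that n1])
    show "\<exists>m\<in>C. inv\<^sub>B a \<cdot> m \<in> Pos \<and>
      inv\<^sub>B b \<cdot> m \<in> Pos \<and>
      (\<forall>c\<in>C. inv\<^sub>B a \<cdot> c \<in> Pos \<longrightarrow>
        inv\<^sub>B b \<cdot> c \<in> Pos \<longrightarrow> inv\<^sub>B m \<cdot> c \<in> Pos)"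
      if "a \<in> C" "b \<in> C"
      by (rule braid_lub[OF n1 that])
  qed
qed

section \<open>Ultra summit graphs of braids\<close>

text \<open>
  The arc map sends the label \<open>s\<close> of an arc from \<open>u\<close> to \<open>v\<close> to \<open>(d u)\<^sup>-\<^sup>1 s (d v)\<close>, the only label
  compatible with conjugating the ends by \<open>d u\<close> and \<open>d v\<close>. In the right-handed graph this label points from the image of
  \<open>v\<close> to the image of \<open>u\<close>.
\<close>

lemma digraph_iso_of_correspondence:
  assumes d: "\<And>u. u \<in> USS_L n x \<Longrightarrow> d u \<in> C"
    and L: "USS_L n x \<subseteq> C"
    and F: "\<And>u. u \<in> USS_L n x \<Longrightarrow> F u = inv\<^sub>B (d u) \<cdot> u \<cdot> d u"
    and bij: "bij_betw F (USS_L n x) (USS_R n x)"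
    and simple: "\<And>u v s. \<lbrakk>u \<in> USS_L n x; v \<in> USS_L n x; s \<in> C;
      inv\<^sub>B s \<cdot> u \<cdot> s = v\<rbrakk> \<Longrightarrow>
      s \<in> simple_braids n \<longleftrightarrow> inv\<^sub>B (d u) \<cdot> s \<cdot> d v \<in> simple_braids n"
  shows "digraph_iso (USG_L n x) (op_digraph (USG_R n x))"
proof -
  let ?VL = "USS_L n x" and ?VR = "USS_R n x" and ?C = "C"
  let ?lab = "\<lambda>u s v. inv\<^sub>B (d u) \<cdot> s \<cdot> d v"
  let ?arc = "\<lambda>(u, s, v). (F v, ?lab u s v, F u)"
  let ?h = "\<lparr>iso_verts = F, iso_arcs = ?arc, iso_head = (\<lambda>(u, s, v). u), iso_tail = (\<lambda>(u, s, v). v)\<rparr>"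
  have arcsL: "(u, s, v) \<in> arcs (USG_L n x) \<longleftrightarrow> u \<in> ?VL \<and> v \<in> ?VL \<and> s \<in> simple_braids n \<and>
      inv\<^sub>B s \<cdot> u \<cdot> s = v" for u s v
    by (simp add: USG_L_def)
  have arcsR: "(a, s, b) \<in> arcs (op_digraph (USG_R n x)) \<longleftrightarrow> a \<in> ?VR \<and> b \<in> ?VR \<and> s \<in> simple_braids n \<and>
      s \<cdot> a \<cdot> inv\<^sub>B s = b" for a s b
    by (simp add: USG_R_def op_digraph_def)
  have simpC: "s \<in> ?C" if "s \<in> simple_braids n" for s using that by (simp add: simple_braids_def)
  have FC: "F u \<in> ?C" if "u \<in> ?VL" for u using that F d L by auto
  have lab_conj: "?lab u s v \<cdot> F v \<cdot> inv\<^sub>B (?lab u s v) = F u \<longleftrightarrow>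
      inv\<^sub>B s \<cdot> u \<cdot> s = v"
    if uv: "u \<in> ?VL" "v \<in> ?VL" and s: "s \<in> ?C" for u s v
  proof -
    note cl = d[OF uv(1)] d[OF uv(2)] s subsetD[OF L uv(1)] subsetD[OF L uv(2)]
    have canc: "g \<cdot> (inv\<^sub>B g \<cdot> y) = y" "inv\<^sub>B g \<cdot> (g \<cdot> y) = y"
      if "g \<in> ?C" "y \<in> ?C" for g y
      using that by (simp_all add: m_assoc[symmetric])
    have "?lab u s v \<cdot> F v \<cdot> inv\<^sub>B (?lab u s v) =
        inv\<^sub>B (d u) \<cdot> (s \<cdot> v \<cdot> inv\<^sub>B s) \<cdot> d u"
      using cl by (simp add: F[OF uv(2)] m_assoc inv_mult_group canc)
    then have "?lab u s v \<cdot> F v \<cdot> inv\<^sub>B (?lab u s v) = F u \<longleftrightarrow>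
        s \<cdot> v \<cdot> inv\<^sub>B s = u"
      using cl by (simp add: F[OF uv(1)])
    also have "\<dots> \<longleftrightarrow> inv\<^sub>B s \<cdot> u \<cdot> s = v"
      using cl by (auto simp: m_assoc canc)
    finally show ?thesis .
  qed
  have img: "?arc ` arcs (USG_L n x) = arcs (op_digraph (USG_R n x))"
  proof (intro equalityI subsetI)
    fix t assume "t \<in> ?arc ` arcs (USG_L n x)"
    then obtain u s v where t: "t = ?arc (u, s, v)" and a: "(u, s, v) \<in> arcs (USG_L n x)" by auto
    then have uv: "u \<in> ?VL" "v \<in> ?VL" and s: "s \<in> ?C" "s \<in> simple_braids n"
      and c: "inv\<^sub>B s \<cdot> u \<cdot> s = v"
      using arcsL simpC by auto
    have "F u \<in> ?VR" "F v \<in> ?VR" using uv bij by (auto simp: bij_betw_def)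
    then show "t \<in> arcs (op_digraph (USG_R n x))"
      using lab_conj[OF uv s(1)] simple[OF uv s(1) c] s(2) c by (simp add: t arcsR)
  next
    fix t assume "t \<in> arcs (op_digraph (USG_R n x))"
    moreover obtain a s' b where t: "t = (a, s', b)" by (cases t) auto
    ultimately have r: "a \<in> ?VR" "b \<in> ?VR" "s' \<in> simple_braids n"
      "s' \<cdot> a \<cdot> inv\<^sub>B s' = b" by (auto simp: arcsR)
    have "b \<in> F ` ?VL" "a \<in> F ` ?VL" using r(1,2) bij by (simp_all add: bij_betw_def)
    then obtain u v where uv: "u \<in> ?VL" "v \<in> ?VL" "F u = b" "F v = a" by blast
    define s where "s = d u \<cdot> s' \<cdot> inv\<^sub>B (d v)"
    have cl: "d u \<in> ?C" "d v \<in> ?C" "s' \<in> ?C" using d uv simpC r by auto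
    have sC: "s \<in> ?C" using cl by (simp add: s_def)
    have lab: "?lab u s v = s'"
    proof -
      have "?lab u s v = (inv\<^sub>B (d u) \<cdot> d u) \<cdot> s' \<cdot> (inv\<^sub>B (d v) \<cdot> d v)"
        using cl by (simp only: s_def m_assoc m_closed inv_closed)
      then show ?thesis using cl by simp
    qed
    have c: "inv\<^sub>B s \<cdot> u \<cdot> s = v"
      using lab_conj[OF uv(1,2) sC] r(4) uv by (simp add: lab)
    have "s \<in> simple_braids n" using simple[OF uv(1,2) sC c] r(3) by (simp add: lab)
    then have "(u, s, v) \<in> arcs (USG_L n x)" using uv c by (simp add: arcsL)
    moreover have "t = ?arc (u, s, v)" using t lab uv by simp
    ultimately show "t \<in> ?arc ` arcs (USG_L n x)" by blast
  qed
  have inj: "inj_on ?arc (arcs (USG_L n x))"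
  proof (rule inj_onI)
    fix t t' assume t: "t \<in> arcs (USG_L n x)" "t' \<in> arcs (USG_L n x)" "?arc t = ?arc t'"
    obtain u s v where [simp]: "t = (u, s, v)" by (cases t) auto
    obtain u' s' v' where [simp]: "t' = (u', s', v')" by (cases t') auto
    have m: "u \<in> ?VL" "v \<in> ?VL" "u' \<in> ?VL" "v' \<in> ?VL" "s \<in> ?C" "s' \<in> ?C"
      using t arcsL simpC by auto
    have "F u = F u'" "F v = F v'" using t(3) by auto
    then have uv: "u = u'" "v = v'" using bij m by (auto simp: bij_betw_def inj_on_def)
    have "?lab u s v = ?lab u s' v" using t(3) uv by simp
    then have "s = s'" using m d by simp
    then show "t = t'" using uv by simp
  qed
  have wf: "wf_digraph (USG_L n x)"
    by unfold_locales (auto simp: USG_L_def)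
  have "pre_digraph.digraph_isomorphism (USG_L n x) ?h"
    unfolding pre_digraph.digraph_isomorphism_def
    using wf inj bij by (auto simp: bij_betw_def USG_L_def)
  moreover have "op_digraph (USG_R n x) = app_iso ?h (USG_L n x)"
    using img bij
    by (simp add: app_iso_def bij_betw_def) (simp add: op_digraph_def USG_L_def USG_R_def)
  ultimately show ?thesis unfolding digraph_iso_def by blast
qed

text \<open>
  With at most one strand \<open>\<Delta>\<close> is trivial, so no exponent of \<open>\<Delta>\<close> is maximal. The existence of a left rigid
  braid therefore forces at least two strands.
\<close>

lemma no_left_normal_form:
  assumes "n \<le> 1" shows "\<not> is_left_normal_form n x p xs"
proof
  assume nf: "is_left_normal_form n x p xs"
  have words: "w = []" if "w \<in> braid_words n" for w
    using that assms by (cases w) (auto simp: braid_words_def)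
  have "Delta n = \<one>\<^sub>B" using assms by (auto simp: Delta_def braid_prod_def)
  then have "Delta n [^]\<^sub>B k = \<one>\<^sub>B" for k :: int by simp
  then have "\<forall>q::int. q \<le> p"
    using nf unfolding is_left_normal_form_def by auto
  then have "p + 1 \<le> p" by blast
  then show False by simp
qed

end

locale braid_garside = braids +
  assumes two_strands: "n \<ge> 2"
begin

sublocale L: garside_group "\<B> n" "Pos" "Delta n" exponent_sum
  by (rule braid_garside_group[OF two_strands])

sublocale R: garside_group "opposite (\<B> n)" "Pos" "Delta n" exponent_sum
  by (rule L.garside_group_opposite)

lemma prefix_order_eq: "prefix_order n = L.div_order"
  by (simp add: prefix_order_def L.div_order_def)

lemma suffix_order_eq: "suffix_order n = R.div_order"
  by (simp add: suffix_order_def R.div_order_def)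

lemma prefix_meet: "a \<sqinter>\<^bsub>prefix_order n\<^esub> b = L.mt a b"
  by (simp add: prefix_order_eq L.mt_def)

lemma suffix_meet: "a \<sqinter>\<^bsub>suffix_order n\<^esub> b = R.mt a b"
  by (simp add: suffix_order_eq R.mt_def)

lemma braid_prod_eq: "braid_prod n xs = L.prodl xs"
  by (simp add: braid_prod_def L.prodl_def)

lemma left_normal_form_iff: "is_left_normal_form n x p xs \<longleftrightarrow> L.normal_form x p xs"
  unfolding is_left_normal_form_def L.normal_form_def braid_prod_eq prefix_meet by blast

lemma left_normal_form_eq: "L.normal_form x p xs \<Longrightarrow> left_normal_form n x = (p, xs)"
  unfolding left_normal_form_def left_normal_form_iff by (rule L.normal_form_THE)

lemma opposite_Delta_pow:
  "Delta n [^]\<^bsub>opposite (\<B> n)\<^esub> (k::int) = Delta n [^]\<^sub>B k"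
  by (rule int_pow_opposite[OF Delta_closed])

lemma opposite_prodl_rev:
  "set ys \<subseteq> C \<Longrightarrow> R.prodl (rev ys) = L.prodl ys"
proof -
  have snoc: "set ys \<subseteq> C \<Longrightarrow> y \<in> C \<Longrightarrow> L.prodl (ys @ [y]) = L.prodl ys \<cdot> y" for ys y
    by (induction ys) (auto simp: m_assoc)
  show "set ys \<subseteq> C \<Longrightarrow> R.prodl (rev ys) = L.prodl ys"
    by (induction ys rule: rev_induct) (auto simp: snoc)
qed

lemma right_normal_form_iff: "is_right_normal_form n x ys p \<longleftrightarrow> R.normal_form x p (rev ys)"
proof (cases "set ys \<subseteq> C")
  case True
  let ?m = "length ys"
  let ?Q = "\<lambda>i. ys ! i = R.mt (L.prodl (take (Suc i) ys)) (Delta n) \<and> ys ! i \<noteq> \<one>\<^sub>B"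
  have sub: "set (take k ys) \<subseteq> C" for k using True set_take_subset by fast
  have Q: "(rev ys ! i = R.mt (R.prodl (drop i (rev ys))) (Delta n) \<and> rev ys ! i \<noteq> \<one>\<^sub>B)
      \<longleftrightarrow> ?Q (?m - Suc i)" if "i < ?m" for i
  proof -
    have "Suc (?m - Suc i) = ?m - i" using that by simp
    then have "R.prodl (drop i (rev ys)) = L.prodl (take (Suc (?m - Suc i)) ys)"
      using that opposite_prodl_rev[OF sub] by (simp add: drop_rev)
    then show ?thesis using that by (simp add: rev_nth)
  qed
  have "(\<forall>i<?m. ?Q i) \<longleftrightarrow> (\<forall>i<?m. ?Q (?m - Suc i))"
  proof (intro iffI allI impI)
    fix i assume all: "\<forall>i<?m. ?Q (?m - Suc i)" and i: "i < ?m"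
    have "?m - Suc (?m - Suc i) = i" "?m - Suc i < ?m" using i by auto
    then show "?Q i" using all by metis
  next
    fix i assume all: "\<forall>i<?m. ?Q i" and i: "i < ?m"
    have "?m - Suc i < ?m" using i by auto
    then show "?Q (?m - Suc i)" using all by blast
  qed
  also have "\<dots> \<longleftrightarrow> (\<forall>i<length (rev ys). rev ys ! i = R.mt (R.prodl (drop i (rev ys))) (Delta n) \<and>
      rev ys ! i \<noteq> \<one>\<^sub>B)"
    using Q by auto
  finally show ?thesis
    unfolding is_right_normal_form_def R.normal_form_def braid_prod_eq suffix_meet
    using True by (simp add: opposite_Delta_pow opposite_prodl_rev[OF True])
qed (auto simp: is_right_normal_form_def R.normal_form_def)

lemma right_normal_form_eq:
  assumes "R.normal_form x p zs" shows "right_normal_form n x = (rev zs, p)"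
  unfolding right_normal_form_def
proof (rule the_equality)
  show "case (rev zs, p) of (ys, p) \<Rightarrow> is_right_normal_form n x ys p"
    using assms by (simp add: right_normal_form_iff)
  fix t assume "case t of (ys, p) \<Rightarrow> is_right_normal_form n x ys p"
  then obtain ys p' where t: "t = (ys, p')" "R.normal_form x p' (rev ys)"
    by (auto simp: right_normal_form_iff)
  then show "t = (rev zs, p)"
    using R.normal_form_unique[OF assms t(2)] by auto
qed

lemma iota_L_eq:
  assumes "L.normal_form x p xs" shows "iota_L n x = L.head_factor x p"
  using L.normal_form_head[OF assms]
  by (cases "xs = []") (simp_all add: iota_L_def left_normal_form_eq[OF assms] tau_pow_def)

lemma iota_R_eq:
  assumes "R.normal_form x p zs" shows "iota_R n x = R.head_factor x p"
proof -
  have zs: "set zs \<subseteq> C" using assms by (simp add: R.normal_form_def)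
  show ?thesis
  proof (cases zs)
    case Nil
    then show ?thesis
      using R.normal_form_head[OF assms] by (simp add: iota_R_def right_normal_form_eq[OF assms])
  next
    case (Cons z zs')
    have z: "z \<in> C" using zs Cons by simp
    have "R.head_factor x p = Delta n [^]\<^sub>B (- p) \<cdot> (z \<cdot> Delta n [^]\<^sub>B p)"
      using R.normal_form_head[OF assms] Cons by (simp add: opposite_Delta_pow)
    moreover have "iota_R n x = Delta n [^]\<^sub>B (- p) \<cdot> z \<cdot> Delta n [^]\<^sub>B p"
      using Cons by (simp add: iota_R_def right_normal_form_eq[OF assms] tau_pow_def)
    ultimately show ?thesis using z Delta_closed by (simp add: m_assoc)
  qed
qed

lemma cycling_L_eq:
  assumes "x \<in> C" shows "cycling_L n x = L.cyc x"
proof -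
  obtain p xs where nf: "L.normal_form x p xs" using L.normal_form_exists[OF assms] by blast
  then have "(THE p. L.is_inf x p) = p" using L.is_inf_unique by (auto simp: L.normal_form_alt)
  then show ?thesis by (simp add: cycling_L_def L.cyc_def L.conjby_def iota_L_eq[OF nf])
qed

lemma cycling_R_eq:
  assumes "x \<in> C" shows "cycling_R n x = R.cyc x"
proof -
  obtain p zs where nf: "R.normal_form x p zs" using R.normal_form_exists[of x] assms by auto
  then have "(THE p. R.is_inf x p) = p" using R.is_inf_unique by (auto simp: R.normal_form_alt)
  moreover have "R.head_factor x p \<in> C"
    using R.mt_closed[of "x \<otimes>\<^bsub>opposite (\<B> n)\<^esub> Delta n [^]\<^bsub>opposite (\<B> n)\<^esub> (- p)" "Delta n"] assms
      Delta_closed by (simp add: R.head_factor_def opposite_Delta_pow)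
  ultimately show ?thesis
    using assms by (simp add: cycling_R_def R.cyc_def R.conjby_def iota_R_eq[OF nf] m_assoc)
qed

lemma L_cyc_closed: "x \<in> C \<Longrightarrow> L.cyc x \<in> C"
  by (simp add: L.cyc_def L.head_factor_def Delta_closed)

lemma R_cyc_closed: "x \<in> C \<Longrightarrow> R.cyc x \<in> C"
  using R.conjby_closed[of x] R.mt_closed Delta_closed
  by (simp add: R.cyc_def R.head_factor_def opposite_Delta_pow)

lemma cycling_L_pow: "x \<in> C \<Longrightarrow> (cycling_L n ^^ t) x = (L.cyc ^^ t) x"
proof (induction t arbitrary: x)
  case (Suc t)
  then show ?case by (simp add: funpow_Suc_right cycling_L_eq L_cyc_closed del: funpow.simps)
qed simp

lemma cycling_R_pow: "x \<in> C \<Longrightarrow> (cycling_R n ^^ t) x = (R.cyc ^^ t) x"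
proof (induction t arbitrary: x)
  case (Suc t)
  then show ?case by (simp add: funpow_Suc_right cycling_R_eq R_cyc_closed del: funpow.simps)
qed simp

lemma conjugates_eq: "conjugates n x = L.conj_class x"
  by (auto simp: conjugates_def L.conj_class_def L.conjby_def)

lemma simple_braids_iff:
  "s \<in> simple_braids n \<longleftrightarrow> s \<in> Pos \<and> inv\<^sub>B s \<cdot> Delta n \<in> Pos"
  using positive_closed by (auto simp: simple_braids_def prefix_order_def)

lemma left_rigid_normal_form:
  assumes "left_rigid n y" "y \<in> C"
  obtains p xs where "L.normal_form y p xs" "xs \<noteq> []" "L.rigid y p (p + int (length xs))"
proof -
  obtain p xs where nf: "L.normal_form y p xs" using L.normal_form_exists[OF assms(2)] by blast
  have "xs \<noteq> []" "L.normal_form (Delta n [^]\<^sub>B p \<cdot> L.prodl (xs @ [L.head_factor y p])) p (xs @ [L.head_factor y p])"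
    using assms(1) by (auto simp: left_rigid_def left_normal_form_eq[OF nf] left_normal_form_iff
        braid_prod_eq iota_L_eq[OF nf])
  moreover from this have "L.rigid y p (p + int (length xs))"
    using L.left_rigid_imp_rigid[OF nf] by (auto simp: L.normal_form_alt)
  ultimately show ?thesis using that nf by blast
qed

lemma canonical_length_eq: "L.normal_form x p xs \<Longrightarrow> canonical_length n x = length xs"
  by (simp add: canonical_length_def left_normal_form_eq)

text \<open>
  Canonical length is the difference between the exponents of the least power of \<open>\<Delta>\<close> above and the greatest
  one below an element. Over the conjugacy class both exponents are extremal at \<open>y\<close>, so the length is minimal exactly where both are attained.
\<close>

lemma SSS_eq:
  assumes y: "y \<in> C" "L.normal_form y p ys" and q: "q = p + int (length ys)"
    and ext: "L.extremal y p q" and x: "x \<in> L.conj_class y"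
  shows "SSS n x = {u \<in> L.conj_class y. L.bounded_by u p q}"
proof -
  have cls: "L.conj_class x = L.conj_class y"
  proof -
    have xC: "x \<in> C" using L.conj_class_closed[OF y(1) x] .
    obtain g where "g \<in> C" "L.conjby x g = y" using L.conj_class_sym[OF y(1) x] .
    then have "y \<in> L.conj_class x" by (auto simp: L.conj_class_def)
    then have "L.conj_class y \<subseteq> L.conj_class x"
      using L.conj_class_conjby[OF xC] by (auto simp: L.conj_class_def[of y])
    moreover have "L.conj_class x \<subseteq> L.conj_class y"
      using L.conj_class_conjby[OF y(1) x] by (auto simp: L.conj_class_def[of x])
    ultimately show ?thesis by blast
  qed
  have len: "int (canonical_length n u) \<ge> q - p \<and>
      (int (canonical_length n u) = q - p \<longleftrightarrow> L.bounded_by u p q)"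
    if u: "u \<in> L.conj_class y" for u
  proof -
    have uC: "u \<in> C" using L.conj_class_closed[OF y(1) u] .
    obtain g where g: "g \<in> C" "u = L.conjby y g" using u by (auto simp: L.conj_class_def)
    obtain p' xs where nf: "L.normal_form u p' xs" using L.normal_form_exists[OF uC] by blast
    have swap: "Delta n [^]\<^sub>B (- j) \<cdot> u \<in> Pos \<longleftrightarrow>
        u \<cdot> Delta n [^]\<^sub>B (- j) \<in> Pos" for j :: int
      by (rule L.swap_D_pow[OF uC, symmetric])
    have inf: "u \<cdot> Delta n [^]\<^sub>B (- p') \<in> Pos"
      "\<And>j. u \<cdot> Delta n [^]\<^sub>B (- j) \<in> Pos \<Longrightarrow> j \<le> p'"
      using nf by (auto simp: L.normal_form_alt L.is_inf_def swap)
    have sup: "inv\<^sub>B u \<cdot> Delta n [^]\<^sub>B j \<in> Pos \<longleftrightarrow> p' + int (length xs) \<le> j" for j :: int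
      by (rule L.normal_form_sup[OF nf])
    have p': "p' \<le> p" using ext[unfolded L.extremal_def, THEN bspec, OF g(1)] inf(1) g(2) by blast
    have q': "q \<le> p' + int (length xs)"
      using ext[unfolded L.extremal_def, THEN bspec, OF g(1)] sup[of "p' + int (length xs)"] g(2) by blast
    have "L.bounded_by u p q \<longleftrightarrow> p' = p \<and> p' + int (length xs) = q"
      using inf(1) inf(2)[of p] p' q' sup[of q] by (auto simp: L.bounded_by_def)
    then show ?thesis using p' q' by (auto simp: canonical_length_eq[OF nf])
  qed
  have ycls: "y \<in> L.conj_class y" using y(1) by (auto simp: L.conj_class_def intro!: image_eqI[of _ _ "\<one>\<^sub>B"])
  have leny: "int (canonical_length n y) = q - p" using canonical_length_eq[OF y(2)] q by simp
  show ?thesis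
  proof (intro equalityI subsetI)
    fix u assume "u \<in> SSS n x"
    then have u: "u \<in> L.conj_class y" "canonical_length n u \<le> canonical_length n y"
      using ycls by (auto simp: SSS_def conjugates_eq cls)
    then show "u \<in> {u \<in> L.conj_class y. L.bounded_by u p q}" using len[OF u(1)] leny by auto
  next
    fix u assume u: "u \<in> {u \<in> L.conj_class y. L.bounded_by u p q}"
    have "canonical_length n u \<le> canonical_length n z" if "z \<in> L.conj_class y" for z
      using len[of u] len[OF that] u by auto
    then show "u \<in> SSS n x" using u by (auto simp: SSS_def conjugates_eq cls)
  qed
qed

text \<open>
  If \<open>q - p = 1\<close>, both graphs have the whole super summit set as vertices and the identity of vertices works. Otherwise the ultra summit sets
  are the sets of left and of right rigid conjugates, by the periodicity theorems for the group and for its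
  opposite, and \<open>rigid_correspondence\<close> provides the vertex map.
\<close>

theorem isomorphic_ultra_summit_graphs:
  assumes y: "y \<in> C" "left_rigid n y" and x: "x \<in> L.conj_class y"
  shows "digraph_iso (USG_L n x) (op_digraph (USG_R n x))"
proof -
  obtain p ys where nf: "L.normal_form y p ys" and ne: "ys \<noteq> []"
    and rig: "L.rigid y p (p + int (length ys))"
    using left_rigid_normal_form[OF y(2,1)] .
  define q where "q = p + int (length ys)"
  have pq: "p < q" using ne by (simp add: q_def)
  note rig = rig[folded q_def]
  have ne1: "inv\<^sub>B y \<cdot> Delta n [^]\<^sub>B q \<noteq> \<one>\<^sub>B"
  proof
    assume "inv\<^sub>B y \<cdot> Delta n [^]\<^sub>B q = \<one>\<^sub>B"
    then have "y = Delta n [^]\<^sub>B q"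
      using y(1) Delta_closed by (metis L.cancel_inv(2) int_pow_closed r_one)
    then have "Delta n [^]\<^sub>B (- q) \<cdot> y \<in> Pos"
      using Delta_closed by (simp add: int_pow_neg)
    then have "q \<le> p" using nf by (simp add: L.normal_form_alt L.is_inf_def)
    then show False using pq by simp
  qed
  have ne2: "y \<cdot> Delta n [^]\<^sub>B (- p) \<noteq> \<one>\<^sub>B"
  proof
    assume a: "y \<cdot> Delta n [^]\<^sub>B (- p) = \<one>\<^sub>B"
    then have "y = Delta n [^]\<^sub>B p"
      using y(1) Delta_closed by (metis int_pow_closed int_pow_neg inv_solve_right' l_one one_closed)
    then have "inv\<^sub>B y \<cdot> Delta n [^]\<^sub>B p \<in> Pos"
      using Delta_closed by simp
    then have "q \<le> p" using L.normal_form_sup[OF nf, of p] by (simp add: q_def)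
    then show False using pq by simp
  qed
  have ext: "L.extremal y p q" by (rule L.rigid_extremal[OF rig pq ne1 ne2])
  have SSS: "SSS n x = {u \<in> L.conj_class y. L.bounded_by u p q}"
    by (rule SSS_eq[OF y(1) nf q_def ext x])
  have cC: "u \<in> C" if "u \<in> L.conj_class y" for u using L.conj_class_closed[OF y(1) that] .
  have extu: "L.extremal u p q" if "u \<in> L.conj_class y" for u
    using that L.extremal_conjby[OF ext y(1)] by (auto simp: L.conj_class_def)
  have extR: "R.extremal u p q" if "u \<in> L.conj_class y" for u
    by (rule L.opposite_extremal[OF cC[OF that] extu[OF that]])
  have L_bounded_R: "R.bounded_by u p q \<longleftrightarrow> L.bounded_by u p q" if "u \<in> C" for u
    by (rule L.opposite_bounded_iff[OF that])
  have USSL: "USS_L n x = {u \<in> L.conj_class y. L.bounded_by u p q \<and> (\<exists>t\<ge>1. (L.cyc ^^ t) u = u)}"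
    using cC by (auto simp: USS_L_def SSS cycling_L_pow)
  have USSR: "USS_R n x = {u \<in> L.conj_class y. L.bounded_by u p q \<and> (\<exists>t\<ge>1. (R.cyc ^^ t) u = u)}"
    using cC by (auto simp: USS_R_def SSS cycling_R_pow)
  show ?thesis
  proof (cases "q = p + 1")
    case True
    have "\<exists>t\<ge>1. (L.cyc ^^ t) u = u" if "u \<in> L.conj_class y" "L.bounded_by u p q" for u
      by (rule L.length_one_cyc_periodic[OF cC[OF that(1)] that(2) extu[OF that(1)] True])
    then have UL: "USS_L n x = {u \<in> L.conj_class y. L.bounded_by u p q}" unfolding USSL by blast
    have "\<exists>t\<ge>1. (R.cyc ^^ t) u = u" if "u \<in> L.conj_class y" "L.bounded_by u p q" for u
      using R.length_one_cyc_periodic[of u p q] that cC extR L_bounded_R True by simp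
    then have UR: "USS_R n x = USS_L n x" unfolding USSR UL by blast
    show ?thesis
    proof (rule digraph_iso_of_correspondence[where d = "\<lambda>_. \<one>\<^sub>B" and F = "\<lambda>u. u"])
      show "bij_betw (\<lambda>u. u) (USS_L n x) (USS_R n x)" by (simp add: UR bij_betw_def)
      show "USS_L n x \<subseteq> C" using cC UL by auto
      then show "u = inv\<^sub>B \<one>\<^sub>B \<cdot> u \<cdot> \<one>\<^sub>B" if "u \<in> USS_L n x" for u
        using that by auto
    qed auto
  next
    case False
    then have pq2: "p + 2 \<le> q" using pq by simp
    let ?VL = "{u \<in> L.conj_class y. L.rigid u p q}" and ?VR = "{u \<in> L.conj_class y. L.rrigid u p q}"
    obtain d where d: "\<forall>u\<in>?VL. d u \<in> C" and bij: "bij_betw (\<lambda>u. L.conjby u (d u)) ?VL ?VR"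
      and arr: "\<forall>u\<in>?VL. \<forall>v\<in>?VL. \<forall>s\<in>C. L.conjby u s = v \<longrightarrow>
        (s \<in> Pos \<and> inv\<^sub>B s \<cdot> Delta n \<in> Pos \<longleftrightarrow>
        inv\<^sub>B (d u) \<cdot> s \<cdot> d v \<in> Pos \<and>
        inv\<^sub>B (inv\<^sub>B (d u) \<cdot> s \<cdot> d v) \<cdot> Delta n \<in> Pos)"
      using L.rigid_correspondence[OF y(1) rig] by blast
    have ycls: "y \<in> L.conj_class y"
      using y(1) by (auto simp: L.conj_class_def intro!: image_eqI[of _ _ "\<one>\<^sub>B"])
    have UL: "USS_L n x = {u \<in> L.conj_class y. L.rigid u p q}"
    proof (intro equalityI subsetI)
      fix u assume "u \<in> USS_L n x"
      then obtain t where u: "u \<in> L.conj_class y" "L.bounded_by u p q" "t \<ge> 1" "(L.cyc ^^ t) u = u"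
        unfolding USSL by blast
      obtain w where w: "w \<in> C" "L.conjby u w = y" using L.conj_class_sym[OF y(1) u(1)] .
      have "L.rigid u p q"
        using L.cyc_periodic_imp_rigid[OF cC[OF u(1)] u(2) extu[OF u(1)] pq2 w(1) _ u(3,4)] w rig by simp
      then show "u \<in> {u \<in> L.conj_class y. L.rigid u p q}" using u by simp
    next
      fix u assume "u \<in> {u \<in> L.conj_class y. L.rigid u p q}"
      then have u: "u \<in> L.conj_class y" "L.rigid u p q" by auto
      show "u \<in> USS_L n x"
        using L.rigid_imp_cyc_periodic[OF cC[OF u(1)] extu[OF u(1)] u(2) pq] L.rigid_bounded[OF u(2)] u(1)
        unfolding USSL by blast
    qed
    have UR: "USS_R n x = {u \<in> L.conj_class y. L.rrigid u p q}"
    proof (intro equalityI subsetI)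
      fix u assume "u \<in> USS_R n x"
      then obtain t where u: "u \<in> L.conj_class y" "L.bounded_by u p q" "t \<ge> 1" "(R.cyc ^^ t) u = u"
        unfolding USSR by blast
      let ?v = "L.conjby y (d y)"
      have v: "?v \<in> L.conj_class y" "L.rrigid ?v p q"
        using bij ycls rig unfolding bij_betw_def by auto
      obtain w where w: "w \<in> C" "L.conjby u w = ?v"
      proof -
        obtain w where "w \<in> C" "L.conjby u w = y" using L.conj_class_sym[OF y(1) u(1)] .
        then show ?thesis
          using that[of "w \<cdot> d y"] d ycls rig cC[OF u(1)] by (simp add: L.conjby_mult)
      qed
      have w': "inv\<^sub>B w \<in> carrier (opposite (\<B> n))" "R.rigid (R.conjby u (inv\<^sub>B w)) p q"
        using w v cC[OF u(1)] by (simp_all add: L.opposite_conjby L.opposite_rigid_iff)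
      have "R.rigid u p q"
        using R.cyc_periodic_imp_rigid[of u p q "inv\<^sub>B w" t] cC[OF u(1)] u(2-4) extR[OF u(1)] pq2 w'
          L_bounded_R by simp
      then show "u \<in> {u \<in> L.conj_class y. L.rrigid u p q}" using u by (simp add: L.opposite_rigid_iff)
    next
      fix u assume "u \<in> {u \<in> L.conj_class y. L.rrigid u p q}"
      then have u: "u \<in> L.conj_class y" "L.rrigid u p q" by auto
      have "\<exists>t\<ge>1. (R.cyc ^^ t) u = u"
        using R.rigid_imp_cyc_periodic[of u p q] cC[OF u(1)] extR[OF u(1)] u(2) pq
        by (simp add: L.opposite_rigid_iff)
      then show "u \<in> USS_R n x" using L.rrigid_bounded[OF u(2)] u(1) unfolding USSR by blast
    qed
    show ?thesis
    proof (rule digraph_iso_of_correspondence[where d = d and F = "\<lambda>u. L.conjby u (d u)"])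
      show "d u \<in> C" if "u \<in> USS_L n x" for u using d that unfolding UL by blast
      show "USS_L n x \<subseteq> C" using cC unfolding UL by blast
      show "bij_betw (\<lambda>u. L.conjby u (d u)) (USS_L n x) (USS_R n x)" unfolding UL UR by (rule bij)
      show "s \<in> simple_braids n \<longleftrightarrow> inv\<^sub>B (d u) \<cdot> s \<cdot> d v \<in> simple_braids n"
        if "u \<in> USS_L n x" "v \<in> USS_L n x" "s \<in> C" "inv\<^sub>B s \<cdot> u \<cdot> s = v" for u v s
        unfolding simple_braids_iff using arr that unfolding UL L.conjby_def by blast
    qed (simp add: L.conjby_def)
  qed
qed

end

theorem theorem1p3:
  fixes n :: nat and x :: braid
  assumes "x \<in> carrier (\<B> n)"
    and "canonical_length n x > 1"
    and "\<exists>y\<in>conjugates n x. left_rigid n y"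
  shows "digraph_iso (USG_L n x) (op_digraph (USG_R n x))"
proof -
  interpret G: group "\<B> n" by (rule group_braid_group)
  obtain y where y: "y \<in> conjugates n x" "left_rigid n y" using assms(3) by blast
  obtain g where g: "g \<in> carrier (\<B> n)" "y = inv\<^bsub>\<B> n\<^esub> g \<otimes>\<^bsub>\<B> n\<^esub> x \<otimes>\<^bsub>\<B> n\<^esub> g"
    using y by (auto simp: conjugates_def)
  have yC: "y \<in> carrier (\<B> n)" using g assms(1) by simp
  have "n \<ge> 2"
  proof (rule ccontr)
    assume "\<not> n \<ge> 2"
    then have "n \<le> 1" by simp
    then show False using y(2) braids.no_left_normal_form by (auto simp: left_rigid_def split: prod.splits)
  qed
  then interpret braid_garside n by unfold_locales
  have "x = L.conjby y (inv\<^bsub>\<B> n\<^esub> g)" using g assms(1) by (simp add: L.conjby_def G.m_assoc)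
  then have "x \<in> L.conj_class y" using g(1) by (auto simp: L.conj_class_def)
  then show ?thesis by (rule isomorphic_ultra_summit_graphs[OF yC y(2)])
qed

end
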